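(* Let $\beta_0=\sigma_0+i\tau_0$ ($\sigma_0,\tau_0\in\mathbb{R}$) be such that $\sigma_0>1/\sqrt2$, $\tau_0>0$ and $\sigma_0+\tau_0=\sqrt2$. There exist a complex-valued random variable $\eta$ and a complex sequence $d_N=O(\log n)$ such that for every continuous function $f\colon\mathbb{C}\to\mathbb{R}$ with compact support, $$\sum_{\beta\in\mathbb{C}\colon\mathcal{Z}_N(\beta)=0} f\big(e^{3\pi i/4}\,n(\beta-\beta_0)-d_N\big)\;\longrightarrow\;\sum_{k\in\mathbb{Z}} f\Big(\frac{2\pi i k+\eta}{\sqrt2\,\tau_0}\Big)\qquad\text{in distribution, as }N\to\infty.$$
   Context: Let $X_1,X_2,\ldots$ be independent real standard normal random variables. For $N\in\mathbb{N}$ put $n=\log N$ (natural logarithm) and $\mathcal{Z}_N(\beta)=\sum_{k=1}^N e^{\beta\sqrt n X_k}$, $\beta\in\mathbb{C}$. Sums over zeros count multiplicities. *)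

theory Defs
  imports "HOL-Probability.Probability" "HOL-Complex_Analysis.Complex_Analysis"
begin

definition rem_partition :: "(nat \<Rightarrow> 'a \<Rightarrow> real) \<Rightarrow> nat \<Rightarrow> 'a \<Rightarrow> complex \<Rightarrow> complex" where
  "rem_partition X N \<omega> \<beta> =
     (\<Sum>k=1..N. exp (\<beta> * complex_of_real (sqrt (ln (real N)) * X k \<omega>)))"

(* Each zero is weighted by its multiplicity, zorder F z.  The set of zeros may be
   infinite; for an entire function F that is not identically zero and g of compact
   support, only finitely many terms of the unordered sum are nonzero. *)
definition sum_zeros :: "(complex \<Rightarrow> complex) \<Rightarrow> (complex \<Rightarrow> real) \<Rightarrow> real" where
  "sum_zeros F g = (\<Sum>\<^sub>\<infinity>z\<in>{z. F z = 0}. of_int (zorder F z) * g z)"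

(* The limit may live on a different probability space.  Measurability is part of the
   definition because distr is meaningful only for measurable functions. *)
definition converges_in_distribution ::
  "'a measure \<Rightarrow> (nat \<Rightarrow> 'a \<Rightarrow> real) \<Rightarrow> 'b measure \<Rightarrow> ('b \<Rightarrow> real) \<Rightarrow> bool" where
  "converges_in_distribution M Y M' Y' \<longleftrightarrow>
     (\<forall>N. Y N \<in> borel_measurable M) \<and> Y' \<in> borel_measurable M' \<and>
     weak_conv_m (\<lambda>N. distr M borel (Y N)) (distr M' borel Y')"

end

theory Submission
  imports Defs
begin

text \<open>
  Write \<open>n = ln N\<close>, \<open>L = ln (4 \<pi> n)\<close> and \<open>c = \<surd>2 \<tau>\<^sub>0\<close>, and rescale the energy levels to
  \<open>y\<^sub>k = \<surd>n X\<^sub>k - (\<surd>2 n - L / (2 \<surd>2))\<close>.  Then \<open>N\<close> times the density of \<open>y\<^sub>k\<close> tends to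
  \<open>\<surd>2 exp (- \<surd>2 y)\<close>, the intensity of the extreme levels.  Multiplying the partition function by
  a zero-free factor turns it into \<open>\<Sum>\<^sub>k exp (\<beta> y\<^sub>k)\<close>, which is analysed in the window
  \<open>\<beta> = \<beta>\<^sub>0 + exp (- 3 \<pi> \<i> / 4) (w + d\<^sub>N) / n\<close>, as a sum of its mean and its fluctuation.

  The mean is \<open>exp (n (\<beta> - \<surd>2)\<^sup>2 / 2 + \<beta> L / (2 \<surd>2))\<close>.  On the line \<open>\<sigma>\<^sub>0 + \<tau>\<^sub>0 = \<surd>2\<close> the number
  \<open>(\<beta>\<^sub>0 - \<surd>2)\<^sup>2\<close> is purely imaginary, so up to an oscillation and a power of \<open>n\<close> the mean has
  order one, and \<open>d\<^sub>N = O (ln n)\<close> can be chosen so that the mean tends to \<open>exp (c w)\<close>, uniformly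
  for bounded \<open>w\<close> (\<open>mean_uniform\<close>).  Changing \<open>\<beta>\<close> by \<open>O (ln n / n)\<close> does not change the fluctuation
  in the limit, uniformly in \<open>w\<close> (\<open>deviation_uniform\<close>); at \<open>\<beta>\<^sub>0\<close> itself it converges in
  distribution to a complex random variable \<open>\<zeta>\<close> with infinitely divisible law.  Hence the zeros of the partition
  function are, in the window, close to those of \<open>exp (c w) + \<zeta>\<close>, which are the points
  \<open>(2 \<pi> \<i> k + Ln (- \<zeta>)) / c\<close>; so \<open>\<eta> = Ln (- \<zeta>)\<close>.

  Three ingredients make this precise.  By Rouche's theorem, a sum over zeros of a continuous function
  with compact support depends continuously on the entire function (\<open>sum_zeros_stable\<close>); this
  yields measurability, the passage to the limit, and an estimate that is uniform in \<open>\<zeta>\<close>.  The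
  characteristic function of the centred sum at \<open>\<beta>\<^sub>0\<close> converges, as for stable laws, to the exponential
  of \<open>\<integral> (exp (\<i> \<langle>t, exp (\<beta>\<^sub>0 y)\<rangle>) - 1 - \<i> \<langle>t, exp (\<beta>\<^sub>0 y)\<rangle>) \<surd>2 exp (- \<surd>2 y) dy\<close>
  (\<open>centred_sum_char_tendsto\<close>): the integral converges at \<open>-\<infinity>\<close> because \<open>\<sigma>\<^sub>0 > 1 / \<surd>2\<close> and at
  \<open>\<infinity>\<close> because \<open>\<sigma>\<^sub>0 < \<surd>2\<close>.  The limit decays exponentially in \<open>norm t\<close>, hence is integrable, and
  Fourier inversion with Gaussian smoothing produces the law of \<open>\<zeta>\<close> together with a density
  (\<open>expectation_tendsto\<close>).  The density also shows that \<open>\<zeta> \<noteq> 0\<close> almost surely, so that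
  the logarithm makes sense.
\<close>

section \<open>Sums over zeros depend continuously on the entire function\<close>

lemma finite_zeros_in_cball:
  fixes F :: "complex \<Rightarrow> complex"
  assumes "F holomorphic_on UNIV" "F p \<noteq> 0"
  shows "finite {z \<in> cball a R. F z = 0}"
proof (cases "F constant_on UNIV")
  case True
  then obtain y where "\<And>x. F x = y" unfolding constant_on_def by auto
  with assms(2) have "F z \<noteq> 0" for z by metis
  then show ?thesis by simp
next
  case False
  show ?thesis
    by (rule holomorphic_compact_finite_zeros[of F UNIV "cball a R"]) (use assms False in auto)
qed

lemma eventually_nonzero_entire:
  fixes F :: "complex \<Rightarrow> complex"
  assumes "F holomorphic_on UNIV" "F p \<noteq> 0"
  shows "eventually (\<lambda>w. F w \<noteq> 0) (at z)"
  using non_zero_neighbour_alt[of F UNIV z p] assms by auto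

lemma sum_zeros_eq_sum:
  assumes "F holomorphic_on UNIV" "F p \<noteq> 0" "\<And>z. norm z > R \<Longrightarrow> g z = 0"
    and "finite A" "\<And>z. z \<in> A \<Longrightarrow> F z = 0" "\<And>z. norm z \<le> R \<Longrightarrow> F z = 0 \<Longrightarrow> z \<in> A"
  shows "sum_zeros F g = (\<Sum>z\<in>A. of_int (zorder F z) * g z)"
proof -
  have "sum_zeros F g = (\<Sum>\<^sub>\<infinity>z\<in>A. of_int (zorder F z) * g z)"
    unfolding sum_zeros_def
  proof (rule infsum_cong_neutral)
    fix x assume "x \<in> {z. F z = 0} - A"
    then have "norm x > R" using assms(6)[of x] by force
    then show "of_int (zorder F x) * g x = 0" using assms(3) by simp
  qed (use assms in auto)
  then show ?thesis using assms by simp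
qed

text \<open>
  Rouche's theorem for a circle, with zero counts instead of winding numbers: the disc of radius
  \<open>r + 1\<close> serves as the surrounding domain, and the zeros in it but outside the circle have winding
  number zero.
\<close>

lemma Rouche_circle:
  fixes F G :: "complex \<Rightarrow> complex"
  assumes F: "F holomorphic_on UNIV" and G: "G holomorphic_on UNIV" and r: "0 < r"
    and less: "\<And>z. z \<in> sphere a r \<Longrightarrow> norm (G z - F z) < norm (F z)"
  shows "(\<Sum>p\<in>{p \<in> ball a r. G p = 0}. zorder G p) = (\<Sum>p\<in>{p \<in> ball a r. F p = 0}. zorder F p)"
proof -
  define q where "q = a + of_real r"
  have q: "q \<in> sphere a r" using r by (simp add: q_def dist_norm)
  have nzF: "F z \<noteq> 0" and nzG: "G z \<noteq> 0" if "z \<in> sphere a r" for z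
    using less[OF that] by auto
  have fin: "finite {p \<in> ball a (r+1). H p = 0}" if "H holomorphic_on UNIV" "H q \<noteq> 0" for H
    by (rule finite_subset[OF _ finite_zeros_in_cball[OF that, of a "r+1"]]) auto
  have R: "(\<Sum>p\<in>{p\<in>ball a (r+1). F p + (G p - F p) = 0}. winding_number (circlepath a r) p * zorder (\<lambda>p. F p + (G p - F p)) p)
      = (\<Sum>p\<in>{p\<in>ball a (r+1). F p = 0}. winding_number (circlepath a r) p * zorder F p)"
  proof (rule Rouche_theorem)
    show "finite {p \<in> ball a (r + 1). F p + (G p - F p) = 0}" "finite {p \<in> ball a (r + 1). F p = 0}"
      using fin[OF G nzG[OF q]] fin[OF F nzF[OF q]] by auto
    show "\<forall>z. z \<notin> ball a (r + 1) \<longrightarrow> winding_number (circlepath a r) z = 0"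
      using r by (auto intro!: winding_number_zero_outside[where s="cball a r"])
  qed (use F G r less in \<open>auto intro!: holomorphic_intros intro: holomorphic_on_subset\<close>)
  have S: "(\<Sum>p\<in>{p\<in>ball a (r+1). H p = 0}. winding_number (circlepath a r) p * of_int (zorder H p))
      = of_int (\<Sum>p\<in>{p \<in> ball a r. H p = 0}. zorder H p)"
    if H: "H holomorphic_on UNIV" and nz: "\<And>z. z \<in> sphere a r \<Longrightarrow> H z \<noteq> 0" for H
  proof -
    have "(\<Sum>p\<in>{p\<in>ball a (r+1). H p = 0}. winding_number (circlepath a r) p * of_int (zorder H p))
      = (\<Sum>p\<in>{p\<in>ball a r. H p = 0}. winding_number (circlepath a r) p * of_int (zorder H p))"
    proof (rule sum.mono_neutral_right)
      show "finite {p\<in>ball a (r+1). H p = 0}" using fin[OF H nz[OF q]] .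
      show "\<forall>i\<in>{p \<in> ball a (r + 1). H p = 0} - {p \<in> ball a r. H p = 0}.
       winding_number (circlepath a r) i * of_int (zorder H i) = 0"
      proof
        fix i assume "i \<in> {p \<in> ball a (r + 1). H p = 0} - {p \<in> ball a r. H p = 0}"
        then have "H i = 0" "i \<notin> ball a r" by auto
        then have "i \<notin> cball a r" using nz[of i] by (auto simp: less_le)
        then have "winding_number (circlepath a r) i = 0"
          using r by (intro winding_number_zero_outside[where s="cball a r"]) auto
        then show "winding_number (circlepath a r) i * of_int (zorder H i) = 0" by simp
      qed
    qed auto
    also have "\<dots> = (\<Sum>p\<in>{p\<in>ball a r. H p = 0}. of_int (zorder H p))"
      by (intro sum.cong refl) (auto simp: winding_number_circlepath dist_norm norm_minus_commute)
    finally show ?thesis by simp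
  qed
  have "of_int (\<Sum>p\<in>{p \<in> ball a r. G p = 0}. zorder G p) = (of_int (\<Sum>p\<in>{p \<in> ball a r. F p = 0}. zorder F p) :: complex)"
    using R S[OF F nzF] S[OF G nzG] by simp
  then show ?thesis by (rule of_int_eq_iff[THEN iffD1])
qed

text \<open>
  Small discs around the zeros of \<open>F\<close> in the support of \<open>g\<close> isolate these zeros.  Off the discs, and on their
  boundaries, \<open>F\<close> is bounded away from zero, so a close entire function \<open>G\<close> has no zeros there and,
  by Rouche's theorem, equally many zeros in each disc, where \<open>g\<close> is almost constant.  The discs
  may stick out of the ball of radius \<open>R\<close>, which is why closeness is needed on a slightly larger ball.
\<close>

theorem sum_zeros_stable:
  fixes F :: "complex \<Rightarrow> complex" and g :: "complex \<Rightarrow> real"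
  assumes F: "F holomorphic_on UNIV" and F0: "F p \<noteq> 0"
    and g: "continuous_on UNIV g" "\<And>z. norm z > R \<Longrightarrow> g z = 0" and R: "R \<ge> 0" and e: "\<epsilon> > 0"
  shows "\<exists>\<delta>>0. \<forall>G. G holomorphic_on UNIV \<longrightarrow> (\<forall>z\<in>cball 0 (R+1). norm (G z - F z) < \<delta>) \<longrightarrow>
       \<bar>sum_zeros G g - sum_zeros F g\<bar> < \<epsilon>"
proof -
  define Z where "Z = {z \<in> cball 0 R. F z = 0}"
  have finZ: "finite Z" unfolding Z_def by (rule finite_zeros_in_cball[OF F F0])
  have zpos: "zorder F z \<ge> 0" for z
    by (rule zorder_ge_0)
       (use F eventually_nonzero_entire[OF F F0, of z] in \<open>auto intro: eventually_frequently simp: analytic_on_open analytic_at_two intro!: holomorphic_on_imp_analytic_at[of _ UNIV]\<close>)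
  define m where "m = real_of_int (\<Sum>z\<in>Z. zorder F z)"
  have m: "m \<ge> 0" unfolding m_def using zpos by (simp add: sum_nonneg)
  define e' where "e' = \<epsilon> / (m + 1)"
  have e': "e' > 0" using e m by (simp add: e'_def)
  have "eventually (\<lambda>r. r < 1 \<and> (\<forall>z\<in>Z. (\<forall>w\<in>cball z r. F w = 0 \<longrightarrow> w = z) \<and> (\<forall>w\<in>cball z r. \<bar>g w - g z\<bar> < e')
      \<and> (\<forall>z'\<in>Z. z' \<noteq> z \<longrightarrow> 2 * r < dist z z'))) (at_right 0)"
  proof (intro eventually_conj eventually_ball_finite ballI)
    show "eventually (\<lambda>r::real. r < 1) (at_right 0)" by (simp add: eventually_at_right_field) (meson zero_less_one)
  next
    show "finite Z" by fact
  next
    fix z assume "z \<in> Z"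
    have "eventually (\<lambda>w. F w \<noteq> 0) (at z)" by (rule eventually_nonzero_entire[OF F F0])
    then obtain d where d: "d > 0" "\<And>w. w \<noteq> z \<Longrightarrow> dist w z < d \<Longrightarrow> F w \<noteq> 0" unfolding eventually_at by auto
    show "\<forall>\<^sub>F r in at_right 0. \<forall>w\<in>cball z r. F w = 0 \<longrightarrow> w = z" unfolding eventually_at_right_field
      using d by (intro exI[of _ d]) (fastforce simp: dist_commute)
    have "isCont g z" using g(1) by (simp add: continuous_on_eq_continuous_at)
    then obtain d where d: "d > 0" "\<And>w. dist w z < d \<Longrightarrow> \<bar>g w - g z\<bar> < e'"
      using e' unfolding continuous_at_eps_delta by (auto simp: dist_real_def)
    show "\<forall>\<^sub>F r in at_right 0. \<forall>w\<in>cball z r. \<bar>g w - g z\<bar> < e'" unfolding eventually_at_right_field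
      using d by (intro exI[of _ d]) (auto simp: dist_commute intro: le_less_trans)
    fix z' assume "z' \<in> Z"
    show "\<forall>\<^sub>F r in at_right 0. z' \<noteq> z \<longrightarrow> 2 * r < dist z z'"
    proof (cases "z' = z")
      case False
      then show ?thesis unfolding eventually_at_right_field by (intro exI[of _ "dist z z'/2"]) auto
    qed simp
  qed (rule finZ)
  then have "\<exists>r. 0 < r \<and> r < 1 \<and> (\<forall>z\<in>Z. (\<forall>w\<in>cball z r. F w = 0 \<longrightarrow> w = z) \<and> (\<forall>w\<in>cball z r. \<bar>g w - g z\<bar> < e')
      \<and> (\<forall>z'\<in>Z. z' \<noteq> z \<longrightarrow> 2 * r < dist z z'))"
    by (rule eventually_happens'[OF trivial_limit_at_right_real eventually_conj[OF eventually_at_right_less]])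
  then obtain r where r: "0 < r" "r < 1" and iso: "\<And>z w. z \<in> Z \<Longrightarrow> w \<in> cball z r \<Longrightarrow> F w = 0 \<Longrightarrow> w = z"
    and gr: "\<And>z w. z \<in> Z \<Longrightarrow> w \<in> cball z r \<Longrightarrow> \<bar>g w - g z\<bar> < e'"
    and sep: "\<And>z z'. z \<in> Z \<Longrightarrow> z' \<in> Z \<Longrightarrow> z' \<noteq> z \<Longrightarrow> 2 * r < dist z z'" by blast
  define K where "K = (cball 0 R - (\<Union>z\<in>Z. ball z r)) \<union> (\<Union>z\<in>Z. sphere z r)"
  have K: "compact K" unfolding K_def using finZ
    by (intro compact_Un compact_diff compact_UN) auto
  have KR: "K \<subseteq> cball 0 (R+1)"
  proof
    fix w assume "w \<in> K"
    then consider "w \<in> cball 0 R" | z where "z \<in> Z" "dist z w = r" unfolding K_def by auto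
    then show "w \<in> cball 0 (R+1)"
    proof cases
      case 2
      then have "norm z \<le> R" unfolding Z_def by auto
      then show ?thesis using 2 r norm_triangle_ineq[of z "w - z"] by (auto simp: dist_norm norm_minus_commute)
    qed auto
  qed
  have KF: "F w \<noteq> 0" if "w \<in> K" for w
  proof
    assume Fw: "F w = 0"
    from that consider "w \<in> cball 0 R" "w \<notin> (\<Union>z\<in>Z. ball z r)" | z where "z \<in> Z" "dist z w = r" unfolding K_def by auto
    then show False
    proof cases
      case 1 then have "w \<in> Z" using Fw unfolding Z_def by auto
      with 1 show False using r by auto
    next
      case 2 then show False using iso[of z w] r Fw by auto
    qed
  qed
  have Kne: "K \<noteq> {}"
  proof (cases "Z = {}")
    case True then show ?thesis unfolding K_def using R by auto
  next
    case False then show ?thesis unfolding K_def using r by (auto simp: sphere_eq_empty ex_in_conv)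
  qed
  obtain w0 where w0: "w0 \<in> K" "\<And>w. w \<in> K \<Longrightarrow> norm (F w0) \<le> norm (F w)"
    using continuous_attains_inf[OF K Kne, of "\<lambda>w. norm (F w)"]
      holomorphic_on_imp_continuous_on[OF F] by (auto intro!: continuous_intros intro: continuous_on_subset)
  show ?thesis
  proof (intro exI[of _ "norm (F w0)"] conjI allI impI)
    show "norm (F w0) > 0" using KF[OF w0(1)] by simp
    fix G :: "complex \<Rightarrow> complex" assume G: "G holomorphic_on UNIV" and "\<forall>z\<in>cball 0 (R+1). norm (G z - F z) < norm (F w0)"
    then have GF: "\<And>z. z \<in> cball 0 (R+1) \<Longrightarrow> norm (G z - F z) < norm (F w0)" by blast
    have less: "norm (G w - F w) < norm (F w)" if "w \<in> K" for w
      using GF[of w] KR w0(2)[OF that] that by force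
    have G0: "G w \<noteq> 0" if "w \<in> K" for w using less[OF that] by auto
    define A where "A = (\<lambda>z. {p \<in> ball z r. G p = 0})"
    have finA: "finite (A z)" for z unfolding A_def
      by (rule finite_subset[OF _ finite_zeros_in_cball[OF G G0[OF w0(1)], of z r]]) auto
    have rouche: "(\<Sum>p\<in>A z. zorder G p) = zorder F z" if z: "z \<in> Z" for z
    proof -
      have "(\<Sum>p\<in>A z. zorder G p) = (\<Sum>p\<in>{p \<in> ball z r. F p = 0}. zorder F p)"
        unfolding A_def by (rule Rouche_circle[OF F G r(1)]) (rule less, use z in \<open>auto simp: K_def\<close>)
      also have "{p \<in> ball z r. F p = 0} = {z}" using iso[OF z] r z unfolding Z_def by auto
      finally show ?thesis by simp
    qed
    have Gpos: "zorder G z \<ge> 0" for z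
      by (rule zorder_ge_0)
       (use G eventually_nonzero_entire[OF G G0[OF w0(1)], of z] in \<open>auto intro: eventually_frequently simp: analytic_on_open analytic_at_two intro!: holomorphic_on_imp_analytic_at[of _ UNIV]\<close>)
    have sG: "sum_zeros G g = (\<Sum>p\<in>(\<Union>z\<in>Z. A z). of_int (zorder G p) * g p)"
    proof (rule sum_zeros_eq_sum[OF G G0[OF w0(1)] g(2)])
      show "finite (\<Union>z\<in>Z. A z)" using finZ finA by auto
      fix z assume "norm z \<le> R" "G z = 0"
      then have "z \<notin> K" using G0 by auto
      with \<open>norm z \<le> R\<close> \<open>G z = 0\<close> show "z \<in> (\<Union>z\<in>Z. A z)" unfolding K_def A_def by auto
    qed (auto simp: A_def)
    also have "\<dots> = (\<Sum>z\<in>Z. \<Sum>p\<in>A z. of_int (zorder G p) * g p)"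
    proof (rule sum.UNION_disjoint[OF finZ])
      show "\<forall>i\<in>Z. \<forall>j\<in>Z. i \<noteq> j \<longrightarrow> A i \<inter> A j = {}"
      proof (intro ballI impI)
        fix i j assume ij: "i \<in> Z" "j \<in> Z" "i \<noteq> j"
        have "2 * r < dist i j" using sep[of i j] ij by auto
        have False if "x \<in> A i" "x \<in> A j" for x
        proof -
          have "dist i x < r" "dist j x < r" using that unfolding A_def by auto
          then show False using \<open>2 * r < dist i j\<close> dist_triangle2[of i j x] by linarith
        qed
        then show "A i \<inter> A j = {}" by blast
      qed
    qed (use finA in auto)
    finally have sG: "sum_zeros G g = (\<Sum>z\<in>Z. \<Sum>p\<in>A z. of_int (zorder G p) * g p)" .
    have sF: "sum_zeros F g = (\<Sum>z\<in>Z. of_int (zorder F z) * g z)"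
      by (rule sum_zeros_eq_sum[OF F F0 g(2)]) (use finZ in \<open>auto simp: Z_def\<close>)
    also have "\<dots> = (\<Sum>z\<in>Z. \<Sum>p\<in>A z. of_int (zorder G p) * g z)"
      by (intro sum.cong refl) (simp add: rouche[symmetric] sum_distrib_right)
    finally have "\<bar>sum_zeros G g - sum_zeros F g\<bar> = \<bar>\<Sum>z\<in>Z. \<Sum>p\<in>A z. of_int (zorder G p) * (g p - g z)\<bar>"
      unfolding sG by (simp add: sum_subtractf right_diff_distrib)
    also have "\<dots> \<le> (\<Sum>z\<in>Z. \<Sum>p\<in>A z. of_int (zorder G p) * e')"
    proof (rule order.trans[OF sum_abs], rule sum_mono)
      fix z assume z: "z \<in> Z"
      show "\<bar>\<Sum>p\<in>A z. of_int (zorder G p) * (g p - g z)\<bar> \<le> (\<Sum>p\<in>A z. of_int (zorder G p) * e')"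
        by (intro order.trans[OF sum_abs] sum_mono)
           (use less_imp_le[OF gr[OF z]] Gpos in \<open>auto simp: abs_mult A_def intro!: mult_left_mono\<close>)
    qed
    also have "\<dots> = m * e'" unfolding m_def by (simp add: rouche[symmetric] sum_distrib_right)
    also have "\<dots> < \<epsilon>" using e m unfolding e'_def by (simp add: field_simps)
    finally show "\<bar>sum_zeros G g - sum_zeros F g\<bar> < \<epsilon>" .
  qed
qed

lemma continuous_sum_zeros:
  fixes F :: "'x::topological_space \<Rightarrow> complex \<Rightarrow> complex" and g :: "complex \<Rightarrow> real"
  assumes hol: "\<And>x. F x holomorphic_on UNIV" and nz: "\<And>x. \<exists>p. F x p \<noteq> 0"
    and cont: "continuous_on UNIV (\<lambda>(x, z). F x z)"
    and g: "continuous_on UNIV g" "\<And>z. norm z > R \<Longrightarrow> g z = 0"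
  shows "continuous_on UNIV (\<lambda>x. sum_zeros (F x) g)"
proof -
  have "((\<lambda>x. sum_zeros (F x) g) \<longlongrightarrow> sum_zeros (F x0) g) (at x0)" for x0
  proof (rule tendstoI)
    fix e :: real assume e: "e > 0"
    have g2: "\<And>z. norm z > max R 0 \<Longrightarrow> g z = 0" using g(2) by auto
    obtain p where p: "F x0 p \<noteq> 0" using nz by blast
    obtain \<delta> where d: "\<delta> > 0" "\<And>G. G holomorphic_on UNIV \<Longrightarrow> (\<And>z. z \<in> cball 0 (max R 0+1) \<Longrightarrow> norm (G z - F x0 z) < \<delta>) \<Longrightarrow>
       \<bar>sum_zeros G g - sum_zeros (F x0) g\<bar> < e"
      using sum_zeros_stable[OF hol p g(1) g2 max.cobounded2 e] by blast
    have c: "continuous_on (UNIV \<times> cball 0 (max R 0+1)) (\<lambda>(x, z). F x z)"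
      by (rule continuous_on_subset[OF cont]) auto
    have d2: "\<delta>/2 > 0" using d by simp
    obtain X0 where X0: "x0 \<in> X0" "open X0"
      "\<forall>x\<in>X0 \<inter> UNIV. \<forall>t\<in>cball 0 (max R 0+1). dist (case (x,t) of (x,z) \<Rightarrow> F x z) (case (x0,t) of (x,z) \<Rightarrow> F x z) \<le> \<delta>/2"
      by (rule continuous_on_prod_compactE[OF c compact_cball UNIV_I d2]) blast
    show "\<forall>\<^sub>F x in at x0. dist (sum_zeros (F x) g) (sum_zeros (F x0) g) < e"
      unfolding eventually_at_topological
    proof (intro exI[of _ X0] conjI ballI impI)
      fix x assume x: "x \<in> X0"
      show "dist (sum_zeros (F x) g) (sum_zeros (F x0) g) < e"
        unfolding dist_real_def
      proof (rule d(2)[OF hol])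
        fix z :: complex assume "z \<in> cball 0 (max R 0+1)"
        then have "dist (F x z) (F x0 z) \<le> \<delta>/2" using X0(3) x by auto
        then show "norm (F x z - F x0 z) < \<delta>" using d by (simp add: dist_norm)
      qed
    qed (use X0 in auto)
  qed
  then show ?thesis by (simp add: continuous_on_def)
qed

text \<open>
  A zero-free factor and an affine substitution keep the multiplicities, so the sum over zeros may
  be computed in the window variable.
\<close>

lemma sum_zeros_affine:
  assumes F: "F holomorphic_on UNIV" "F p \<noteq> 0" and h: "h holomorphic_on UNIV" "\<And>w. h w \<noteq> 0" and a: "a \<noteq> 0"
  shows "sum_zeros F (\<lambda>\<beta>. f (a * (\<beta> - b) - d)) = sum_zeros (\<lambda>w. h w * F (b + (w + d) / a)) f"
proof -
  have zo: "zorder (\<lambda>w. h w * F (b + (w + d) / a)) (a * (z - b) - d) = zorder F z" if "F z = 0" for z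
  proof -
    have n: "zorder F z > 0" and expo: "(\<exists>r. r>0 \<and> cball z r \<subseteq> UNIV \<and> zor_poly F z holomorphic_on cball z r
    \<and> (\<forall>w\<in>cball z r. F w  = zor_poly F z w * (w-z) ^ nat (zorder F z)  \<and> zor_poly F z w \<noteq>0))"
      using zorder_exist_zero[of F UNIV z] F that by auto
    define g where "g = zor_poly F z"
    define n where "n = nat (zorder F z)"
    obtain r where r: "r > 0" "g holomorphic_on cball z r" "\<And>w. w \<in> cball z r \<Longrightarrow> F w = g w * (w - z) ^ n" "\<And>w. w \<in> cball z r \<Longrightarrow> g w \<noteq> 0"
      using expo unfolding g_def n_def by auto
    define \<phi> where "\<phi> = (\<lambda>w. b + (w + d) / a)"
    define S where "S = ball (a * (z - b) - d) (r * norm a)"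
    have \<phi>: "\<phi> w - z = (w - (a * (z - b) - d)) / a" for w using a by (simp add: \<phi>_def field_simps)
    have \<phi>S: "\<phi> w \<in> cball z r" if "w \<in> S" for w
    proof -
      have "norm (w - (a * (z - b) - d)) < r * norm a" using that unfolding S_def by (simp add: dist_norm norm_minus_commute)
      then have "norm (\<phi> w - z) < r" unfolding \<phi> using a by (simp add: norm_divide pos_divide_less_eq)
      then show ?thesis by (simp add: dist_norm norm_minus_commute)
    qed
    have h': "h holomorphic_on S" using h(1) by (rule holomorphic_on_subset) auto
    have "zorder (\<lambda>w. h w * F (\<phi> w)) (a * (z - b) - d) = int n"
    proof (rule zorder_eqI[where S=S and g="\<lambda>w. h w * g (\<phi> w) / a ^ n"])
      have "(g \<circ> \<phi>) holomorphic_on S"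
        by (rule holomorphic_on_compose_gen[OF _ r(2)]) (use \<phi>S a in \<open>auto simp: \<phi>_def intro!: holomorphic_intros\<close>)
      then show "(\<lambda>w. h w * g (\<phi> w) / a ^ n) holomorphic_on S"
        using h' a by (auto simp: o_def intro!: holomorphic_intros)
      show c: "a * (z - b) - d \<in> S" using r a unfolding S_def by simp
      show "h (a * (z - b) - d) * g (\<phi> (a * (z - b) - d)) / a ^ n \<noteq> 0"
        using h(2) r(4)[OF \<phi>S[OF c]] a by simp
      fix w assume "w \<in> S"
      then show "h w * F (\<phi> w) = h w * g (\<phi> w) / a ^ n * (w - (a * (z - b) - d)) powi int n"
        using r(3)[OF \<phi>S[of w]] by (simp add: \<phi> power_divide)
    qed (auto simp: S_def)
    then show ?thesis using n unfolding \<phi>_def n_def by simp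
  qed
  have "bij_betw (\<lambda>\<beta>. a * (\<beta> - b) - d) {z. F z = 0} {w. h w * F (b + (w + d) / a) = 0}"
    by (rule bij_betwI[where g="\<lambda>w. b + (w + d) / a"]) (use a h in \<open>auto simp: field_simps\<close>)
  from infsum_reindex_bij_betw[OF this, of "\<lambda>w. of_int (zorder (\<lambda>w. h w * F (b + (w + d) / a)) w) * f w", symmetric]
  show ?thesis unfolding sum_zeros_def by (auto simp: zo intro!: infsum_cong)
qed

lemma sum_zeros_eq_0:
  assumes "\<And>z. F z = 0 \<Longrightarrow> g z = 0"
  shows "sum_zeros F g = 0"
  unfolding sum_zeros_def by (rule infsum_0) (use assms in auto)

lemma exp_shift_zeros_far:
  fixes c R :: real and s :: complex
  assumes "c \<ge> 0" "\<And>z. norm z > R \<Longrightarrow> f z = 0" "norm s > exp (c * R)"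
  shows "sum_zeros (\<lambda>w. exp (of_real c * w) + s) f = 0"
proof (rule sum_zeros_eq_0)
  fix z assume z: "exp (of_real c * z) + s = 0"
  show "f z = 0"
  proof (rule ccontr)
    assume "f z \<noteq> 0"
    then have R: "norm z \<le> R" using assms(2) by force
    have "norm s = norm (exp (of_real c * z))" using z by (metis add_eq_0_iff norm_minus_cancel)
    also have "\<dots> \<le> exp (c * R)"
      using order.trans[OF complex_Re_le_cmod R] assms(1) by (simp add: mult_left_mono)
    finally show False using assms(3) by simp
  qed
qed

text \<open>
  The constant \<open>\<delta>\<close> works for all \<open>s\<close> at once.  For large \<open>s\<close> neither function vanishes on the support
  of \<open>f\<close>; bounded values of \<open>s\<close> are handled by compactness, since a sequence of
  counterexamples would have a subsequence along which \<open>s\<close> converges.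
\<close>

lemma sum_zeros_exp_shift_uniform:
  fixes c R :: real and f :: "complex \<Rightarrow> real"
  assumes c: "c > 0" and f: "continuous_on UNIV f" "\<And>z. norm z > R \<Longrightarrow> f z = 0" and R: "R \<ge> 0" and e: "\<epsilon> > 0"
  shows "\<exists>\<delta>>0. \<forall>G s. G holomorphic_on UNIV \<longrightarrow> (\<forall>z\<in>cball 0 (R+1). norm (G z - (exp (of_real c * z) + s)) \<le> \<delta>) \<longrightarrow>
       \<bar>sum_zeros G f - sum_zeros (\<lambda>w. exp (of_real c * w) + s) f\<bar> < \<epsilon>"
proof (rule ccontr)
  assume neg: "\<not> ?thesis"
  define T where "T = (\<lambda>s w. exp (of_real c * w) + s :: complex)"
  have T: "T s holomorphic_on UNIV" for s unfolding T_def by (intro holomorphic_intros)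
  have Tnz: "\<exists>p. T s p \<noteq> 0" for s
  proof (cases "s = -1")
    case True
    then have "T s ((Complex 0 pi) / of_real c) \<noteq> 0" using c by (simp add: T_def exp_Complex cis_pi Complex_eq)
    then show ?thesis by blast
  next
    case False
    then have "T s 0 \<noteq> 0" by (auto simp: T_def add_eq_0_iff)
    then show ?thesis by blast
  qed
  define K where "K = exp (c * R) + 1"
  define Q where "Q = (\<lambda>d p. fst p holomorphic_on UNIV \<and> (\<forall>z \<in> cball 0 (R+1). norm (fst p z - T (snd p) z) \<le> d) \<and>
      \<not> \<bar>sum_zeros (fst p) f - sum_zeros (T (snd p)) f\<bar> < \<epsilon>)"
  have "\<exists>p. Q d p" if d: "d > 0" for d
  proof (rule ccontr)
    assume "\<not> ?thesis"
    then have n: "\<not> Q d (G, s)" for G s by blast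
    have "\<forall>G s. G holomorphic_on UNIV \<longrightarrow> (\<forall>z\<in>cball 0 (R+1). norm (G z - (exp (of_real c * z) + s)) \<le> d) \<longrightarrow>
       \<bar>sum_zeros G f - sum_zeros (\<lambda>w. exp (of_real c * w) + s) f\<bar> < \<epsilon>"
    proof (intro allI impI)
      fix G s assume "G holomorphic_on UNIV" "\<forall>z\<in>cball 0 (R+1). norm (G z - (exp (of_real c * z) + s)) \<le> d"
      then show "\<bar>sum_zeros G f - sum_zeros (\<lambda>w. exp (of_real c * w) + s) f\<bar> < \<epsilon>"
        using n[of G s] unfolding Q_def T_def fst_conv snd_conv by blast
    qed
    with d neg show False by blast
  qed
  then have "\<forall>j. \<exists>p. Q (1 / real (Suc j)) p" by simp
  from choice[OF this] obtain Gs where Gs: "\<And>j. Q (1 / real (Suc j)) (Gs j)" by blast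
  have G: "G j holomorphic_on UNIV" "z \<in> cball 0 (R+1) \<Longrightarrow> norm (G j z - T (s j) z) \<le> 1 / real (Suc j)"
     "\<not> \<bar>sum_zeros (G j) f - sum_zeros (T (s j)) f\<bar> < \<epsilon>" if "G = fst \<circ> Gs" "s = snd \<circ> Gs" for G s j z
    using that Gs[of j] unfolding Q_def o_def by blast+
  define G s where "G = fst \<circ> Gs" and "s = snd \<circ> Gs"
  note G = G[OF G_def s_def]
  have sK: "s j \<in> cball 0 K" for j
  proof (rule ccontr)
    assume "s j \<notin> cball 0 K"
    then have sj: "norm (s j) > exp (c * R) + 1" by (simp add: K_def)
    have "sum_zeros (T (s j)) f = 0" unfolding T_def by (rule exp_shift_zeros_far[OF less_imp_le[OF c] f(2)]) (use sj in auto)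
    moreover have "sum_zeros (G j) f = 0"
    proof (rule sum_zeros_eq_0)
      fix z assume z: "G j z = 0"
      show "f z = 0"
      proof (rule ccontr)
        assume "f z \<noteq> 0"
        then have zR: "norm z \<le> R" using f(2) by force
        have "norm (s j) = norm ((T (s j) z - G j z) - exp (of_real c * z))" using z by (simp add: T_def)
        also have "\<dots> \<le> norm (T (s j) z - G j z) + norm (exp (of_real c * z))" by (rule norm_triangle_ineq4)
        also have "norm (T (s j) z - G j z) \<le> 1 / real (Suc j)" using G(2)[of z j] zR by (simp add: norm_minus_commute)
        also have "1 / real (Suc j) \<le> 1" by simp
        also have "norm (exp (of_real c * z)) \<le> exp (c * R)"
          using order.trans[OF complex_Re_le_cmod zR] c by (simp add: mult_left_mono)
        finally show False using sj by simp
      qed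
    qed
    ultimately show False using G(3)[of j] e by simp
  qed
  obtain l r where l: "strict_mono (r :: nat \<Rightarrow> nat)" "(s \<circ> r) \<longlonglongrightarrow> l"
    using compact_cball[of "0::complex" K] sK unfolding compact_def by blast
  obtain p where p: "T l p \<noteq> 0" using Tnz by blast
  obtain \<delta> where d: "\<delta> > 0" "\<And>G. G holomorphic_on UNIV \<Longrightarrow> (\<And>z. z \<in> cball 0 (R+1) \<Longrightarrow> norm (G z - T l z) < \<delta>) \<Longrightarrow>
       \<bar>sum_zeros G f - sum_zeros (T l) f\<bar> < \<epsilon> / 2"
    using sum_zeros_stable[OF T p f R half_gt_zero[OF e]] by blast
  have "eventually (\<lambda>j. norm ((s \<circ> r) j - l) < \<delta> / 2) sequentially"
    using tendstoD[OF l(2) half_gt_zero[OF d(1)]] by (simp add: dist_norm)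
  moreover have "eventually (\<lambda>j. 1 / real (Suc j) < \<delta> / 2) sequentially"
    using d(1) by real_asymp
  ultimately have "\<exists>j. norm ((s \<circ> r) j - l) < \<delta> / 2 \<and> 1 / real (Suc j) < \<delta> / 2"
    by (intro eventually_happens'[OF sequentially_bot eventually_conj])
  then obtain j where j: "norm (s (r j) - l) < \<delta> / 2" "1 / real (Suc j) < \<delta> / 2" by auto
  have "1 / real (Suc (r j)) \<le> 1 / real (Suc j)"
    using seq_suble[OF l(1), of j] by (simp add: frac_le)
  then have rj: "1 / real (Suc (r j)) < \<delta> / 2" using j by simp
  have 1: "\<bar>sum_zeros (G (r j)) f - sum_zeros (T l) f\<bar> < \<epsilon> / 2"
  proof (rule d(2)[OF G(1)])
    fix z :: complex assume "z \<in> cball 0 (R+1)"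
    then have "norm (G (r j) z - T (s (r j)) z) < \<delta>/2" using G(2)[of z "r j"] rj by simp
    moreover have eq: "G (r j) z - T l z = (G (r j) z - T (s (r j)) z) + (s (r j) - l)" by (simp add: T_def)
    have "norm (G (r j) z - T l z) \<le> norm (G (r j) z - T (s (r j)) z) + norm (s (r j) - l)"
      unfolding eq by (rule norm_triangle_ineq)
    ultimately show "norm (G (r j) z - T l z) < \<delta>" using j(1) by linarith
  qed
  have 2: "\<bar>sum_zeros (T (s (r j))) f - sum_zeros (T l) f\<bar> < \<epsilon> / 2"
  proof (rule d(2)[OF T])
    fix z :: complex
    have "norm (T (s (r j)) z - T l z) = norm (s (r j) - l)" by (simp add: T_def)
    then show "norm (T (s (r j)) z - T l z) < \<delta>" using j(1) d(1) by linarith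
  qed
  show False using 1 2 G(3)[of "r j"] by linarith
qed

lemma sum_zeros_exp_shift:
  fixes c :: real and s :: complex
  assumes c: "c \<noteq> 0" and s: "s \<noteq> 0"
  shows "sum_zeros (\<lambda>w. exp (of_real c * w) + s) f
    = (\<Sum>\<^sub>\<infinity>k\<in>(UNIV::int set). f ((2 * of_real pi * \<i> * of_int k + Ln (- s)) / of_real c))"
proof -
  define T where "T = (\<lambda>w. exp (of_real c * w) + s :: complex)"
  define \<phi> where "\<phi> = (\<lambda>k::int. (2 * of_real pi * \<i> * of_int k + Ln (- s)) / of_real c)"
  have zo: "zorder T z = 1" if "T z = 0" for z
  proof (rule zorder_zero_eqI[of T UNIV])
    show "T holomorphic_on UNIV" unfolding T_def by (intro holomorphic_intros)
    show "(deriv ^^ nat 1) T z \<noteq> 0"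
    proof -
      have "(T has_field_derivative (of_real c * exp (of_real c * z))) (at z)"
        unfolding T_def by (auto intro!: derivative_eq_intros)
      then show ?thesis using c by (simp add: DERIV_imp_deriv)
    qed
  qed (use that in auto)
  have "bij_betw \<phi> UNIV {z. T z = 0}"
  proof (rule bij_betw_imageI)
    show "inj_on \<phi> UNIV" using c by (auto simp: inj_on_def \<phi>_def)
    show "\<phi> ` UNIV = {z. T z = 0}"
    proof (intro equalityI subsetI)
      fix z assume "z \<in> \<phi> ` UNIV"
      then obtain k where k: "z = \<phi> k" by blast
      have "of_real c * z = Ln (-s) + (of_int (2*k) * pi) * \<i>" using c by (simp add: k \<phi>_def field_simps)
      then have "exp (of_real c * z) = exp (Ln (-s) + (of_int (2*k) * pi) * \<i>)" by simp
      also have "\<dots> = -s" using s exp_eq[of "Ln (-s) + (of_int (2*k) * pi) * \<i>" "Ln (-s)"] by auto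
      finally show "z \<in> {z. T z = 0}" by (simp add: T_def)
    next
      fix z assume "z \<in> {z. T z = 0}"
      then have "exp (of_real c * z) = exp (Ln (- s))" using s by (simp add: T_def eq_neg_iff_add_eq_0)
      then obtain k :: int where "of_real c * z = Ln (-s) + (of_int (2*k) * pi) * \<i>" unfolding exp_eq by blast
      then have "z = \<phi> k" using c by (simp add: \<phi>_def field_simps)
      then show "z \<in> \<phi> ` UNIV" by blast
    qed
  qed
  from infsum_reindex_bij_betw[OF this, of f]
  have "(\<Sum>\<^sub>\<infinity>k\<in>UNIV. f (\<phi> k)) = infsum f {z. T z = 0}" .
  also have "\<dots> = sum_zeros T f" unfolding sum_zeros_def by (rule infsum_cong) (simp add: zo)
  finally show ?thesis unfolding T_def \<phi>_def by simp
qed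

section \<open>Gaussian approximate identities in the plane\<close>

text \<open>
  The form in which integrability is checked before each use of Fubini's theorem: the second factor is a
  probability space, so a bound that does not depend on it suffices.
\<close>

lemma integrable_pair_prob_bound:
  fixes f :: "_ \<Rightarrow> _::{banach, second_countable_topology}"
  assumes M2: "prob_space M2" and f[measurable]: "f \<in> borel_measurable (M1 \<Otimes>\<^sub>M M2)"
    and w: "integrable M1 w" and le: "\<And>x y. norm (f (x, y)) \<le> w x"
  shows "integrable (M1 \<Otimes>\<^sub>M M2) f"
proof (rule integrableI_bounded)
  interpret M2: prob_space M2 by fact
  have [measurable]: "w \<in> borel_measurable M1" using w by auto
  have w0: "w x \<ge> 0" for x using le[of x] norm_ge_zero order_trans by blast
  have "(\<integral>\<^sup>+z. norm (f z) \<partial>(M1 \<Otimes>\<^sub>M M2)) \<le> (\<integral>\<^sup>+z. ennreal (w (fst z)) \<partial>(M1 \<Otimes>\<^sub>M M2))"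
    by (intro nn_integral_mono) (auto simp: le intro!: ennreal_leI split: prod.splits)
  also have "\<dots> = (\<integral>\<^sup>+x. (\<integral>\<^sup>+y. ennreal (w x) \<partial>M2) \<partial>M1)"
    by (subst M2.nn_integral_fst[symmetric]) auto
  also have "\<dots> = (\<integral>\<^sup>+x. ennreal (w x) \<partial>M1)" by (simp add: M2.emeasure_space_1)
  also have "\<dots> < \<infinity>" using w w0 by (simp add: nn_integral_eq_integral)
  finally show "(\<integral>\<^sup>+z. norm (f z) \<partial>(M1 \<Otimes>\<^sub>M M2)) < \<infinity>" .
qed fact

lemma norm_integral_le:
  fixes f :: "_ \<Rightarrow> _::{banach, second_countable_topology}"
  assumes g: "integrable M g" and le: "\<And>x. norm (f x) \<le> g x"
  shows "norm (integral\<^sup>L M f) \<le> integral\<^sup>L M g"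
proof (cases "integrable M f")
  case True
  then show ?thesis using g le by (intro order.trans[OF integral_norm_bound integral_mono]) auto
next
  case False
  moreover have "0 \<le> g x" for x using le[of x] norm_ge_zero order_trans by blast
  ultimately show ?thesis by (simp add: not_integrable_integral_eq)
qed

lemma
  fixes f g :: "real \<Rightarrow> 'b::{real_normed_field, banach, second_countable_topology}"
  assumes f: "integrable lborel f" and g: "integrable lborel g"
  shows integrable_lborel_times: "integrable lborel (\<lambda>x::real \<times> real. f (fst x) * g (snd x))"
    and integral_lborel_times: "(\<integral>x. f (fst x) * g (snd x) \<partial>(lborel :: (real \<times> real) measure)) = (\<integral>x. f x \<partial>lborel) * (\<integral>x. g x \<partial>lborel)"
proof -
  have [measurable]: "f \<in> borel_measurable borel" "g \<in> borel_measurable borel" using f g by auto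
  have int: "integrable (lborel \<Otimes>\<^sub>M lborel) (\<lambda>x::real \<times> real. f (fst x) * g (snd x))"
  proof (rule lborel_pair.Fubini_integrable)
    show "integrable lborel (\<lambda>x. \<integral>y. norm (f (fst (x, y)) * g (snd (x, y))) \<partial>lborel)"
      using f by (simp add: norm_mult)
    show "AE x in lborel. integrable lborel (\<lambda>y. f (fst (x, y)) * g (snd (x, y)))"
      using g by simp
  qed measurable
  then show "integrable lborel (\<lambda>x::real \<times> real. f (fst x) * g (snd x))" by (simp add: lborel_prod)
  show "(\<integral>x. f (fst x) * g (snd x) \<partial>(lborel :: (real \<times> real) measure)) = (\<integral>x. f x \<partial>lborel) * (\<integral>x. g x \<partial>lborel)"
    using lborel_pair.integral_fst'[OF int] f g by (simp add: lborel_prod)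
qed

lemma integral_lborel_translate:
  fixes f :: "'c::euclidean_space \<Rightarrow> 'b::{banach, second_countable_topology}"
  assumes [measurable]: "f \<in> borel_measurable borel"
  shows "(\<integral>x. f (z + x) \<partial>lborel) = (\<integral>x. f x \<partial>lborel)"
proof -
  have "(\<integral>x. f x \<partial>lborel) = (\<integral>x. f x \<partial>(distr lborel borel ((+) z)))" by (simp add: lborel_distr_plus)
  also have "\<dots> = (\<integral>x. f (z + x) \<partial>lborel)" by (subst integral_distr) auto
  finally show ?thesis ..
qed

lemma char_normal_density_0:
  assumes r: "r > 0"
  shows "(\<integral>t. complex_of_real (normal_density 0 r t) * iexp (t * x) \<partial>lborel) = complex_of_real (exp (- (r * x)\<^sup>2 / 2))"
proof -
  have "complex_of_real (exp (- (r * x)\<^sup>2 / 2)) = char std_normal_distribution (r * x)"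
    by (simp add: char_std_normal_distribution)
  also have "\<dots> = (\<integral>u. std_normal_density u *\<^sub>R iexp (r * x * u) \<partial>lborel)"
    unfolding char_def by (subst integral_density) auto
  also have "\<dots> = \<bar>1 / r\<bar> *\<^sub>R (\<integral>t. std_normal_density (0 + 1 / r * t) *\<^sub>R iexp (r * x * (0 + 1 / r * t)) \<partial>lborel)"
    by (rule lborel_integral_real_affine) (use r in auto)
  also have "\<dots> = (\<integral>t. (1 / r) *\<^sub>R (std_normal_density (t / r) *\<^sub>R iexp (t * x)) \<partial>lborel)"
    using r by (subst integral_scaleR_right[symmetric]) (simp add: mult.commute)
  also have "\<dots> = (\<integral>t. complex_of_real (normal_density 0 r t) * iexp (t * x) \<partial>lborel)"
  proof (rule Bochner_Integration.integral_cong[OF refl])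
    fix t
    have "normal_density 0 r t = 1 / r * std_normal_density (t / r)"
      using r by (simp add: normal_density_def real_sqrt_mult power_divide field_simps)
    then show "(1 / r) *\<^sub>R (std_normal_density (t / r) *\<^sub>R iexp (t * x)) = complex_of_real (normal_density 0 r t) * iexp (t * x)"
      by (simp add: scaleR_conv_of_real)
  qed
  finally show ?thesis ..
qed

text \<open>The density of two independent centred normal variables with standard deviation \<open>r\<close>.\<close>

definition gauss2 :: "real \<Rightarrow> real \<times> real \<Rightarrow> real" where
  "gauss2 r x = normal_density 0 r (fst x) * normal_density 0 r (snd x)"

lemma gauss2_nonneg [simp]: "gauss2 r x \<ge> 0" by (simp add: gauss2_def)

lemma borel_measurable_gauss2 [measurable]: "gauss2 r \<in> borel_measurable borel"
  unfolding gauss2_def borel_prod[symmetric] by measurable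

lemma norm_prod_sq: "(norm (x::real\<times>real))\<^sup>2 = (fst x)\<^sup>2 + (snd x)\<^sup>2"
  by (simp add: norm_prod_def)

lemma gauss2_eq:
  assumes "r > 0"
  shows "gauss2 r x = exp (- (norm x / r)\<^sup>2 / 2) / (2 * pi * r\<^sup>2)"
proof -
  have "sqrt (2 * pi * r\<^sup>2) * sqrt (2 * pi * r\<^sup>2) = 2 * pi * r\<^sup>2" using assms by simp
  moreover have "exp (- (norm x / r)\<^sup>2 / 2) = exp (- (fst x)\<^sup>2 / (2 * r\<^sup>2)) * exp (- (snd x)\<^sup>2 / (2 * r\<^sup>2))"
    by (simp add: exp_add[symmetric] norm_prod_sq power_divide add_divide_distrib)
  ultimately show ?thesis by (simp add: gauss2_def normal_density_def)
qed

lemma gauss2_uminus [simp]: "gauss2 r (- x) = gauss2 r x"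
  by (simp add: gauss2_def normal_density_def)

lemma gauss2_commute: "gauss2 r (x - y) = gauss2 r (y - x)"
  using gauss2_uminus[of r "y - x"] by simp

lemma integrable_gauss2 [simp]: "r > 0 \<Longrightarrow> integrable lborel (gauss2 r)"
  and integral_gauss2 [simp]: "r > 0 \<Longrightarrow> (\<integral>x. gauss2 r x \<partial>lborel) = 1"
  unfolding gauss2_def[abs_def] by (simp_all add: integrable_lborel_times integral_lborel_times)

lemma
  assumes r: "r > 0"
  shows integrable_gauss2_sq: "integrable lborel (\<lambda>x. gauss2 r x * (norm x)\<^sup>2)"
    and integral_gauss2_sq: "(\<integral>x. gauss2 r x * (norm x)\<^sup>2 \<partial>lborel) = 2 * r\<^sup>2"
proof -
  have m: "integrable lborel (\<lambda>x. normal_density 0 r x * x\<^sup>2)" using integrable_normal_moment[OF r, of 0 2] by simp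
  have v: "(\<integral>x. normal_density 0 r x * x\<^sup>2 \<partial>lborel) = r\<^sup>2" using integral_normal_moment_even[OF r, of 0 1] by simp
  have eq: "gauss2 r x * (norm x)\<^sup>2 = (normal_density 0 r (fst x) * (fst x)\<^sup>2) * normal_density 0 r (snd x) +
      normal_density 0 r (fst x) * (normal_density 0 r (snd x) * (snd x)\<^sup>2)" for x
    by (simp add: gauss2_def norm_prod_sq algebra_simps)
  note i = integrable_lborel_times[OF m integrable_normal_density[OF r]] integrable_lborel_times[OF integrable_normal_density[OF r] m]
  show "integrable lborel (\<lambda>x. gauss2 r x * (norm x)\<^sup>2)" unfolding eq using i by (rule Bochner_Integration.integrable_add)
  show "(\<integral>x. gauss2 r x * (norm x)\<^sup>2 \<partial>lborel) = 2 * r\<^sup>2" unfolding eq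
    using i r by (simp add: integral_lborel_times[OF m integrable_normal_density[OF r]] integral_lborel_times[OF integrable_normal_density[OF r] m] v)
qed

lemma gauss2_char:
  assumes r: "r > 0"
  shows "(\<integral>t. complex_of_real (gauss2 r t) * iexp (t \<bullet> x) \<partial>lborel) = complex_of_real (exp (- (r * norm x)\<^sup>2 / 2))"
proof -
  have i: "integrable lborel (\<lambda>t. complex_of_real (normal_density 0 r t) * iexp (t * y))" for y
    by (rule Bochner_Integration.integrable_bound[OF integrable_normal_density[OF r, of 0]]) (auto simp: norm_mult)
  have "complex_of_real (gauss2 r t) * iexp (t \<bullet> x) =
     (complex_of_real (normal_density 0 r (fst t)) * iexp (fst t * fst x)) * (complex_of_real (normal_density 0 r (snd t)) * iexp (snd t * snd x))" for t
    by (cases t; cases x) (simp add: gauss2_def inner_prod_def exp_add[symmetric] algebra_simps)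
  then have "(\<integral>t. complex_of_real (gauss2 r t) * iexp (t \<bullet> x) \<partial>lborel) = complex_of_real (exp (- (r * fst x)\<^sup>2 / 2)) * complex_of_real (exp (- (r * snd x)\<^sup>2 / 2))"
    by (simp only: integral_lborel_times[OF i i, of "fst x" "snd x"] char_normal_density_0[OF r])
  also have "\<dots> = complex_of_real (exp (- (r * norm x)\<^sup>2 / 2))"
    by (simp add: power_mult_distrib norm_prod_sq exp_add[symmetric] of_real_mult[symmetric] field_simps del: of_real_mult)
  finally show ?thesis .
qed

abbreviation gauss_weight :: "real \<Rightarrow> real \<times> real \<Rightarrow> real" where
  "gauss_weight r t \<equiv> exp (- (r * norm t)\<^sup>2 / 2)"

lemma gauss2_inverse:
  assumes r: "r > 0"
  shows "gauss_weight r t = 2 * pi / r\<^sup>2 * gauss2 (1 / r) t"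
  using r by (simp add: gauss2_eq field_simps)

lemma integrable_gauss_weight: "r > 0 \<Longrightarrow> integrable lborel (\<lambda>t::real\<times>real. gauss_weight r t)"
  unfolding gauss2_inverse by simp

text \<open>
  The Gaussian kernel is its own Fourier transform up to scaling: this is \<open>gauss2_char\<close> for the
  standard deviation \<open>1 / r\<close>.
\<close>

lemma gauss2_Fourier:
  assumes r: "r > 0"
  shows "complex_of_real (gauss2 r x) = (1 / (4 * pi\<^sup>2)) * (\<integral>t. complex_of_real (gauss_weight r t) * iexp (t \<bullet> x) \<partial>lborel)"
proof -
  have "(\<integral>t. complex_of_real (gauss_weight r t) * iexp (t \<bullet> x) \<partial>lborel) =
     complex_of_real (2 * pi / r\<^sup>2) * (\<integral>t. complex_of_real (gauss2 (1 / r) t) * iexp (t \<bullet> x) \<partial>lborel)"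
    unfolding gauss2_inverse[OF r] by (subst integral_mult_right_zero[symmetric]) (simp add: mult.assoc)
  also have "\<dots> = complex_of_real (2 * pi / r\<^sup>2 * exp (- (norm x / r)\<^sup>2 / 2))"
    using r by (subst gauss2_char) auto
  also have "\<dots> = complex_of_real (4 * pi\<^sup>2 * gauss2 r x)"
    using r by (subst gauss2_eq[OF r]) (simp add: field_simps power2_eq_square)
  finally show ?thesis by simp
qed

text \<open>
  An explicit form of the approximate identity property.  Chebyshev's inequality is built in: off the
  ball of radius \<open>\<delta>\<close> the oscillation \<open>2 B\<close> is bounded by \<open>2 B (norm x)\<^sup>2 / \<delta>\<^sup>2\<close>, and the second
  moment of the kernel is \<open>2 r\<^sup>2\<close>.
\<close>

lemma gauss2_approx_identity:
  fixes h :: "real \<times> real \<Rightarrow> 'b::{banach, second_countable_topology}"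
  assumes [measurable]: "h \<in> borel_measurable borel" and B: "\<And>x. norm (h x) \<le> B"
    and cl: "\<And>x. norm (x - z) < \<delta> \<Longrightarrow> norm (h x - h z) \<le> \<eta>" and pos: "\<delta> > 0" "\<eta> \<ge> 0" "r > 0"
  shows "norm ((\<integral>x. gauss2 r (x - z) *\<^sub>R h x \<partial>lborel) - h z) \<le> \<eta> + 4 * B * r\<^sup>2 / \<delta>\<^sup>2"
proof -
  have B0: "B \<ge> 0" using B[of 0] norm_ge_zero order_trans by blast
  have eq: "(\<integral>x. gauss2 r (x - z) *\<^sub>R h x \<partial>lborel) = (\<integral>x. gauss2 r x *\<^sub>R h (z + x) \<partial>lborel)"
    using integral_lborel_translate[of "\<lambda>x. gauss2 r (x - z) *\<^sub>R h x" z] by simp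
  have i1: "integrable lborel (\<lambda>x. gauss2 r x *\<^sub>R h (z + x))"
  proof (rule Bochner_Integration.integrable_bound[of _ "\<lambda>x. gauss2 r x * B"], goal_cases)
    case 3
    have "norm (gauss2 r x *\<^sub>R h (z + x)) \<le> norm (gauss2 r x * B)" for x
      using B[of "z + x"] B0 by (simp add: abs_mult mult_left_mono)
    then show ?case by (rule AE_I2)
  qed (use pos in auto)
  have i2: "integrable lborel (\<lambda>x. gauss2 r x *\<^sub>R h z)" using pos by simp
  have "(\<integral>x. gauss2 r x *\<^sub>R h (z + x) \<partial>lborel) - h z = (\<integral>x. gauss2 r x *\<^sub>R (h (z + x) - h z) \<partial>lborel)"
    using i1 i2 pos by (simp add: scaleR_diff_right)
  also have "norm \<dots> \<le> (\<integral>x. gauss2 r x * \<eta> + (2 * B / \<delta>\<^sup>2) * (gauss2 r x * (norm x)\<^sup>2) \<partial>lborel)"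
  proof (rule norm_integral_le)
    show "integrable lborel (\<lambda>x. gauss2 r x * \<eta> + (2 * B / \<delta>\<^sup>2) * (gauss2 r x * (norm x)\<^sup>2))"
      using integrable_gauss2_sq[OF pos(3)] pos by (intro Bochner_Integration.integrable_add) auto
    fix x :: "real \<times> real"
    have "norm (h (z + x) - h z) \<le> \<eta> + 2 * B / \<delta>\<^sup>2 * (norm x)\<^sup>2"
    proof (cases "norm x < \<delta>")
      case True
      then have "norm (h (z + x) - h z) \<le> \<eta>" using cl[of "z + x"] by simp
      moreover have "2 * B / \<delta>\<^sup>2 * (norm x)\<^sup>2 \<ge> 0" using B0 by simp
      ultimately show ?thesis by linarith
    next
      case False
      then have "(norm x)\<^sup>2 \<ge> \<delta>\<^sup>2" using pos by (intro power_mono) auto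
      then have "2 * B * 1 \<le> 2 * B * ((norm x)\<^sup>2 / \<delta>\<^sup>2)" using B0 pos by (intro mult_left_mono) auto
      moreover have "norm (h (z + x) - h z) \<le> 2 * B" using norm_triangle_ineq4[of "h (z + x)" "h z"] B[of z] B[of "z + x"] by linarith
      ultimately show ?thesis using pos by simp
    qed
    from mult_left_mono[OF this, of "gauss2 r x"]
    show "norm (gauss2 r x *\<^sub>R (h (z + x) - h z)) \<le> gauss2 r x * \<eta> + (2 * B / \<delta>\<^sup>2) * (gauss2 r x * (norm x)\<^sup>2)"
      unfolding norm_scaleR by (simp add: distrib_left mult.left_commute)
  qed
  also have "\<dots> = \<eta> + 4 * B * r\<^sup>2 / \<delta>\<^sup>2"
    using integrable_gauss2_sq[OF pos(3)] integral_gauss2_sq[OF pos(3)] pos by (subst Bochner_Integration.integral_add) auto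
  finally show ?thesis unfolding eq .
qed

section \<open>Convergence of planar characteristic functions to an integrable limit\<close>

lemma compact_support_bounded:
  fixes h :: "'c::euclidean_space \<Rightarrow> real"
  assumes "continuous_on UNIV h" "\<And>x. norm x > R \<Longrightarrow> h x = 0"
  obtains B where "B \<ge> 0" "\<And>x. \<bar>h x\<bar> \<le> B"
proof -
  have "bounded (h ` cball 0 R)"
    by (intro compact_imp_bounded compact_continuous_image continuous_on_subset[OF assms(1)]) auto
  then obtain B where "\<forall>x\<in>cball 0 R. \<bar>h x\<bar> \<le> B" unfolding bounded_iff by auto
  then have B: "\<And>x. x \<in> cball 0 R \<Longrightarrow> \<bar>h x\<bar> \<le> B" by blast
  have "\<bar>h x\<bar> \<le> max B 0" for x
    using B[of x] assms(2)[of x] by (cases "norm x > R") auto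
  then show thesis by (intro that[of "max B 0"]) auto
qed

lemma compact_support_uniformly_continuous:
  fixes h :: "'c::euclidean_space \<Rightarrow> real"
  assumes c: "continuous_on UNIV h" and s: "\<And>x. norm x > R \<Longrightarrow> h x = 0" and e: "e > 0"
  shows "\<exists>\<delta>>0. \<forall>x z. norm (x - z) < \<delta> \<longrightarrow> \<bar>h x - h z\<bar> \<le> e"
proof -
  have "uniformly_continuous_on (cball 0 (R + 1)) h"
    by (intro compact_uniformly_continuous continuous_on_subset[OF c]) auto
  then obtain d where d: "d > 0" "\<And>x z. x \<in> cball 0 (R+1) \<Longrightarrow> z \<in> cball 0 (R+1) \<Longrightarrow> dist x z < d \<Longrightarrow> dist (h x) (h z) < e"
    using e unfolding uniformly_continuous_on_def by metis
  show ?thesis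
  proof (intro exI[of _ "min d 1"] conjI allI impI)
    fix x z :: 'c assume xz: "norm (x - z) < min d 1"
    show "\<bar>h x - h z\<bar> \<le> e"
    proof (cases "norm x > R \<and> norm z > R")
      case True then show ?thesis using s[of x] s[of z] e by simp
    next
      case False
      then have "norm x \<le> R + 1 \<and> norm z \<le> R + 1"
        using xz norm_triangle_ineq3[of x z] by linarith
      then show ?thesis using d(2)[of x z] xz by (simp add: dist_norm)
    qed
  qed (use d in auto)
qed

lemma compact_support_integrable:
  fixes h :: "'c::euclidean_space \<Rightarrow> real"
  assumes c: "continuous_on UNIV h" and s: "\<And>x. norm x > R \<Longrightarrow> h x = 0"
  shows "integrable lborel h"
proof -
  have "integrable lborel (\<lambda>x. indicator (cball 0 R) x *\<^sub>R h x)"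
    by (rule borel_integrable_compact) (auto intro: continuous_on_subset[OF c])
  moreover have "indicator (cball 0 R) x *\<^sub>R h x = h x" for x using s[of x] by (cases "norm x > R") auto
  ultimately show ?thesis by (simp only:)
qed

text \<open>
  A planar version of Levy's continuity theorem.  Since the limit \<open>\<phi>\<close> is integrable, no tightness or selection argument
  is needed to find the limit law: Fourier inversion gives its density, which is the limit, first for
  \<open>N \<rightarrow> \<infinity>\<close> and then for \<open>r \<rightarrow> 0\<close>, of the densities of \<open>Z N\<close> after smoothing by a Gaussian of standard deviation \<open>r\<close>.
\<close>

locale planar_characteristic_convergence = prob_space M for M :: "'a measure" +
  fixes Z :: "nat \<Rightarrow> 'a \<Rightarrow> real \<times> real" and \<phi> :: "real \<times> real \<Rightarrow> complex"
  assumes Z[measurable]: "\<And>N. Z N \<in> borel_measurable M"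
    and char_conv: "\<And>t. (\<lambda>N. \<integral>\<omega>. iexp (t \<bullet> Z N \<omega>) \<partial>M) \<longlonglongrightarrow> \<phi> t"
    and int_phi: "integrable lborel \<phi>" and cont0: "isCont \<phi> 0"
begin

definition "char2 N t = (\<integral>\<omega>. iexp (t \<bullet> Z N \<omega>) \<partial>M)"
definition "smoothed_density r N x = (\<integral>\<omega>. gauss2 r (x - Z N \<omega>) \<partial>M)"
text \<open>
  The density of the limit law after smoothing; for \<open>r = 0\<close> this is the inverse Fourier
  transform of \<open>\<phi>\<close>.
\<close>

definition "limit_density r x = Re ((1 / (4 * pi\<^sup>2)) * (\<integral>t. complex_of_real (gauss_weight r t) * (iexp (- (t \<bullet> x)) * \<phi> t) \<partial>lborel))"

lemma char2_tendsto: "(\<lambda>N. char2 N t) \<longlonglongrightarrow> \<phi> t"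
  unfolding char2_def by (rule char_conv)

lemma norm_char2: "norm (char2 N t) \<le> 1"
proof -
  have "norm (char2 N t) \<le> (\<integral>\<omega>. norm (iexp (t \<bullet> Z N \<omega>)) \<partial>M)" unfolding char2_def by (rule integral_norm_bound)
  also have "\<dots> = 1" by (simp add: prob_space)
  finally show ?thesis .
qed

lemma norm_phi: "norm (\<phi> t) \<le> 1"
  by (rule LIMSEQ_le_const2[OF tendsto_norm[OF char2_tendsto]]) (use norm_char2 in auto)

lemma phi_0: "\<phi> 0 = 1"
proof -
  have "(\<lambda>N. char2 N 0) \<longlonglongrightarrow> 1" by (simp add: char2_def prob_space)
  then show ?thesis using char2_tendsto LIMSEQ_unique by blast
qed

lemma measurable_phi [measurable]: "\<phi> \<in> borel_measurable borel" using int_phi by auto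

lemma measurable_char2 [measurable]: "char2 N \<in> borel_measurable borel"
  unfolding char2_def[abs_def] by measurable

lemma smoothed_density_Fourier:
  assumes r: "r > 0"
  shows "complex_of_real (smoothed_density r N x) =
     (1 / (4 * pi\<^sup>2)) * (\<integral>t. complex_of_real (gauss_weight r t) * (iexp (- (t \<bullet> x)) * char2 N t) \<partial>lborel)"
proof -
  interpret P: pair_sigma_finite "lborel :: (real \<times> real) measure" M ..
  let ?f = "\<lambda>t \<omega>. complex_of_real (gauss_weight r t) * iexp (t \<bullet> (Z N \<omega> - x))"
  have int: "integrable (lborel \<Otimes>\<^sub>M M) (case_prod ?f)"
    by (rule integrable_pair_prob_bound[OF _ _ integrable_gauss_weight[OF r]]) (auto simp: norm_mult prob_space_axioms)
  have "complex_of_real (smoothed_density r N x) = (\<integral>\<omega>. (1 / (4 * pi\<^sup>2)) * (\<integral>t. ?f t \<omega> \<partial>lborel) \<partial>M)"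
    unfolding smoothed_density_def integral_complex_of_real[symmetric] gauss2_commute[of r x] gauss2_Fourier[OF r] ..
  also have "\<dots> = (1 / (4 * pi\<^sup>2)) * (\<integral>\<omega>. (\<integral>t. ?f t \<omega> \<partial>lborel) \<partial>M)" by (rule integral_mult_right_zero)
  also have "(\<integral>\<omega>. (\<integral>t. ?f t \<omega> \<partial>lborel) \<partial>M) = (\<integral>t. (\<integral>\<omega>. ?f t \<omega> \<partial>M) \<partial>lborel)"
    by (rule P.Fubini_integral[OF int])
  also have "\<dots> = (\<integral>t. complex_of_real (gauss_weight r t) * (iexp (- (t \<bullet> x)) * char2 N t) \<partial>lborel)"
  proof (rule Bochner_Integration.integral_cong[OF refl])
    fix t
    have "iexp (t \<bullet> (Z N \<omega> - x)) = iexp (- (t \<bullet> x)) * iexp (t \<bullet> Z N \<omega>)" for \<omega>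
      by (simp add: inner_diff_right exp_add[symmetric] algebra_simps)
    then show "(\<integral>\<omega>. ?f t \<omega> \<partial>M) = complex_of_real (gauss_weight r t) * (iexp (- (t \<bullet> x)) * char2 N t)"
      unfolding char2_def by (simp only: integral_mult_right_zero)
  qed
  finally show ?thesis .
qed

lemma smoothed_density_tendsto:
  assumes r: "r > 0"
  shows "(\<lambda>N. smoothed_density r N x) \<longlonglongrightarrow> limit_density r x"
proof -
  have "(\<lambda>N. complex_of_real (smoothed_density r N x)) \<longlonglongrightarrow>
     (1 / (4 * pi\<^sup>2)) * (\<integral>t. complex_of_real (gauss_weight r t) * (iexp (- (t \<bullet> x)) * \<phi> t) \<partial>lborel)"
    unfolding smoothed_density_Fourier[OF r]
  proof (intro tendsto_mult tendsto_const integral_dominated_convergence[OF _ _ integrable_gauss_weight[OF r]])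
    show "AE t in lborel. (\<lambda>N. complex_of_real (gauss_weight r t) * (iexp (- (t \<bullet> x)) * char2 N t))
      \<longlonglongrightarrow> complex_of_real (gauss_weight r t) * (iexp (- (t \<bullet> x)) * \<phi> t)"
      by (intro AE_I2 tendsto_mult tendsto_const char2_tendsto)
    show "AE t in lborel. norm (complex_of_real (gauss_weight r t) * (iexp (- (t \<bullet> x)) * char2 N t)) \<le> gauss_weight r t" for N
      using norm_char2 by (auto simp: norm_mult)
  qed measurable
  from tendsto_Re[OF this] show ?thesis unfolding limit_density_def by simp
qed

lemma limit_density_bound: "\<bar>limit_density r x\<bar> \<le> (\<integral>t. norm (\<phi> t) \<partial>lborel) / (4 * pi\<^sup>2)"
proof -
  have "\<bar>limit_density r x\<bar> \<le> norm ((1 / (4 * pi\<^sup>2)) * (\<integral>t. complex_of_real (gauss_weight r t) * (iexp (- (t \<bullet> x)) * \<phi> t) \<partial>lborel))"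
    unfolding limit_density_def by (rule abs_Re_le_cmod)
  also have "\<dots> = 1 / (4 * pi\<^sup>2) * norm (\<integral>t. complex_of_real (gauss_weight r t) * (iexp (- (t \<bullet> x)) * \<phi> t) \<partial>lborel)"
    by (simp add: norm_mult norm_divide norm_power)
  also have "norm (\<integral>t. complex_of_real (gauss_weight r t) * (iexp (- (t \<bullet> x)) * \<phi> t) \<partial>lborel) \<le> (\<integral>t. norm (\<phi> t) \<partial>lborel)"
  proof (rule norm_integral_le)
  qed (use int_phi in \<open>auto simp: norm_mult intro!: mult_left_le_one_le\<close>)
  finally show ?thesis by (simp add: divide_right_mono)
qed

lemma limit_density_tendsto: "(\<lambda>m. limit_density (1 / real (Suc m)) x) \<longlonglongrightarrow> limit_density 0 x"
  unfolding limit_density_def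
proof (intro tendsto_Re tendsto_mult tendsto_const integral_dominated_convergence[where w = "\<lambda>t. norm (\<phi> t)"])
  show "AE t in lborel. (\<lambda>m. complex_of_real (exp (- (1 / real (Suc m) * norm t)\<^sup>2 / 2)) * (iexp (- (t \<bullet> x)) * \<phi> t))
     \<longlonglongrightarrow> complex_of_real (exp (- (0 * norm t)\<^sup>2 / 2)) * (iexp (- (t \<bullet> x)) * \<phi> t)"
    by (intro AE_I2 tendsto_mult tendsto_const tendsto_of_real tendsto_exp tendsto_intros tendsto_divide)
       (use LIMSEQ_inverse_real_of_nat in \<open>auto simp: inverse_eq_divide\<close>)
  show "AE t in lborel. norm (complex_of_real (exp (- (1 / real (Suc m) * norm t)\<^sup>2 / 2)) * (iexp (- (t \<bullet> x)) * \<phi> t)) \<le> norm (\<phi> t)" for m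
    by (auto simp: norm_mult intro!: mult_left_le_one_le)
qed (use int_phi in \<open>measurable, auto\<close>)

lemma limit_density_nonneg_pos: "r > 0 \<Longrightarrow> limit_density r x \<ge> 0"
  by (rule LIMSEQ_le_const[OF smoothed_density_tendsto]) (auto simp: smoothed_density_def)

text \<open>Nonnegativity comes from the smoothed densities, of which this is a double limit.\<close>

lemma limit_density_nonneg: "limit_density 0 x \<ge> 0"
  by (rule LIMSEQ_le_const[OF limit_density_tendsto]) (auto intro!: limit_density_nonneg_pos)

lemma measurable_limit_density [measurable]: "limit_density r \<in> borel_measurable borel"
  unfolding limit_density_def[abs_def] by measurable

lemma measurable_smoothed_density [measurable]: "smoothed_density r N \<in> borel_measurable borel"
  unfolding smoothed_density_def[abs_def] by measurable

lemma smoothed_density_bound: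
  assumes r: "r > 0"
  shows "\<bar>smoothed_density r N x\<bar> \<le> 1 / (2 * pi * r\<^sup>2)"
proof -
  have b: "gauss2 r y \<le> 1 / (2 * pi * r\<^sup>2)" for y
    using r by (simp add: gauss2_eq divide_right_mono)
  have "smoothed_density r N x \<le> (\<integral>\<omega>. 1 / (2 * pi * r\<^sup>2) \<partial>M)"
    unfolding smoothed_density_def
    by (intro integral_mono integrable_const_bound[of _ "1 / (2 * pi * r\<^sup>2)"]) (use b in auto)
  moreover have "smoothed_density r N x \<ge> 0" unfolding smoothed_density_def by simp
  ultimately show ?thesis by (simp add: prob_space)
qed

context
  fixes h :: "real \<times> real \<Rightarrow> real" and R :: real
  assumes h: "continuous_on UNIV h" and supp: "\<And>x. norm x > R \<Longrightarrow> h x = 0"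
begin

lemma measurable_test [measurable]: "h \<in> borel_measurable borel"
  using h by (rule borel_measurable_continuous_onI)

lemma smoothed_expectation:
  assumes r: "r > 0"
  shows "(\<integral>\<omega>. (\<integral>x. gauss2 r (x - Z N \<omega>) * h x \<partial>lborel) \<partial>M) = (\<integral>x. h x * smoothed_density r N x \<partial>lborel)"
proof -
  interpret P: pair_sigma_finite "lborel :: (real \<times> real) measure" M ..
  have b: "gauss2 r y \<le> 1 / (2 * pi * r\<^sup>2)" for y
    using r by (simp add: gauss2_eq divide_right_mono)
  have i: "integrable lborel (\<lambda>x. 1 / (2 * pi * r\<^sup>2) * \<bar>h x\<bar>)"
    using compact_support_integrable[OF h supp] by auto
  have int: "integrable (lborel \<Otimes>\<^sub>M M) (\<lambda>(x, \<omega>). gauss2 r (x - Z N \<omega>) * h x)"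
  proof (rule integrable_pair_prob_bound[OF prob_space_axioms _ i])
    fix x \<omega>
    show "norm (case (x, \<omega>) of (x, \<omega>) \<Rightarrow> gauss2 r (x - Z N \<omega>) * h x) \<le> 1 / (2 * pi * r\<^sup>2) * \<bar>h x\<bar>"
      unfolding prod.case real_norm_def abs_mult by (intro mult_right_mono) (simp_all only: abs_of_nonneg gauss2_nonneg b abs_ge_zero)
  qed measurable
  have "(\<integral>\<omega>. (\<integral>x. gauss2 r (x - Z N \<omega>) * h x \<partial>lborel) \<partial>M) = (\<integral>x. (\<integral>\<omega>. gauss2 r (x - Z N \<omega>) * h x \<partial>M) \<partial>lborel)"
    by (rule P.Fubini_integral[OF int])
  also have "\<dots> = (\<integral>x. h x * smoothed_density r N x \<partial>lborel)"
    by (simp add: smoothed_density_def mult.commute)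
  finally show ?thesis .
qed

text \<open>
  Smoothing changes the expectation of \<open>h (Z N)\<close> by a quantity that is small uniformly in \<open>N\<close>, because \<open>h\<close> is
  uniformly continuous.  After smoothing, dominated convergence applies.
\<close>

theorem expectation_tendsto: "(\<lambda>N. \<integral>\<omega>. h (Z N \<omega>) \<partial>M) \<longlonglongrightarrow> (\<integral>x. h x * limit_density 0 x \<partial>lborel)"
proof (rule LIMSEQ_I)
  fix e :: real assume e: "e > 0"
  have hi: "integrable lborel h" by (rule compact_support_integrable[OF h supp])
  obtain B where B: "B \<ge> 0" "\<And>x. \<bar>h x\<bar> \<le> B" using compact_support_bounded[OF h supp] by blast
  have "e / 4 > 0" using e by simp
  obtain \<delta> where \<delta>: "\<delta> > 0" "\<And>x z. norm (x - z) < \<delta> \<Longrightarrow> \<bar>h x - h z\<bar> \<le> e / 4"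
    using compact_support_uniformly_continuous[OF h supp \<open>e / 4 > 0\<close>] by blast
  have L1: "(\<lambda>m. \<integral>x. h x * limit_density (1 / real (Suc m)) x \<partial>lborel) \<longlonglongrightarrow> (\<integral>x. h x * limit_density 0 x \<partial>lborel)"
  proof (rule integral_dominated_convergence[where w = "\<lambda>x. \<bar>h x\<bar> * ((\<integral>t. norm (\<phi> t) \<partial>lborel) / (4 * pi\<^sup>2))"])
    show "AE x in lborel. (\<lambda>m. h x * limit_density (1 / real (Suc m)) x) \<longlonglongrightarrow> h x * limit_density 0 x"
      by (intro AE_I2 tendsto_mult tendsto_const limit_density_tendsto)
    show "AE x in lborel. norm (h x * limit_density (1 / real (Suc m)) x) \<le> \<bar>h x\<bar> * ((\<integral>t. norm (\<phi> t) \<partial>lborel) / (4 * pi\<^sup>2))" for m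
      by (intro AE_I2) (simp only: real_norm_def abs_mult, intro mult_left_mono limit_density_bound abs_ge_zero)
  qed (use hi in auto)
  have "(\<lambda>m. 4 * B * (1 / real (Suc m))\<^sup>2 / \<delta>\<^sup>2) \<longlonglongrightarrow> 0" using \<delta>(1) by real_asymp
  from order_tendstoD(2)[OF this \<open>e / 4 > 0\<close>] tendstoD[OF L1 \<open>e / 4 > 0\<close>]
  have "eventually (\<lambda>m. 4 * B * (1 / real (Suc m))\<^sup>2 / \<delta>\<^sup>2 < e / 4 \<and>
     dist (\<integral>x. h x * limit_density (1 / real (Suc m)) x \<partial>lborel) (\<integral>x. h x * limit_density 0 x \<partial>lborel) < e / 4) sequentially"
    by (rule eventually_conj)
  from eventually_happens'[OF sequentially_bot this] obtain m where
    m: "4 * B * (1 / real (Suc m))\<^sup>2 / \<delta>\<^sup>2 < e / 4" "dist (\<integral>x. h x * limit_density (1 / real (Suc m)) x \<partial>lborel) (\<integral>x. h x * limit_density 0 x \<partial>lborel) < e / 4"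
    by blast
  define r where "r = 1 / real (Suc m)"
  have r: "r > 0" by (simp add: r_def)
  have L2: "(\<lambda>N. \<integral>x. h x * smoothed_density r N x \<partial>lborel) \<longlonglongrightarrow> (\<integral>x. h x * limit_density r x \<partial>lborel)"
  proof (rule integral_dominated_convergence[where w = "\<lambda>x. \<bar>h x\<bar> * (1 / (2 * pi * r\<^sup>2))"])
    show "AE x in lborel. (\<lambda>N. h x * smoothed_density r N x) \<longlonglongrightarrow> h x * limit_density r x"
      by (intro AE_I2 tendsto_mult tendsto_const smoothed_density_tendsto r)
    show "AE x in lborel. norm (h x * smoothed_density r N x) \<le> \<bar>h x\<bar> * (1 / (2 * pi * r\<^sup>2))" for N
      by (intro AE_I2) (simp only: real_norm_def abs_mult, intro mult_left_mono smoothed_density_bound r abs_ge_zero)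
  qed (use hi in auto)
  from tendstoD[OF this \<open>e / 4 > 0\<close>] obtain N0 where
    N0: "\<And>N. N \<ge> N0 \<Longrightarrow> dist (\<integral>x. h x * smoothed_density r N x \<partial>lborel) (\<integral>x. h x * limit_density r x \<partial>lborel) < e / 4"
    unfolding eventually_sequentially by blast
  show "\<exists>no. \<forall>N\<ge>no. norm ((\<integral>\<omega>. h (Z N \<omega>) \<partial>M) - (\<integral>x. h x * limit_density 0 x \<partial>lborel)) < e"
  proof (intro exI[of _ N0] allI impI)
    fix N assume N: "N \<ge> N0"
    have ap: "\<bar>(\<integral>x. gauss2 r (x - z) * h x \<partial>lborel) - h z\<bar> \<le> e / 4 + 4 * B * r\<^sup>2 / \<delta>\<^sup>2" for z
      using gauss2_approx_identity[of h B z \<delta> "e/4" r] B \<delta> r e by simp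
    have b2: "4 * B * r\<^sup>2 / \<delta>\<^sup>2 < e / 4" using m(1) unfolding r_def .
    have i1: "integrable M (\<lambda>\<omega>. h (Z N \<omega>))" by (rule integrable_const_bound[of _ B]) (use B in auto)
    have [measurable]: "(\<lambda>\<omega>. \<integral>x. gauss2 r (x - Z N \<omega>) * h x \<partial>lborel) \<in> borel_measurable M" by measurable
    have i2: "integrable M (\<lambda>\<omega>. \<integral>x. gauss2 r (x - Z N \<omega>) * h x \<partial>lborel)"
    proof (rule integrable_const_bound[of _ "B + (e / 4 + 4 * B * r\<^sup>2 / \<delta>\<^sup>2)"], intro AE_I2)
      fix \<omega>
      show "norm (\<integral>x. gauss2 r (x - Z N \<omega>) * h x \<partial>lborel) \<le> B + (e / 4 + 4 * B * r\<^sup>2 / \<delta>\<^sup>2)"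
        using ap[of "Z N \<omega>"] B(2)[of "Z N \<omega>"] by (simp only: real_norm_def)
    qed measurable
    have "\<bar>(\<integral>\<omega>. (\<integral>x. gauss2 r (x - Z N \<omega>) * h x \<partial>lborel) \<partial>M) - (\<integral>\<omega>. h (Z N \<omega>) \<partial>M)\<bar>
        = \<bar>\<integral>\<omega>. (\<integral>x. gauss2 r (x - Z N \<omega>) * h x \<partial>lborel) - h (Z N \<omega>) \<partial>M\<bar>" using i1 i2 by simp
    also have "\<dots> \<le> (\<integral>\<omega>. e / 4 + 4 * B * r\<^sup>2 / \<delta>\<^sup>2 \<partial>M)"
      unfolding real_norm_def[symmetric]
      by (rule norm_integral_le) (simp_all only: ap real_norm_def integrable_const)
    also have "\<dots> = e / 4 + 4 * B * r\<^sup>2 / \<delta>\<^sup>2" by (simp add: prob_space)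
    finally have "\<bar>(\<integral>x. h x * smoothed_density r N x \<partial>lborel) - (\<integral>\<omega>. h (Z N \<omega>) \<partial>M)\<bar> \<le> e / 4 + 4 * B * r\<^sup>2 / \<delta>\<^sup>2"
      unfolding smoothed_expectation[OF r] .
    with N0[OF N] m(2) b2 show "norm ((\<integral>\<omega>. h (Z N \<omega>) \<partial>M) - (\<integral>x. h x * limit_density 0 x \<partial>lborel)) < e"
      unfolding r_def[symmetric] dist_real_def real_norm_def by linarith
  qed
qed

end

lemma gaussian_expectation:
  assumes r: "r > 0"
  shows "complex_of_real (\<integral>\<omega>. exp (- (r * norm (Z N \<omega>))\<^sup>2 / 2) \<partial>M) = (\<integral>t. complex_of_real (gauss2 r t) * char2 N t \<partial>lborel)"
proof -
  interpret P: pair_sigma_finite "lborel :: (real \<times> real) measure" M ..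
  let ?f = "\<lambda>t \<omega>. complex_of_real (gauss2 r t) * iexp (t \<bullet> Z N \<omega>)"
  have int: "integrable (lborel \<Otimes>\<^sub>M M) (case_prod ?f)"
    by (rule integrable_pair_prob_bound[OF prob_space_axioms _ integrable_gauss2[OF r]]) (auto simp: norm_mult)
  have "complex_of_real (\<integral>\<omega>. exp (- (r * norm (Z N \<omega>))\<^sup>2 / 2) \<partial>M) = (\<integral>\<omega>. (\<integral>t. ?f t \<omega> \<partial>lborel) \<partial>M)"
    unfolding integral_complex_of_real[symmetric] gauss2_char[OF r] ..
  also have "\<dots> = (\<integral>t. (\<integral>\<omega>. ?f t \<omega> \<partial>M) \<partial>lborel)" by (rule P.Fubini_integral[OF int])
  finally show ?thesis unfolding char2_def by (simp only: integral_mult_right_zero)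
qed

lemma gaussian_expectation_tendsto:
  assumes r: "r > 0"
  shows "(\<lambda>N. \<integral>\<omega>. exp (- (r * norm (Z N \<omega>))\<^sup>2 / 2) \<partial>M) \<longlonglongrightarrow> Re (\<integral>t. gauss2 r t *\<^sub>R \<phi> t \<partial>lborel)"
proof -
  have "(\<lambda>N. complex_of_real (\<integral>\<omega>. exp (- (r * norm (Z N \<omega>))\<^sup>2 / 2) \<partial>M)) \<longlonglongrightarrow> (\<integral>t. complex_of_real (gauss2 r t) * \<phi> t \<partial>lborel)"
    unfolding gaussian_expectation[OF r]
  proof (rule integral_dominated_convergence[OF _ _ integrable_gauss2[OF r]])
    show "AE t in lborel. (\<lambda>N. complex_of_real (gauss2 r t) * char2 N t) \<longlonglongrightarrow> complex_of_real (gauss2 r t) * \<phi> t"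
      by (intro AE_I2 tendsto_mult tendsto_const char2_tendsto)
    have "norm (complex_of_real (gauss2 r t) * char2 N t) \<le> gauss2 r t" for N t
      using mult_left_mono[OF norm_char2[of N t], of "gauss2 r t"] by (simp add: norm_mult)
    then show "AE t in lborel. norm (complex_of_real (gauss2 r t) * char2 N t) \<le> gauss2 r t" for N
      by (rule AE_I2)
  qed measurable
  from tendsto_Re[OF this] show ?thesis by (simp add: scaleR_conv_of_real)
qed

text \<open>
  Continuity of \<open>\<phi>\<close> at the origin is what prevents mass from escaping to infinity: it makes the
  limiting Gaussian expectations close to one.
\<close>

lemma gaussian_mass_near_1:
  assumes e: "e > 0"
  obtains r where "r > 0" "Re (\<integral>t. gauss2 r t *\<^sub>R \<phi> t \<partial>lborel) \<ge> 1 - e"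
proof -
  have e2: "e / 2 > 0" using e by simp
  then obtain d where d: "d > 0" "\<And>x. norm (x - 0) < d \<Longrightarrow> norm (\<phi> x - \<phi> 0) \<le> e / 2"
    using cont0 unfolding continuous_at_eps_delta dist_norm by (meson less_imp_le)
  have "((\<lambda>r. 4 * 1 * r\<^sup>2 / d\<^sup>2) \<longlongrightarrow> 0) (at_right 0)" using d(1) by real_asymp
  from order_tendstoD(2)[OF this e2] have "\<forall>\<^sub>F r in at_right 0. 4 * 1 * r\<^sup>2 / d\<^sup>2 < e / 2" .
  from eventually_happens'[OF trivial_limit_at_right_real eventually_conj[OF eventually_at_right_less this]]
  obtain r where r: "r > 0" "4 * 1 * r\<^sup>2 / d\<^sup>2 < e / 2" by blast
  have "norm ((\<integral>x. gauss2 r (x - 0) *\<^sub>R \<phi> x \<partial>lborel) - \<phi> 0) \<le> e / 2 + 4 * 1 * r\<^sup>2 / d\<^sup>2"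
    by (rule gauss2_approx_identity[of \<phi> 1 0 d "e / 2" r]) (use e norm_phi d r(1) in auto)
  then have "norm ((\<integral>x. gauss2 r x *\<^sub>R \<phi> x \<partial>lborel) - 1) \<le> e" using r(2) by (simp add: phi_0)
  then have "\<bar>Re (\<integral>x. gauss2 r x *\<^sub>R \<phi> x \<partial>lborel) - 1\<bar> \<le> e"
    using abs_Re_le_cmod[of "(\<integral>x. gauss2 r x *\<^sub>R \<phi> x \<partial>lborel) - 1"] by simp
  then show thesis by (intro that[OF r(1)]) linarith
qed

definition "cutoff R x = max 0 (min 1 (R + 1 - norm (x :: real \<times> real)))"

lemma cutoff_props:
  shows "continuous_on UNIV (cutoff R)" "norm x > R + 1 \<Longrightarrow> cutoff R x = 0" "0 \<le> cutoff R x" "cutoff R x \<le> 1"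
    "norm x \<le> R \<Longrightarrow> cutoff R x = 1" "R \<le> R' \<Longrightarrow> cutoff R x \<le> cutoff R' x"
  unfolding cutoff_def[abs_def] by (auto intro!: continuous_intros)

text \<open>
  The limiting masses \<open>c m\<close> of growing cutoffs are at most one.  They are bounded below by comparing
  the cutoff with a Gaussian, whose limiting expectation is close to one.
\<close>

lemma has_bochner_integral_limit_density:
  "integrable lborel (limit_density 0)" "(\<integral>x. limit_density 0 x \<partial>lborel) = 1"
proof -
  define c where "c = (\<lambda>m. \<integral>x. cutoff (real m) x * limit_density 0 x \<partial>lborel)"
  have cm[measurable]: "cutoff R \<in> borel_measurable borel" for R
    using cutoff_props(1) by (rule borel_measurable_continuous_onI)
  have lim: "(\<lambda>N. \<integral>\<omega>. cutoff (real m) (Z N \<omega>) \<partial>M) \<longlonglongrightarrow> c m" for m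
    unfolding c_def by (rule expectation_tendsto[OF cutoff_props(1) cutoff_props(2)])
  have ci: "integrable M (\<lambda>\<omega>. cutoff R (Z N \<omega>))" for R N
    by (rule integrable_const_bound[of _ 1]) (auto simp: cutoff_props)
  have c1: "c m \<le> 1" for m
  proof (rule LIMSEQ_le_const2[OF lim], intro exI[of _ 0] allI impI)
    fix N
    have "(\<integral>\<omega>. cutoff (real m) (Z N \<omega>) \<partial>M) \<le> (\<integral>\<omega>. 1 \<partial>M)"
      by (rule integral_mono[OF ci]) (auto simp: cutoff_props)
    then show "(\<integral>\<omega>. cutoff (real m) (Z N \<omega>) \<partial>M) \<le> 1" by (simp add: prob_space)
  qed
  have clow: "c m \<ge> Re (\<integral>t. gauss2 r t *\<^sub>R \<phi> t \<partial>lborel) - exp (- (r * real m)\<^sup>2 / 2)" if r: "r > 0" for m r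
  proof (rule LIMSEQ_le[OF tendsto_diff[OF gaussian_expectation_tendsto[OF r] tendsto_const] lim], intro exI[of _ 0] allI impI)
    fix N
    have i: "integrable M (\<lambda>\<omega>. exp (- (r * norm (Z N \<omega>))\<^sup>2 / 2))"
      by (rule integrable_const_bound[of _ 1]) auto
    have "exp (- (r * norm x)\<^sup>2 / 2) - exp (- (r * real m)\<^sup>2 / 2) \<le> cutoff (real m) x" for x
    proof (cases "norm x \<le> real m")
      case True
      have "exp (- (r * norm x)\<^sup>2 / 2) \<le> 1" "exp (- (r * real m)\<^sup>2 / 2) \<ge> 0" by auto
      then show ?thesis using cutoff_props(5)[OF True] by linarith
    next
      case False
      then have "(r * real m)\<^sup>2 \<le> (r * norm x)\<^sup>2" using r by (intro power_mono mult_left_mono) auto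
      then have "exp (- (r * norm x)\<^sup>2 / 2) \<le> exp (- (r * real m)\<^sup>2 / 2)" by simp
      then show ?thesis using cutoff_props(3)[of "real m" x] by linarith
    qed
    then have "(\<integral>\<omega>. exp (- (r * norm (Z N \<omega>))\<^sup>2 / 2) - exp (- (r * real m)\<^sup>2 / 2) \<partial>M) \<le> (\<integral>\<omega>. cutoff (real m) (Z N \<omega>) \<partial>M)"
      by (intro integral_mono ci Bochner_Integration.integrable_diff i) auto
    then show "(\<integral>\<omega>. exp (- (r * norm (Z N \<omega>))\<^sup>2 / 2) \<partial>M) - exp (- (r * real m)\<^sup>2 / 2) \<le> (\<integral>\<omega>. cutoff (real m) (Z N \<omega>) \<partial>M)"
      using i by (simp add: prob_space)
  qed
  have "c \<longlonglongrightarrow> 1"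
  proof (rule LIMSEQ_I)
    fix e :: real assume e: "e > 0"
    then obtain r where r: "r > 0" "Re (\<integral>t. gauss2 r t *\<^sub>R \<phi> t \<partial>lborel) \<ge> 1 - e / 2"
      using gaussian_mass_near_1[of "e / 2"] by auto
    have "(\<lambda>m. exp (- (r * real m)\<^sup>2 / 2)) \<longlonglongrightarrow> 0" using r(1) by real_asymp
    from order_tendstoD(2)[OF this, of "e / 2"] e obtain m0 where m0: "\<And>m. m \<ge> m0 \<Longrightarrow> exp (- (r * real m)\<^sup>2 / 2) < e / 2"
      unfolding eventually_sequentially by auto
    have "norm (c m - 1) < e" if "m \<ge> m0" for m
      using m0[OF that] clow[OF r(1), of m] r(2) c1[of m] unfolding real_norm_def by linarith
    then show "\<exists>no. \<forall>m\<ge>no. norm (c m - 1) < e" by blast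
  qed
  moreover have "AE x in lborel. mono (\<lambda>m. cutoff (real m) x * limit_density 0 x)"
    by (intro AE_I2 monoI mult_right_mono cutoff_props limit_density_nonneg) auto
  moreover have "AE x in lborel. (\<lambda>m. cutoff (real m) x * limit_density 0 x) \<longlonglongrightarrow> limit_density 0 x"
  proof (intro AE_I2 tendsto_eventually)
    fix x :: "real \<times> real"
    have "eventually (\<lambda>m. real m \<ge> norm x) sequentially" by real_asymp
    then show "\<forall>\<^sub>F m in sequentially. cutoff (real m) x * limit_density 0 x = limit_density 0 x"
      by eventually_elim (simp add: cutoff_props)
  qed
  moreover have "integrable lborel (\<lambda>x. cutoff (real m) x * limit_density 0 x)" for m
  proof (rule Bochner_Integration.integrable_bound[of _ "\<lambda>x. cutoff (real m) x * ((\<integral>t. norm (\<phi> t) \<partial>lborel) / (4 * pi\<^sup>2))"])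
    show "integrable lborel (\<lambda>x. cutoff (real m) x * ((\<integral>t. norm (\<phi> t) \<partial>lborel) / (4 * pi\<^sup>2)))"
      using compact_support_integrable[OF cutoff_props(1) cutoff_props(2)] by auto
    show "AE x in lborel. norm (cutoff (real m) x * limit_density 0 x) \<le> norm (cutoff (real m) x * ((\<integral>t. norm (\<phi> t) \<partial>lborel) / (4 * pi\<^sup>2)))"
      unfolding norm_mult by (intro AE_I2 mult_left_mono norm_ge_zero) (simp add: limit_density_bound)
  qed measurable
  moreover have "limit_density 0 \<in> borel_measurable lborel" by simp
  ultimately have "has_bochner_integral lborel (limit_density 0) 1"
    unfolding c_def by (intro has_bochner_integral_monotone_convergence)
  then show "integrable lborel (limit_density 0)" "(\<integral>x. limit_density 0 x \<partial>lborel) = 1"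
    by (auto simp: has_bochner_integral_iff)
qed

end

section \<open>The intensity of the rescaled energy levels\<close>

lemma integrable_exp_neg_abs:
  assumes r: "\<rho> > 0"
  shows "integrable lborel (\<lambda>y::real. exp (- \<rho> * \<bar>y\<bar>))"
proof -
  have e: "integrable lborel (exponential_density \<rho>)"
  proof (rule integrableI_nonneg)
    interpret prob_space "density lborel (exponential_density \<rho>)" by (rule prob_space_exponential_density[OF r])
    show "(\<integral>\<^sup>+x. ennreal (exponential_density \<rho> x) \<partial>lborel) < \<infinity>"
      using emeasure_space_1 by (simp add: emeasure_density)
  qed (use r in \<open>auto intro!: AE_I2 exponential_density_nonneg\<close>)
  then have "integrable lborel (\<lambda>x. exponential_density \<rho> (0 + (-1) * x))"
    by (rule lborel_integrable_real_affine) simp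
  then have "integrable lborel (\<lambda>x. 1 / \<rho> * (exponential_density \<rho> x + exponential_density \<rho> (- x)))"
    using e by auto
  then show ?thesis
    by (rule Bochner_Integration.integrable_bound) (use r in \<open>auto intro!: AE_I2 simp: exponential_density_def mult.commute abs_mult\<close>)
qed

locale rem_boundary =
  fixes \<sigma> \<tau> :: real
  assumes sigma: "\<sigma> > 1 / sqrt 2" and tau: "\<tau> > 0" and sum: "\<sigma> + \<tau> = sqrt 2"
begin

text \<open>
  The margin in all exponential estimates.  The exponents \<open>2 \<sigma> - \<surd>2\<close> and \<open>\<surd>2 - \<sigma>\<close> govern the decay at
  \<open>-\<infinity>\<close> and \<open>\<infinity>\<close>; the factor six leaves room for the envelope of the densities, for the
  perturbation of \<open>\<beta>\<close> and for polynomial factors.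
\<close>

definition "\<kappa> = min (2 * \<sigma> - sqrt 2) \<tau> / 6"

lemma kappa: "\<kappa> > 0" "6 * \<kappa> \<le> 2 * \<sigma> - sqrt 2" "6 * \<kappa> \<le> sqrt 2 - \<sigma>"
  and sigma_pos: "\<sigma> > 0" and sigma_less: "\<sigma> < sqrt 2"
proof -
  have "2 / sqrt 2 = sqrt 2" by (rule real_div_sqrt) simp
  then have "2 * \<sigma> - sqrt 2 > 0" using mult_strict_left_mono[OF sigma, of 2] by simp
  then show "\<kappa> > 0" "6 * \<kappa> \<le> 2 * \<sigma> - sqrt 2" "6 * \<kappa> \<le> sqrt 2 - \<sigma>"
    using tau sum unfolding \<kappa>_def by auto
  have "1 / sqrt 2 > (0::real)" by simp
  then show "\<sigma> > 0" using sigma by linarith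
  show "\<sigma> < sqrt 2" using sum tau by linarith
qed

definition "logN N = ln (real N)"
definition "loglog N = ln (4 * pi * logN N)"
text \<open>
  The location of the largest of the variables \<open>\<surd>n X\<^sub>k\<close>.  With this centring, \<open>N\<close> times the density of a rescaled
  level converges without further normalisation.
\<close>

definition "centring N = sqrt 2 * logN N - loglog N / (2 * sqrt 2)"
definition "level_density N y = real N * normal_density (- centring N) (sqrt (logN N)) y"
definition "limit_intensity y = sqrt 2 * exp (- (sqrt 2 * y))"

abbreviation "envelope y \<equiv> exp (- (sqrt 2 * y) + \<kappa> * \<bar>y\<bar>)"

lemma level_density_nonneg [simp]: "level_density N y \<ge> 0" by (simp add: level_density_def)
lemma limit_intensity_pos: "limit_intensity y > 0" by (simp add: limit_intensity_def)

lemma measurable_level_density [measurable]: "level_density N \<in> borel_measurable borel" "limit_intensity \<in> borel_measurable borel"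
  unfolding level_density_def[abs_def] limit_intensity_def[abs_def] by measurable

lemma logN_pos: "N \<ge> 2 \<Longrightarrow> logN N > 0" by (simp add: logN_def)

text \<open>
  Completing the square: the factor \<open>exp (L / 2)\<close> that the logarithmic term of the centring produces
  cancels the normalisation \<open>1 / \<surd>(2 \<pi> n)\<close> and leaves \<open>\<surd>2\<close>.
\<close>

lemma level_density_eq:
  assumes N: "N \<ge> 2"
  shows "level_density N y = sqrt 2 * exp (- (loglog N)\<^sup>2 / (16 * logN N)) * exp (- (sqrt 2 - loglog N / (2 * sqrt 2 * logN N)) * y - y\<^sup>2 / (2 * logN N))"
proof -
  define n where "n = logN N"
  define L where "L = loglog N"
  have n: "n > 0" using logN_pos[OF N] by (simp add: n_def)
  have Nn: "real N = exp n" using N by (simp add: n_def logN_def)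
  have L: "sqrt (4 * pi * n) = exp (L / 2)"
  proof -
    have "sqrt (exp L) = exp (L / 2)" by (rule real_sqrt_unique) (simp_all add: power2_eq_square exp_add[symmetric])
    then show ?thesis using n by (simp add: L_def loglog_def n_def)
  qed
  have s: "1 / sqrt (2 * pi * n) = sqrt 2 * exp (- L / 2)"
  proof -
    have "sqrt (4 * pi * n) = sqrt 2 * sqrt (2 * pi * n)" by (simp add: real_sqrt_mult[symmetric])
    then show ?thesis using L n by (simp add: exp_minus field_simps)
  qed
  have expo: "n + (- L / 2) + (- (y + centring N)\<^sup>2 / (2 * n)) = - L\<^sup>2 / (16 * n) + (- (sqrt 2 - L / (2 * sqrt 2 * n)) * y - y\<^sup>2 / (2 * n))"
  proof -
    define q where "q = sqrt (2::real)"
    have q: "q * q = 2" "q > 0" by (simp_all add: q_def)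
    have sh: "centring N = q * n - L * q / 4" unfolding centring_def n_def[symmetric] L_def[symmetric] q_def[symmetric]
      using q by (simp add: field_simps)
    have lq: "L / (2 * q * n) = L * q / (4 * n)" using q n by (simp add: field_simps)
    have sq: "(y + (q * n - L * q / 4))\<^sup>2 = y\<^sup>2 + 2 * y * (q * n - L * q / 4) + (2 * n\<^sup>2 - n * L + L\<^sup>2 / 8)"
    proof -
      have "(q * n - L * q / 4)\<^sup>2 = (q * q) * (n - L / 4)\<^sup>2" by (simp add: power2_eq_square field_simps)
      also have "\<dots> = 2 * n\<^sup>2 - n * L + L\<^sup>2 / 8" unfolding q(1) by (simp add: power2_eq_square field_simps)
      finally show ?thesis unfolding power2_sum by (simp only: algebra_simps)
    qed
    show ?thesis unfolding sh q_def[symmetric] lq sq using n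
      by (simp add: field_simps power2_eq_square)
  qed
  have "level_density N y = exp n * (1 / sqrt (2 * pi * n) * exp (- (y + centring N)\<^sup>2 / (2 * n)))"
    using n unfolding level_density_def normal_density_def n_def[symmetric] by (simp add: Nn)
  also have "\<dots> = sqrt 2 * exp (n + (- L / 2) + (- (y + centring N)\<^sup>2 / (2 * n)))"
    unfolding s exp_add by (simp only: mult_ac)
  also have "\<dots> = sqrt 2 * exp (- L\<^sup>2 / (16 * n)) * exp (- (sqrt 2 - L / (2 * sqrt 2 * n)) * y - y\<^sup>2 / (2 * n))"
    unfolding expo unfolding exp_add by (simp only: mult.assoc)
  finally show ?thesis unfolding n_def L_def .
qed

lemma level_density_tendsto: "(\<lambda>N. level_density N y) \<longlonglongrightarrow> limit_intensity y"
proof -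
  have "(\<lambda>N. sqrt 2 * exp (- (loglog N)\<^sup>2 / (16 * logN N)) * exp (- (sqrt 2 - loglog N / (2 * sqrt 2 * logN N)) * y - y\<^sup>2 / (2 * logN N)))
     \<longlonglongrightarrow> sqrt 2 * exp 0 * exp (- (sqrt 2 - 0) * y - 0)"
  proof (intro tendsto_intros)
    show "(\<lambda>N. - (loglog N)\<^sup>2 / (16 * logN N)) \<longlonglongrightarrow> 0" unfolding loglog_def logN_def by real_asymp
    show "(\<lambda>N. loglog N / (2 * sqrt 2 * logN N)) \<longlonglongrightarrow> 0" unfolding loglog_def logN_def by real_asymp
    show "(\<lambda>N. y\<^sup>2 / (2 * logN N)) \<longlonglongrightarrow> 0" unfolding logN_def by real_asymp
  qed
  then have "(\<lambda>N. level_density N y) \<longlonglongrightarrow> sqrt 2 * exp 0 * exp (- (sqrt 2 - 0) * y - 0)"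
    by (rule Lim_transform_eventually) (use level_density_eq in \<open>auto simp: eventually_sequentially intro!: exI[of _ 2]\<close>)
  then show ?thesis by (simp add: limit_intensity_def)
qed

lemma level_density_bound: "eventually (\<lambda>N. \<forall>y. level_density N y \<le> 2 * envelope y) sequentially"
proof -
  have "(\<lambda>N. \<bar>loglog N / (2 * sqrt 2 * logN N)\<bar>) \<longlonglongrightarrow> 0" unfolding loglog_def logN_def by real_asymp
  from order_tendstoD(2)[OF this kappa(1)] eventually_ge_at_top[of 2]
  show ?thesis
  proof eventually_elim
    case (elim N)
    show ?case
    proof
      fix y
      have n: "logN N > 0" by (rule logN_pos[OF elim(2)])
      define q where "q = loglog N / (2 * sqrt 2 * logN N)"
      have "q * y \<le> \<bar>q\<bar> * \<bar>y\<bar>" by (metis abs_ge_self abs_mult)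
      also have "\<dots> \<le> \<kappa> * \<bar>y\<bar>" using elim(1) unfolding q_def by (intro mult_right_mono) auto
      finally have qy: "q * y \<le> \<kappa> * \<bar>y\<bar>" .
      have "- (sqrt 2 - q) * y - y\<^sup>2 / (2 * logN N) \<le> - (sqrt 2 * y) + \<kappa> * \<bar>y\<bar>"
      proof -
        have "y\<^sup>2 / (2 * logN N) \<ge> 0" using n by simp
        moreover have "- (sqrt 2 - q) * y = - (sqrt 2 * y) + q * y" by (simp add: algebra_simps)
        ultimately show ?thesis using qy by linarith
      qed
      then have e2: "exp (- (sqrt 2 - q) * y - y\<^sup>2 / (2 * logN N)) \<le> envelope y" by simp
      have e1: "exp (- (loglog N)\<^sup>2 / (16 * logN N)) \<le> 1" using n by simp
      have "sqrt 2 \<le> (2::real)" by (rule real_le_lsqrt) auto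
      then have "sqrt 2 * exp (- (loglog N)\<^sup>2 / (16 * logN N)) \<le> 2 * 1" using e1 by (intro mult_mono) auto
      then have "level_density N y \<le> 2 * 1 * envelope y"
        unfolding level_density_eq[OF elim(2)] q_def[symmetric] by (rule mult_mono[OF _ e2]) auto
      then show "level_density N y \<le> 2 * envelope y" by simp
    qed
  qed
qed

definition "decay_integral = (\<integral>y. exp (- \<kappa> * \<bar>y\<bar>) \<partial>lborel)"

lemma decay_integral_nonneg: "decay_integral \<ge> 0" by (simp add: decay_integral_def)

lemma limit_intensity_bound: "limit_intensity y \<le> 2 * envelope y"
proof -
  have "sqrt 2 \<le> (2::real)" by (rule real_le_lsqrt) auto
  then show ?thesis unfolding limit_intensity_def using kappa(1) by (intro mult_mono) auto
qed

text \<open>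
  The interface to all later estimates: it suffices to check that \<open>g\<close> times the envelope decays
  like \<open>exp (- \<kappa> \<bar>y\<bar>)\<close>.
\<close>

lemma level_density_integral:
  fixes g :: "real \<Rightarrow> 'b::{banach, second_countable_topology}"
  assumes [measurable]: "g \<in> borel_measurable borel" and g: "\<And>y. envelope y * norm (g y) \<le> C * exp (- \<kappa> * \<bar>y\<bar>)"
    and d: "\<And>y. level_density N y \<le> 2 * envelope y"
  shows "integrable lborel (\<lambda>y. level_density N y *\<^sub>R g y)" "norm (\<integral>y. level_density N y *\<^sub>R g y \<partial>lborel) \<le> 2 * C * decay_integral"
proof -
  have le: "norm (level_density N y *\<^sub>R g y) \<le> 2 * C * exp (- \<kappa> * \<bar>y\<bar>)" for y
    using mult_right_mono[OF d, of "norm (g y)" y] g[of y] by simp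
  have i: "integrable lborel (\<lambda>y. 2 * C * exp (- \<kappa> * \<bar>y\<bar>))"
    using integrable_exp_neg_abs[OF kappa(1)] by simp
  show "integrable lborel (\<lambda>y. level_density N y *\<^sub>R g y)"
    by (rule Bochner_Integration.integrable_bound[OF i]) (use le in \<open>auto intro: order.trans[OF _ abs_ge_self]\<close>)
  from order.trans[OF integral_norm_bound integral_mono[OF integrable_norm[OF this] i le]]
  show "norm (\<integral>y. level_density N y *\<^sub>R g y \<partial>lborel) \<le> 2 * C * decay_integral" by (simp add: decay_integral_def)
qed

lemma limit_intensity_integral:
  fixes g :: "real \<Rightarrow> 'b::{banach, second_countable_topology}"
  assumes [measurable]: "g \<in> borel_measurable borel" and g: "\<And>y. envelope y * norm (g y) \<le> C * exp (- \<kappa> * \<bar>y\<bar>)"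
  shows "integrable lborel (\<lambda>y. limit_intensity y *\<^sub>R g y)" "norm (\<integral>y. limit_intensity y *\<^sub>R g y \<partial>lborel) \<le> 2 * C * decay_integral"
    "(\<lambda>N. \<integral>y. level_density N y *\<^sub>R g y \<partial>lborel) \<longlonglongrightarrow> (\<integral>y. limit_intensity y *\<^sub>R g y \<partial>lborel)"
proof -
  have le: "norm (q *\<^sub>R g y) \<le> 2 * C * exp (- \<kappa> * \<bar>y\<bar>)" if "0 \<le> q" "q \<le> 2 * envelope y" for q y
    using mult_right_mono[OF that(2), of "norm (g y)"] that(1) g[of y] by simp
  note le2 = le[OF less_imp_le[OF limit_intensity_pos] limit_intensity_bound]
  have i: "integrable lborel (\<lambda>y. 2 * C * exp (- \<kappa> * \<bar>y\<bar>))"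
    using integrable_exp_neg_abs[OF kappa(1)] by simp
  show i2: "integrable lborel (\<lambda>y. limit_intensity y *\<^sub>R g y)"
    by (rule Bochner_Integration.integrable_bound[OF i]) (use le2 in \<open>auto intro: order.trans[OF _ abs_ge_self]\<close>)
  from order.trans[OF integral_norm_bound integral_mono[OF integrable_norm[OF this] i le2]]
  show "norm (\<integral>y. limit_intensity y *\<^sub>R g y \<partial>lborel) \<le> 2 * C * decay_integral" by (simp add: decay_integral_def)
  obtain N0 where N0: "\<And>N y. N \<ge> N0 \<Longrightarrow> level_density N y \<le> 2 * envelope y"
    using level_density_bound unfolding eventually_sequentially by blast
  have "(\<lambda>N. \<integral>y. level_density (N + N0) y *\<^sub>R g y \<partial>lborel) \<longlonglongrightarrow> (\<integral>y. limit_intensity y *\<^sub>R g y \<partial>lborel)"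
  proof (rule integral_dominated_convergence[OF _ _ i])
    show "AE y in lborel. (\<lambda>N. level_density (N + N0) y *\<^sub>R g y) \<longlonglongrightarrow> limit_intensity y *\<^sub>R g y"
      by (intro AE_I2 tendsto_scaleR tendsto_const LIMSEQ_ignore_initial_segment level_density_tendsto)
    show "AE y in lborel. norm (level_density (N + N0) y *\<^sub>R g y) \<le> 2 * C * exp (- \<kappa> * \<bar>y\<bar>)" for N
      by (intro AE_I2 le level_density_nonneg N0) simp
  qed measurable
  then show "(\<lambda>N. \<integral>y. level_density N y *\<^sub>R g y \<partial>lborel) \<longlonglongrightarrow> (\<integral>y. limit_intensity y *\<^sub>R g y \<partial>lborel)"
    by (rule LIMSEQ_offset)
qed

end

section \<open>Exponential moments of the model\<close>

lemma
  fixes b :: complex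
  shows integrable_exp_std_normal: "integrable lborel (\<lambda>x. std_normal_density x *\<^sub>R exp (b * complex_of_real x))"
    and integral_exp_std_normal: "(\<integral>x. std_normal_density x *\<^sub>R exp (b * complex_of_real x) \<partial>lborel) = exp (b\<^sup>2 / 2)"
proof -
  define p q where "p = Re b" and "q = Im b"
  have b: "b = complex_of_real p + \<i> * complex_of_real q" by (simp add: p_def q_def complex_eq_iff)
  have sh: "std_normal_density x *\<^sub>R exp (b * complex_of_real x) = complex_of_real (exp (p\<^sup>2 / 2)) * (std_normal_density (x - p) *\<^sub>R iexp (q * x))" for x
  proof -
    have "exp (b * complex_of_real x) = exp (p * x) *\<^sub>R iexp (q * x)"
      unfolding b by (simp add: distrib_right exp_add exp_of_real[symmetric] scaleR_conv_of_real mult.assoc del: exp_of_real)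
    moreover have "std_normal_density x * exp (p * x) = exp (p\<^sup>2 / 2) * std_normal_density (x - p)"
      unfolding std_normal_density_def by (simp add: exp_add[symmetric] power2_diff algebra_simps add_divide_distrib diff_divide_distrib)
    ultimately show ?thesis by (metis (no_types, lifting) scaleR_conv_of_real scaleR_scaleR)
  qed
  have i0: "integrable lborel (\<lambda>x. std_normal_density (x - p))"
    using lborel_integrable_real_affine[of std_normal_density 1 "-p"] by simp
  have i1: "integrable lborel (\<lambda>x. std_normal_density (x - p) *\<^sub>R iexp (q * x))"
    by (rule Bochner_Integration.integrable_bound[OF i0]) auto
  show "integrable lborel (\<lambda>x. std_normal_density x *\<^sub>R exp (b * complex_of_real x))"
    unfolding sh using i1 by (rule integrable_mult_right)
  have "(\<integral>x. std_normal_density (x - p) *\<^sub>R iexp (q * x) \<partial>lborel) = (\<integral>x. std_normal_density x *\<^sub>R iexp (q * (p + x)) \<partial>lborel)"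
    using integral_lborel_translate[of "\<lambda>x. std_normal_density (x - p) *\<^sub>R iexp (q * x)" p] by simp
  also have "\<dots> = (\<integral>x. iexp (q * p) * (std_normal_density x *\<^sub>R iexp (q * x)) \<partial>lborel)"
    by (rule Bochner_Integration.integral_cong[OF refl]) (simp add: distrib_left exp_add)
  also have "\<dots> = iexp (q * p) * (\<integral>x. std_normal_density x *\<^sub>R iexp (q * x) \<partial>lborel)"
    by (rule integral_mult_right_zero)
  also have "\<dots> = iexp (q * p) * char std_normal_distribution q"
    unfolding char_def by (subst integral_density) auto
  finally have "(\<integral>x. std_normal_density (x - p) *\<^sub>R iexp (q * x) \<partial>lborel) = iexp (q * p) * complex_of_real (exp (- q\<^sup>2 / 2))"
    by (simp add: char_std_normal_distribution)
  then have "(\<integral>x. std_normal_density x *\<^sub>R exp (b * complex_of_real x) \<partial>lborel)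
     = complex_of_real (exp (p\<^sup>2 / 2)) * (iexp (q * p) * complex_of_real (exp (- q\<^sup>2 / 2)))"
    unfolding sh by (simp only: integral_mult_right_zero)
  also have "\<dots> = exp (complex_of_real (p\<^sup>2 / 2) + \<i> * complex_of_real (q * p) + complex_of_real (- q\<^sup>2 / 2))"
    by (simp only: exp_add exp_of_real[symmetric] mult.assoc)
  also have "complex_of_real (p\<^sup>2 / 2) + \<i> * complex_of_real (q * p) + complex_of_real (- q\<^sup>2 / 2) = b\<^sup>2 / 2"
    unfolding b by (simp add: power2_eq_square field_simps)
  finally show "(\<integral>x. std_normal_density x *\<^sub>R exp (b * complex_of_real x) \<partial>lborel) = exp (b\<^sup>2 / 2)" .
qed

locale rem_model = rem_boundary \<sigma> \<tau> + prob_space M for \<sigma> \<tau> :: real and M :: "'a measure" +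
  fixes X :: "nat \<Rightarrow> 'a \<Rightarrow> real"
  assumes indep: "indep_vars (\<lambda>_. borel) X {1..}"
    and dist: "\<And>k. k \<ge> 1 \<Longrightarrow> distributed M lborel (X k) std_normal_density"
begin

definition "Y N k \<omega> = sqrt (logN N) * X k \<omega> - centring N"

lemma measurable_X [measurable]: "k \<ge> 1 \<Longrightarrow> X k \<in> borel_measurable M"
  using distributed_measurable[OF dist] by simp

lemma measurable_Y [measurable]: "k \<ge> 1 \<Longrightarrow> Y N k \<in> borel_measurable M"
  unfolding Y_def[abs_def] by measurable

lemma Y_distributed:
  assumes N: "N \<ge> 2" and k: "k \<ge> 1"
  shows "distributed M lborel (Y N k) (normal_density (- centring N) (sqrt (logN N)))"
proof -
  have "distributed M lborel (\<lambda>x. - centring N + sqrt (logN N) * X k x) (normal_density (- centring N + sqrt (logN N) * 0) (\<bar>sqrt (logN N)\<bar> * 1))"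
    by (rule normal_density_affine) (use dist[OF k] logN_pos[OF N] in auto)
  then show ?thesis using logN_pos[OF N] unfolding Y_def[abs_def] by simp
qed

lemma Y_integral:
  fixes g :: "real \<Rightarrow> 'b::{banach, second_countable_topology}"
  assumes N: "N \<ge> 2" and k: "k \<ge> 1" and [measurable]: "g \<in> borel_measurable borel"
  shows "real N *\<^sub>R (\<integral>\<omega>. g (Y N k \<omega>) \<partial>M) = (\<integral>y. level_density N y *\<^sub>R g y \<partial>lborel)"
    and "integrable M (\<lambda>\<omega>. g (Y N k \<omega>)) \<longleftrightarrow> integrable lborel (\<lambda>y. level_density N y *\<^sub>R g y)"
proof -
  note [measurable] = measurable_Y[OF k]
  let ?f = "normal_density (- centring N) (sqrt (logN N))"
  have d: "distr M lborel (Y N k) = density lborel ?f"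
    by (rule distributed_distr_eq_density[OF Y_distributed[OF N k]])
  have "(\<integral>\<omega>. g (Y N k \<omega>) \<partial>M) = (\<integral>y. g y \<partial>(distr M lborel (Y N k)))"
    by (subst integral_distr) auto
  also have "\<dots> = (\<integral>y. ?f y *\<^sub>R g y \<partial>lborel)" unfolding d by (subst integral_density) auto
  finally show "real N *\<^sub>R (\<integral>\<omega>. g (Y N k \<omega>) \<partial>M) = (\<integral>y. level_density N y *\<^sub>R g y \<partial>lborel)"
    unfolding level_density_def by (simp add: integral_scaleR_right[symmetric] del: integral_scaleR_right)
  have "integrable M (\<lambda>\<omega>. g (Y N k \<omega>)) \<longleftrightarrow> integrable (distr M lborel (Y N k)) g"
    by (subst integrable_distr_eq) auto
  also have "\<dots> \<longleftrightarrow> integrable lborel (\<lambda>y. ?f y *\<^sub>R g y)"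
    unfolding d by (subst integrable_density) auto
  also have "\<dots> \<longleftrightarrow> integrable lborel (\<lambda>y. level_density N y *\<^sub>R g y)"
  proof
    assume "integrable lborel (\<lambda>y. ?f y *\<^sub>R g y)"
    from integrable_scaleR_right[OF this, of "real N"] show "integrable lborel (\<lambda>y. level_density N y *\<^sub>R g y)"
      by (simp add: level_density_def)
  next
    assume "integrable lborel (\<lambda>y. level_density N y *\<^sub>R g y)"
    from integrable_scaleR_right[OF this, of "1 / real N"] show "integrable lborel (\<lambda>y. ?f y *\<^sub>R g y)"
      using N by (simp add: level_density_def)
  qed
  finally show "integrable M (\<lambda>\<omega>. g (Y N k \<omega>)) \<longleftrightarrow> integrable lborel (\<lambda>y. level_density N y *\<^sub>R g y)" .
qed

definition "expo \<beta> y = exp (\<beta> * complex_of_real y)"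
definition mgf :: "nat \<Rightarrow> complex \<Rightarrow> complex" where
  "mgf N \<beta> = exp (\<beta>\<^sup>2 * of_real (logN N) / 2 - \<beta> * of_real (centring N))"

lemma measurable_expo [measurable]: "expo \<beta> \<in> borel_measurable borel" unfolding expo_def[abs_def] by measurable

lemma norm_expo: "norm (expo \<beta> y) = exp (Re \<beta> * y)" by (simp add: expo_def)

lemma
  assumes k: "k \<ge> 1" and N: "N \<ge> 2"
  shows integrable_expo: "integrable M (\<lambda>\<omega>. expo \<beta> (Y N k \<omega>))"
    and expectation_expo: "(\<integral>\<omega>. expo \<beta> (Y N k \<omega>) \<partial>M) = mgf N \<beta>"
proof -
  note [measurable] = measurable_X[OF k]
  define b where "b = \<beta> * of_real (sqrt (logN N))"
  have d: "distr M lborel (X k) = density lborel std_normal_density"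
    by (rule distributed_distr_eq_density[OF dist[OF k]])
  have eq: "expo \<beta> (Y N k \<omega>) = exp (- \<beta> * of_real (centring N)) * exp (b * complex_of_real (X k \<omega>))" for \<omega>
    by (simp add: expo_def Y_def b_def exp_add[symmetric] algebra_simps)
  have "integrable (distr M lborel (X k)) (\<lambda>x. exp (b * complex_of_real x))"
    unfolding d by (subst integrable_density) (auto simp: integrable_exp_std_normal)
  then have i: "integrable M (\<lambda>\<omega>. exp (b * complex_of_real (X k \<omega>)))"
    by (subst (asm) integrable_distr_eq) auto
  then show "integrable M (\<lambda>\<omega>. expo \<beta> (Y N k \<omega>))" unfolding eq by (rule integrable_mult_right)
  have "(\<integral>\<omega>. exp (b * complex_of_real (X k \<omega>)) \<partial>M) = (\<integral>x. exp (b * complex_of_real x) \<partial>(distr M lborel (X k)))"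
    by (subst integral_distr) auto
  also have "\<dots> = exp (b\<^sup>2 / 2)" unfolding d by (subst integral_density) (auto simp: integral_exp_std_normal)
  finally have "(\<integral>\<omega>. exp (b * complex_of_real (X k \<omega>)) \<partial>M) = exp (b\<^sup>2 / 2)" .
  moreover have "b\<^sup>2 = \<beta>\<^sup>2 * of_real (logN N)"
    unfolding b_def power_mult_distrib of_real_power[symmetric] using logN_pos[OF N] by simp
  ultimately have "(\<integral>\<omega>. expo \<beta> (Y N k \<omega>) \<partial>M) = exp (- \<beta> * of_real (centring N)) * exp (\<beta>\<^sup>2 * of_real (logN N) / 2)"
    unfolding eq by (simp only: integral_mult_right_zero)
  then show "(\<integral>\<omega>. expo \<beta> (Y N k \<omega>) \<partial>M) = mgf N \<beta>"
    unfolding mgf_def exp_add[symmetric] by (simp add: algebra_simps)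
qed

definition "\<beta>0 = Complex \<sigma> \<tau>"

lemma real_times_mgf:
  assumes N: "N \<ge> 2"
  shows "of_nat N * mgf N \<beta> = exp (of_real (logN N) * (\<beta> - of_real (sqrt 2))\<^sup>2 / 2 + \<beta> * of_real (loglog N / (2 * sqrt 2)))"
proof -
  have "real N = exp (logN N)" using N by (simp add: logN_def)
  then have "of_real (real N) * mgf N \<beta> = exp (of_real (logN N) + (\<beta>\<^sup>2 * of_real (logN N) / 2 - \<beta> * of_real (centring N)))"
    unfolding mgf_def exp_add by (simp only: exp_of_real)
  also have "of_real (logN N) + (\<beta>\<^sup>2 * of_real (logN N) / 2 - \<beta> * of_real (centring N)) =
     of_real (logN N) * (\<beta> - of_real (sqrt 2))\<^sup>2 / 2 + \<beta> * of_real (loglog N / (2 * sqrt 2))"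
  proof -
    have "(complex_of_real (sqrt 2))\<^sup>2 = 2" by (simp add: of_real_power[symmetric] del: of_real_power)
    then show ?thesis unfolding centring_def by (simp add: power2_diff algebra_simps add_divide_distrib diff_divide_distrib)
  qed
  finally show ?thesis by simp
qed

lemma beta0_diff_sq: "(\<beta>0 - of_real (sqrt 2))\<^sup>2 = - 2 * \<i> * of_real (\<tau>\<^sup>2)"
proof -
  have "\<sigma> - sqrt 2 = - \<tau>" using sum by linarith
  then have "\<beta>0 - of_real (sqrt 2) = Complex (- \<tau>) \<tau>" by (simp add: \<beta>0_def complex_eq_iff)
  then show ?thesis by (simp add: complex_eq_iff power2_eq_square)
qed

text \<open>
  The mean of the whole sum grows like a power of \<open>n\<close>, less than the first power after squaring because
  \<open>\<sigma> < \<surd>2\<close>.  So the squared mean of one summand is negligible even after multiplication by \<open>N\<close>.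
\<close>

lemma norm_mgf_small: "(\<lambda>N. real N * (norm (mgf N \<beta>0))\<^sup>2) \<longlonglongrightarrow> 0"
proof (rule Lim_null_comparison)
  have "(\<lambda>N. 4 * pi * logN N / real N) \<longlonglongrightarrow> 0" unfolding logN_def by real_asymp
  then show "(\<lambda>N. 4 * pi * logN N / real N) \<longlonglongrightarrow> 0" .
  have "eventually (\<lambda>N. loglog N \<ge> 0) sequentially" unfolding loglog_def logN_def by real_asymp
  with eventually_ge_at_top[of 2]
  show "\<forall>\<^sub>F N in sequentially. norm (real N * (norm (mgf N \<beta>0))\<^sup>2) \<le> 4 * pi * logN N / real N"
  proof eventually_elim
    case (elim N)
    have "norm (of_nat N * mgf N \<beta>0) = exp (\<sigma> * (loglog N / (2 * sqrt 2)))"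
      unfolding real_times_mgf[OF elim(1)] beta0_diff_sq norm_exp_eq_Re by (simp add: \<beta>0_def)
    also have "\<dots> \<le> exp (loglog N / 2)"
    proof -
      have "\<sigma> * (loglog N / (2 * sqrt 2)) \<le> sqrt 2 * (loglog N / (2 * sqrt 2))"
        using sigma_less elim(2) by (intro mult_right_mono) auto
      then show ?thesis by simp
    qed
    finally have "(norm (of_nat N * mgf N \<beta>0))\<^sup>2 \<le> (exp (loglog N / 2))\<^sup>2" by (intro power_mono) auto
    also have "\<dots> = exp (loglog N)" by (simp add: power2_eq_square exp_add[symmetric])
    also have "\<dots> = 4 * pi * logN N" using logN_pos[OF elim(1)] by (simp add: loglog_def)
    finally have "real N * (real N * (norm (mgf N \<beta>0))\<^sup>2) \<le> 4 * pi * logN N"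
      by (simp add: norm_mult power2_eq_square mult_ac)
    then show ?case using elim(1) by (simp add: field_simps)
  qed
qed

end

section \<open>The characteristic function of the centred sum\<close>

text \<open>The derivative of the exponential function at the origin, along the sequence \<open>z / N\<close>.\<close>

lemma complex_exp_power_limit: "(\<lambda>N. of_nat N * (exp (z / of_nat N) - 1)) \<longlonglongrightarrow> (z::complex)"
proof (cases "z = 0")
  case False
  have d: "((\<lambda>h. (exp h - 1) / h) \<longlongrightarrow> (1::complex)) (at 0)"
    using DERIV_exp[of "0::complex"] unfolding DERIV_def by simp
  have "filterlim (\<lambda>N. z / of_nat N) (at 0) sequentially"
  proof (rule filterlim_atI)
    show "(\<lambda>N. z / of_nat N) \<longlonglongrightarrow> 0" by (rule lim_const_over_n)
    show "\<forall>\<^sub>F N in sequentially. z / of_nat N \<noteq> 0"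
      using eventually_gt_at_top[of 0] by eventually_elim (use False in simp)
  qed
  from filterlim_compose[OF d this]
  have "(\<lambda>N. z * ((exp (z / of_nat N) - 1) / (z / of_nat N))) \<longlonglongrightarrow> z * 1" by (intro tendsto_mult tendsto_const)
  then show ?thesis using False by (simp add: mult.commute)
qed simp

context rem_model
begin

definition "centred_sum N \<omega> = (\<Sum>k=1..N. expo \<beta>0 (Y N k \<omega>)) - of_nat N * mgf N \<beta>0"
definition "centred_sum_pair N \<omega> = (Re (centred_sum N \<omega>), Im (centred_sum N \<omega>))"
text \<open>The inner product of \<open>t\<close> with \<open>z\<close>, seen as a vector in the plane.\<close>

definition pairing :: "real \<times> real \<Rightarrow> complex \<Rightarrow> real" where "pairing t z = fst t * Re z + snd t * Im z"
definition "tilt t y = pairing t (expo \<beta>0 y)"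
definition "compensated_exp t y = iexp (tilt t y) - 1 - \<i> * complex_of_real (tilt t y)"
definition "char_exponent t = (\<integral>y. limit_intensity y *\<^sub>R compensated_exp t y \<partial>lborel)"

lemma inner_pairing: "t \<bullet> (Re z, Im z) = pairing t z" by (cases t) (simp add: pairing_def)

lemma abs_pairing: "\<bar>pairing t z\<bar> \<le> norm t * norm z"
proof -
  have "norm (Re z, Im z) = norm z" by (simp add: norm_Pair cmod_def)
  then show ?thesis using Cauchy_Schwarz_ineq2[of t "(Re z, Im z)"] by (simp add: inner_pairing)
qed

lemma measurable_tilt [measurable]: "tilt t \<in> borel_measurable borel"
  unfolding tilt_def[abs_def] pairing_def by measurable

lemma measurable_compensated_exp [measurable]: "compensated_exp t \<in> borel_measurable borel"
  unfolding compensated_exp_def[abs_def] by measurable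

lemma measurable_centred_sum [measurable]: "centred_sum N \<in> borel_measurable M"
proof -
  have [measurable]: "(\<lambda>\<omega>. \<Sum>k=1..N. expo \<beta>0 (Y N k \<omega>)) \<in> borel_measurable M"
    by (rule borel_measurable_sum) (auto intro!: measurable_compose[OF measurable_Y])
  show ?thesis unfolding centred_sum_def[abs_def] by measurable
qed

lemma measurable_centred_sum_pair [measurable]: "centred_sum_pair N \<in> borel_measurable M"
  unfolding centred_sum_pair_def[abs_def] by measurable

lemma abs_tilt: "\<bar>tilt t y\<bar> \<le> norm t * exp (\<sigma> * y)"
  using abs_pairing[of t "expo \<beta>0 y"] by (simp add: tilt_def norm_expo \<beta>0_def)

lemma norm_compensated_exp: "norm (compensated_exp t y) \<le> (tilt t y)\<^sup>2 / 2" "norm (compensated_exp t y) \<le> 2 * \<bar>tilt t y\<bar>"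
  using iexp_approx1[of "tilt t y" 1] iexp_approx2[of "tilt t y" 1]
  by (simp_all add: compensated_exp_def atMost_Suc power2_eq_square algebra_simps)

text \<open>
  The quadratic bound is used for negative \<open>y\<close>, where \<open>exp (2 \<sigma> y)\<close> compensates \<open>exp (- \<surd>2 y)\<close>, and the linear
  one for positive \<open>y\<close>, where \<open>exp (\<sigma> y)\<close> does not destroy the decay.
\<close>

lemma compensated_exp_dominated:
  "envelope y * norm (compensated_exp t y) \<le> ((norm t)\<^sup>2 + 2 * norm t) * exp (- \<kappa> * \<bar>y\<bar>)"
proof (cases "y < 0")
  case True
  have "(tilt t y)\<^sup>2 \<le> (norm t * exp (\<sigma> * y))\<^sup>2"
    using abs_tilt[of t y] by (intro abs_le_square_iff[THEN iffD1]) simp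
  also have "\<dots> = (norm t)\<^sup>2 * exp (2 * \<sigma> * y)" by (simp add: power_mult_distrib power2_eq_square exp_add[symmetric])
  finally have 1: "norm (compensated_exp t y) \<le> (norm t)\<^sup>2 * exp (2 * \<sigma> * y)" using norm_compensated_exp(1)[of t y] zero_le_power2[of "tilt t y"] by linarith
  have "envelope y * norm (compensated_exp t y) \<le> envelope y * ((norm t)\<^sup>2 * exp (2 * \<sigma> * y))"
    using 1 by (rule mult_left_mono) simp
  also have "\<dots> = (norm t)\<^sup>2 * exp (- (sqrt 2 * y) + \<kappa> * \<bar>y\<bar> + 2 * \<sigma> * y)" unfolding exp_add by (simp only: mult_ac)
  also have "\<dots> \<le> (norm t)\<^sup>2 * exp (- \<kappa> * \<bar>y\<bar>)"
  proof (rule mult_left_mono)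
    have "6 * \<kappa> * (- y) \<le> (2 * \<sigma> - sqrt 2) * (- y)" using kappa(2) True by (intro mult_right_mono) auto
    moreover have "\<kappa> * y \<le> 0" using kappa(1) True by (simp add: mult_nonneg_nonpos)
    ultimately show "exp (- (sqrt 2 * y) + \<kappa> * \<bar>y\<bar> + 2 * \<sigma> * y) \<le> exp (- \<kappa> * \<bar>y\<bar>)" using True by (simp add: algebra_simps)
  qed simp
  also have "\<dots> \<le> ((norm t)\<^sup>2 + 2 * norm t) * exp (- \<kappa> * \<bar>y\<bar>)" by (intro mult_right_mono) auto
  finally show ?thesis .
next
  case False
  have 1: "norm (compensated_exp t y) \<le> 2 * norm t * exp (\<sigma> * y)" using norm_compensated_exp(2)[of t y] abs_tilt[of t y] by linarith
  have "envelope y * norm (compensated_exp t y) \<le> envelope y * (2 * norm t * exp (\<sigma> * y))"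
    using 1 by (rule mult_left_mono) simp
  also have "\<dots> = 2 * norm t * exp (- (sqrt 2 * y) + \<kappa> * \<bar>y\<bar> + \<sigma> * y)" unfolding exp_add by (simp only: mult_ac)
  also have "\<dots> \<le> 2 * norm t * exp (- \<kappa> * \<bar>y\<bar>)"
  proof (rule mult_left_mono)
    have "6 * \<kappa> * y \<le> (sqrt 2 - \<sigma>) * y" using kappa(3) False by (intro mult_right_mono) auto
    moreover have "\<kappa> * y \<ge> 0" using kappa(1) False by simp
    ultimately show "exp (- (sqrt 2 * y) + \<kappa> * \<bar>y\<bar> + \<sigma> * y) \<le> exp (- \<kappa> * \<bar>y\<bar>)" using False by (simp add: algebra_simps)
  qed simp
  also have "\<dots> \<le> ((norm t)\<^sup>2 + 2 * norm t) * exp (- \<kappa> * \<bar>y\<bar>)" by (intro mult_right_mono) auto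
  finally show ?thesis .
qed

lemma integrable_char_exponent: "integrable lborel (\<lambda>y. limit_intensity y *\<^sub>R compensated_exp t y)"
  and norm_char_exponent: "norm (char_exponent t) \<le> 2 * ((norm t)\<^sup>2 + 2 * norm t) * decay_integral"
  and char_exponent_tendsto: "(\<lambda>N. \<integral>y. level_density N y *\<^sub>R compensated_exp t y \<partial>lborel) \<longlonglongrightarrow> char_exponent t"
  unfolding char_exponent_def using limit_intensity_integral[OF measurable_compensated_exp compensated_exp_dominated] by blast+

lemma Re_compensated_exp: "Re (compensated_exp t y) = cos (tilt t y) - 1"
  by (simp add: compensated_exp_def Re_exp)

lemma Re_char_exponent: "Re (char_exponent t) = - (\<integral>y. limit_intensity y * (1 - cos (tilt t y)) \<partial>lborel)"
proof -
  have "Re (char_exponent t) = (\<integral>y. Re (limit_intensity y *\<^sub>R compensated_exp t y) \<partial>lborel)"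
    unfolding char_exponent_def by (rule integral_Re[symmetric, OF integrable_char_exponent])
  also have "\<dots> = (\<integral>y. - (limit_intensity y * (1 - cos (tilt t y))) \<partial>lborel)"
    by (rule Bochner_Integration.integral_cong[OF refl]) (simp add: Re_compensated_exp algebra_simps)
  finally show ?thesis by simp
qed

lemma Re_char_exponent_nonpos: "Re (char_exponent t) \<le> 0"
  unfolding Re_char_exponent using less_imp_le[OF limit_intensity_pos] by (simp add: integral_nonneg_AE)

lemma measurable_char_exponent [measurable]: "char_exponent \<in> borel_measurable borel"
proof -
  have [measurable]: "fst \<in> borel_measurable (borel :: (real \<times> real) measure)" "snd \<in> borel_measurable (borel :: (real \<times> real) measure)"
    by (auto intro!: borel_measurable_continuous_onI continuous_intros)
  have [measurable]: "(\<lambda>(t, y). compensated_exp t y) \<in> borel_measurable (borel \<Otimes>\<^sub>M borel)"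
    unfolding compensated_exp_def tilt_def pairing_def by measurable
  show ?thesis unfolding char_exponent_def[abs_def] by measurable
qed

lemma centred_sum_char_eq:
  assumes N: "N \<ge> 2"
  shows "(\<integral>\<omega>. iexp (t \<bullet> centred_sum_pair N \<omega>) \<partial>M) = (\<integral>\<omega>. iexp (tilt t (Y N 1 \<omega>) - pairing t (mgf N \<beta>0)) \<partial>M) ^ N"
proof -
  let ?a = "pairing t (mgf N \<beta>0)"
  let ?g = "\<lambda>y. iexp (tilt t y - ?a)"
  have "t \<bullet> centred_sum_pair N \<omega> = (\<Sum>k=1..N. tilt t (Y N k \<omega>) - ?a)" for \<omega>
  proof -
    have "centred_sum N \<omega> = (\<Sum>k=1..N. expo \<beta>0 (Y N k \<omega>) - mgf N \<beta>0)" unfolding centred_sum_def by (simp add: sum_subtractf)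
    moreover have "pairing t (\<Sum>k=1..N. expo \<beta>0 (Y N k \<omega>) - mgf N \<beta>0) = (\<Sum>k=1..N. pairing t (expo \<beta>0 (Y N k \<omega>) - mgf N \<beta>0))"
      unfolding pairing_def by (simp only: Re_sum Im_sum sum_distrib_left sum.distrib)
    ultimately show ?thesis unfolding centred_sum_pair_def inner_pairing tilt_def by (simp add: pairing_def algebra_simps)
  qed
  then have "iexp (t \<bullet> centred_sum_pair N \<omega>) = (\<Prod>k=1..N. ?g (Y N k \<omega>))" for \<omega>
    by (simp add: sum_distrib_left exp_sum del: of_real_diff)
  then have "(\<integral>\<omega>. iexp (t \<bullet> centred_sum_pair N \<omega>) \<partial>M) = (\<integral>\<omega>. (\<Prod>k=1..N. ?g (Y N k \<omega>)) \<partial>M)" by simp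
  also have "\<dots> = (\<Prod>k=1..N. \<integral>\<omega>. ?g (Y N k \<omega>) \<partial>M)"
  proof (rule indep_vars_lebesgue_integral)
    have "indep_vars (\<lambda>_. borel) X {1..N}" by (rule indep_vars_subset[OF indep]) auto
    from indep_vars_compose2[OF this, where Y = "\<lambda>k x. ?g (sqrt (logN N) * x - centring N)" and N = "\<lambda>_. borel"]
    show "indep_vars (\<lambda>_. borel) (\<lambda>k \<omega>. ?g (Y N k \<omega>)) {1..N}" unfolding Y_def by measurable
    show "integrable M (\<lambda>\<omega>. ?g (Y N k \<omega>))" if "k \<in> {1..N}" for k
      by (rule integrable_const_bound[of _ 1]) (use that in \<open>auto intro!: measurable_compose[OF measurable_Y]\<close>)
  qed simp
  also have "\<dots> = (\<Prod>k=1..N. \<integral>\<omega>. ?g (Y N 1 \<omega>) \<partial>M)"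
  proof (rule prod.cong[OF refl])
    fix k assume "k \<in> {1..N}"
    then have k: "k \<ge> 1" by simp
    have "real N *\<^sub>R (\<integral>\<omega>. ?g (Y N k \<omega>) \<partial>M) = real N *\<^sub>R (\<integral>\<omega>. ?g (Y N 1 \<omega>) \<partial>M)"
      using Y_integral(1)[OF N k, of ?g] Y_integral(1)[OF N order_refl, of ?g] by simp
    then show "(\<integral>\<omega>. ?g (Y N k \<omega>) \<partial>M) = (\<integral>\<omega>. ?g (Y N 1 \<omega>) \<partial>M)" using N by simp
  qed
  finally show ?thesis by simp
qed

text \<open>
  The first-order term of the exponential integrates to the explicit mean; only the compensated part is an
  integral against the level density, and that one converges.
\<close>

lemma tilt_char_eq:
  assumes N: "N \<ge> 2" and d: "\<And>y. level_density N y \<le> 2 * envelope y"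
  shows "(\<integral>\<omega>. iexp (tilt t (Y N 1 \<omega>) - pairing t (mgf N \<beta>0)) \<partial>M) =
     iexp (- pairing t (mgf N \<beta>0)) * (1 + \<i> * complex_of_real (pairing t (mgf N \<beta>0)) + (1 / of_nat N) * (\<integral>y. level_density N y *\<^sub>R compensated_exp t y \<partial>lborel))"
proof -
  let ?a = "pairing t (mgf N \<beta>0)"
  note iY = integrable_expo[OF order_refl N, of \<beta>0]
  have iA: "integrable M (\<lambda>\<omega>. tilt t (Y N 1 \<omega>))"
    unfolding tilt_def pairing_def using iY by (intro Bochner_Integration.integrable_add integrable_mult_right integrable_Re integrable_Im)
  have eA: "(\<integral>\<omega>. tilt t (Y N 1 \<omega>) \<partial>M) = ?a"
    unfolding tilt_def pairing_def using iY by (simp add: integrable_Re integrable_Im integral_Re integral_Im expectation_expo[OF order_refl N] del: One_nat_def)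
  have iA': "integrable M (\<lambda>\<omega>. \<i> * complex_of_real (tilt t (Y N 1 \<omega>)))" using iA by (intro integrable_mult_right integrable_of_real)
  have eA': "(\<integral>\<omega>. \<i> * complex_of_real (tilt t (Y N 1 \<omega>)) \<partial>M) = \<i> * complex_of_real ?a"
    using eA by (simp only: integral_mult_right_zero integral_complex_of_real)
  have ih: "integrable M (\<lambda>\<omega>. compensated_exp t (Y N 1 \<omega>))"
    unfolding Y_integral(2)[OF N order_refl measurable_compensated_exp] by (rule level_density_integral(1)[OF measurable_compensated_exp compensated_exp_dominated d])
  have eh: "(\<integral>\<omega>. compensated_exp t (Y N 1 \<omega>) \<partial>M) = (1 / of_nat N) * (\<integral>y. level_density N y *\<^sub>R compensated_exp t y \<partial>lborel)"
    using Y_integral(1)[OF N order_refl measurable_compensated_exp, of t] N by (simp add: scaleR_conv_of_real field_simps)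
  have "(\<integral>\<omega>. iexp (tilt t (Y N 1 \<omega>) - ?a) \<partial>M) = (\<integral>\<omega>. iexp (- ?a) * (1 + \<i> * complex_of_real (tilt t (Y N 1 \<omega>)) + compensated_exp t (Y N 1 \<omega>)) \<partial>M)"
    by (rule Bochner_Integration.integral_cong[OF refl]) (simp add: compensated_exp_def exp_add[symmetric] algebra_simps)
  also have "\<dots> = iexp (- ?a) * (\<integral>\<omega>. 1 + \<i> * complex_of_real (tilt t (Y N 1 \<omega>)) + compensated_exp t (Y N 1 \<omega>) \<partial>M)"
    by (rule integral_mult_right_zero)
  also have "(\<integral>\<omega>. 1 + \<i> * complex_of_real (tilt t (Y N 1 \<omega>)) + compensated_exp t (Y N 1 \<omega>) \<partial>M) = 1 + \<i> * complex_of_real ?a + (1 / of_nat N) * (\<integral>y. level_density N y *\<^sub>R compensated_exp t y \<partial>lborel)"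
    using iA' ih by (simp only: Bochner_Integration.integral_add Bochner_Integration.integrable_add integrable_const eA' eh) (simp add: prob_space)
  finally show ?thesis .
qed

text \<open>
  With \<open>q\<close> the characteristic function of one summand, \<open>N (q - 1)\<close> tends to the exponent \<open>\<psi>\<close>: the centring
  \<open>a\<close> contributes only at order \<open>N a\<^sup>2\<close>, which is negligible.  Comparing \<open>q\<close> with
  \<open>exp (\<psi> / N)\<close>, both of norm at most one, avoids logarithms of \<open>q\<close>.
\<close>

theorem centred_sum_char_tendsto: "(\<lambda>N. \<integral>\<omega>. iexp (t \<bullet> centred_sum_pair N \<omega>) \<partial>M) \<longlonglongrightarrow> exp (char_exponent t)"
proof -
  define a where "a = (\<lambda>N. pairing t (mgf N \<beta>0))"
  define q where "q = (\<lambda>N. \<integral>\<omega>. iexp (tilt t (Y N 1 \<omega>) - a N) \<partial>M)"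
  define \<psi> where "\<psi> = char_exponent t"
  define w where "w = (\<lambda>N. \<integral>y. level_density N y *\<^sub>R compensated_exp t y \<partial>lborel)"
  have w: "w \<longlonglongrightarrow> \<psi>" unfolding w_def \<psi>_def by (rule char_exponent_tendsto)
  have Na: "(\<lambda>N. real N * (a N)\<^sup>2) \<longlonglongrightarrow> 0"
  proof (rule Lim_null_comparison)
    show "(\<lambda>N. (norm t)\<^sup>2 * (real N * (norm (mgf N \<beta>0))\<^sup>2)) \<longlonglongrightarrow> 0"
      using tendsto_mult[OF tendsto_const norm_mgf_small, of "(norm t)\<^sup>2"] by simp
    have "(a N)\<^sup>2 \<le> (norm t * norm (mgf N \<beta>0))\<^sup>2" for N
      using abs_pairing[of t "mgf N \<beta>0"] by (intro abs_le_square_iff[THEN iffD1]) (simp add: a_def)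
    then have "real N * (a N)\<^sup>2 \<le> real N * (norm t * norm (mgf N \<beta>0))\<^sup>2" for N by (rule mult_left_mono) simp
    then show "\<forall>\<^sub>F N in sequentially. norm (real N * (a N)\<^sup>2) \<le> (norm t)\<^sup>2 * (real N * (norm (mgf N \<beta>0))\<^sup>2)"
      by (intro always_eventually) (simp add: power_mult_distrib mult_ac)
  qed
  have a0: "a \<longlonglongrightarrow> 0"
  proof -
    have "(\<lambda>N. (a N)\<^sup>2) \<longlonglongrightarrow> 0"
    proof (rule Lim_null_comparison[OF _ Na])
      show "\<forall>\<^sub>F N in sequentially. norm ((a N)\<^sup>2) \<le> real N * (a N)\<^sup>2"
        using eventually_ge_at_top[of 1] by eventually_elim (simp add: mult_le_cancel_right1)
    qed
    from tendsto_real_sqrt[OF this] have "(\<lambda>N. \<bar>a N\<bar>) \<longlonglongrightarrow> 0" by simp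
    then show ?thesis by (rule tendsto_rabs_zero_cancel)
  qed
  have "(\<lambda>N. iexp (- a N) * (of_nat N * (1 + \<i> * of_real (a N) - iexp (a N))) + iexp (- a N) * w N) \<longlonglongrightarrow> iexp (- 0) * 0 + iexp (- 0) * \<psi>"
  proof (intro tendsto_add tendsto_mult w)
    show e: "(\<lambda>N. iexp (- a N)) \<longlonglongrightarrow> iexp (- 0)" using a0 by (intro tendsto_intros)
    then show "(\<lambda>N. iexp (- a N)) \<longlonglongrightarrow> iexp (- 0)" .
    show "(\<lambda>N. of_nat N * (1 + \<i> * of_real (a N) - iexp (a N))) \<longlonglongrightarrow> 0"
    proof (rule Lim_null_comparison)
      show "(\<lambda>N. real N * (a N)\<^sup>2 / 2) \<longlonglongrightarrow> 0" using tendsto_divide[OF Na tendsto_const, of 2] by simp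
      have "norm (1 + \<i> * of_real (a N) - iexp (a N)) \<le> (a N)\<^sup>2 / 2" for N
        using iexp_approx1[of "a N" 1] by (simp add: atMost_Suc power2_eq_square norm_minus_commute algebra_simps)
      then have "norm (of_nat N * (1 + \<i> * of_real (a N) - iexp (a N))) \<le> real N * ((a N)\<^sup>2 / 2)" for N
        unfolding norm_mult norm_of_nat by (rule mult_left_mono) simp
      then show "\<forall>\<^sub>F N in sequentially. norm (of_nat N * (1 + \<i> * of_real (a N) - iexp (a N))) \<le> real N * (a N)\<^sup>2 / 2"
        by (intro always_eventually) simp
    qed
  qed
  then have lim: "(\<lambda>N. iexp (- a N) * (of_nat N * (1 + \<i> * of_real (a N) - iexp (a N))) + iexp (- a N) * w N) \<longlonglongrightarrow> \<psi>" by simp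
  have ev: "\<forall>\<^sub>F N in sequentially. iexp (- a N) * (of_nat N * (1 + \<i> * of_real (a N) - iexp (a N))) + iexp (- a N) * w N = of_nat N * (q N - 1)"
    using eventually_ge_at_top[of 2] level_density_bound
  proof eventually_elim
    case (elim N)
    then have d: "\<And>y. level_density N y \<le> 2 * envelope y" by blast
    have q: "q N = iexp (- a N) * (1 + \<i> * of_real (a N) + (1 / of_nat N) * w N)"
      unfolding q_def a_def w_def by (rule tilt_char_eq[OF elim(1) d])
    have "iexp (- a N) * iexp (a N) = 1" by (simp add: exp_add[symmetric])
    moreover have "of_nat N * (1 / of_nat N) = (1::complex)" using elim(1) by simp
    ultimately show ?case unfolding q by algebra
  qed
  have Nq: "(\<lambda>N. of_nat N * (q N - 1)) \<longlonglongrightarrow> \<psi>"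
    by (rule Lim_transform_eventually[OF lim ev])
  have "(\<lambda>N. of_nat N * (q N - 1) - of_nat N * (exp (\<psi> / of_nat N) - 1)) \<longlonglongrightarrow> \<psi> - \<psi>"
    by (intro tendsto_diff Nq complex_exp_power_limit)
  then have dl: "(\<lambda>N. norm (of_nat N * (q N - exp (\<psi> / of_nat N)))) \<longlonglongrightarrow> 0"
    by (intro tendsto_norm_zero) (simp add: algebra_simps)
  have "(\<lambda>N. q N ^ N - exp \<psi>) \<longlonglongrightarrow> 0"
  proof (rule Lim_null_comparison[OF _ dl])
    show "\<forall>\<^sub>F N in sequentially. norm (q N ^ N - exp \<psi>) \<le> norm (of_nat N * (q N - exp (\<psi> / of_nat N)))"
      using eventually_ge_at_top[of 2]
    proof eventually_elim
      case (elim N)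
      have "exp (\<psi> / of_nat N) ^ N = exp \<psi>" using elim by (simp add: exp_of_nat_mult[symmetric])
      moreover have "norm (q N) \<le> 1"
      proof -
        have "norm (q N) \<le> (\<integral>\<omega>. 1 \<partial>M)" unfolding q_def by (rule norm_integral_le) auto
        then show ?thesis by (simp add: prob_space)
      qed
      moreover have "norm (exp (\<psi> / of_nat N)) \<le> 1"
        using Re_char_exponent_nonpos[of t] elim by (simp add: \<psi>_def divide_nonpos_pos)
      ultimately show ?case using norm_power_diff[of "q N" "exp (\<psi> / of_nat N)" N] by (simp add: norm_mult)
    qed
  qed
  then have "(\<lambda>N. q N ^ N) \<longlonglongrightarrow> exp \<psi>" by (rule LIM_zero_cancel)
  moreover have "\<forall>\<^sub>F N in sequentially. q N ^ N = (\<integral>\<omega>. iexp (t \<bullet> centred_sum_pair N \<omega>) \<partial>M)"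
    using eventually_ge_at_top[of 2] by eventually_elim (simp only: centred_sum_char_eq q_def a_def)
  ultimately show ?thesis unfolding \<psi>_def by (rule Lim_transform_eventually)
qed

text \<open>Taylor's formula gives \<open>x\<^sup>2 / 3\<close>; a quarter is enough.\<close>

lemma one_minus_cos_ge:
  fixes x :: real
  assumes "\<bar>x\<bar> \<le> 1"
  shows "x\<^sup>2 / 4 \<le> 1 - cos x"
proof -
  have "norm (iexp x - (1 + \<i> * x + (\<i> * x)\<^sup>2 / 2)) \<le> \<bar>x\<bar> ^ 3 / 6"
    using iexp_approx1[of x 2] by (simp add: numeral_eq_Suc fact_reduce)
  then have "\<bar>Re (iexp x - (1 + \<i> * x + (\<i> * x)\<^sup>2 / 2))\<bar> \<le> \<bar>x\<bar> ^ 3 / 6"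
    using abs_Re_le_cmod order_trans by blast
  moreover have "Re (iexp x - (1 + \<i> * x + (\<i> * x)\<^sup>2 / 2)) = cos x - 1 + x\<^sup>2 / 2"
    by (simp add: Re_exp power2_eq_square)
  moreover have "\<bar>x\<bar> ^ 3 \<le> x\<^sup>2"
    using mult_right_mono[OF assms, of "\<bar>x\<bar>\<^sup>2"] by (simp add: power2_eq_square power3_eq_cube)
  moreover have "0 \<le> x\<^sup>2" by simp
  ultimately show ?thesis by linarith
qed

lemma integral_cos_squared_period:
  fixes \<theta> :: real
  shows "has_bochner_integral lborel (\<lambda>y. (cos (\<tau> * y - \<theta>))\<^sup>2 * indicator {a..a + pi / \<tau>} y) (pi / (2 * \<tau>))"
proof -
  define F where "F = (\<lambda>y. y / 2 + sin (2 * (\<tau> * y - \<theta>)) / (4 * \<tau>))"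
  have F: "(F has_real_derivative (cos (\<tau> * y - \<theta>))\<^sup>2) (at y)" for y
  proof -
    have "(F has_real_derivative 1 / 2 + cos (2 * (\<tau> * y - \<theta>)) * (2 * \<tau>) / (4 * \<tau>)) (at y)"
      unfolding F_def using tau by (auto intro!: derivative_eq_intros)
    moreover have "1 / 2 + cos (2 * (\<tau> * y - \<theta>)) * (2 * \<tau>) / (4 * \<tau>) = (cos (\<tau> * y - \<theta>))\<^sup>2"
      using tau unfolding cos_double_cos by (simp add: field_simps)
    ultimately show ?thesis by simp
  qed
  have per: "sin (2 * (\<tau> * (a + pi / \<tau>) - \<theta>)) = sin (2 * (\<tau> * a - \<theta>))"
  proof -
    have "2 * (\<tau> * (a + pi / \<tau>) - \<theta>) = 2 * (\<tau> * a - \<theta>) + 2 * pi" using tau by (simp add: field_simps)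
    then show ?thesis by (simp only: sin_periodic)
  qed
  have "has_bochner_integral lborel (\<lambda>y. (cos (\<tau> * y - \<theta>))\<^sup>2 * indicator {a..a + pi / \<tau>} y) (F (a + pi / \<tau>) - F a)"
    by (rule has_bochner_integral_FTC_Icc_nonneg) (use F tau in auto)
  also have "F (a + pi / \<tau>) - F a = pi / (2 * \<tau>)" unfolding F_def per by (simp add: field_simps)
  finally show ?thesis .
qed

lemma tilt_polar:
  obtains \<theta> where "\<And>y. tilt t y = norm t * exp (\<sigma> * y) * cos (\<tau> * y - \<theta>)"
proof -
  define z where "z = Complex (fst t) (snd t)"
  have "norm z = norm t" by (cases t) (simp add: z_def norm_Pair complex_norm)
  then have z: "fst t = norm t * cos (Arg z)" "snd t = norm t * sin (Arg z)"
    using rcis_cmod_Arg[of z] unfolding z_def by (metis Re_rcis complex.sel(1), metis Im_rcis complex.sel(2))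
  have "tilt t y = norm t * exp (\<sigma> * y) * cos (\<tau> * y - Arg z)" for y
  proof -
    have "tilt t y = fst t * (exp (\<sigma> * y) * cos (\<tau> * y)) + snd t * (exp (\<sigma> * y) * sin (\<tau> * y))"
      by (simp add: tilt_def pairing_def expo_def \<beta>0_def Re_exp Im_exp)
    also have "\<dots> = norm t * exp (\<sigma> * y) * cos (\<tau> * y - Arg z)"
      unfolding z cos_diff by (simp add: algebra_simps)
    finally show ?thesis .
  qed
  then show thesis by (rule that)
qed

text \<open>
  Only levels with \<open>norm t * exp (\<sigma> y)\<close> between \<open>exp (- \<sigma> T)\<close> and one are used, that is, an interval of length \<open>T = \<pi> / \<tau>\<close>.
  This is a full period of the squared cosine, so the bound does not depend on the direction of \<open>t\<close>.
  On this interval the intensity has order \<open>norm t powr (\<surd>2 / \<sigma>)\<close>, which for \<open>norm t \<ge> 1\<close>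
  dominates \<open>norm t\<close>.
\<close>

lemma char_exponent_decay:
  obtains c where "c > 0" "\<And>t. norm t \<ge> 1 \<Longrightarrow> Re (char_exponent t) \<le> - c * norm t"
proof -
  define T where "T = pi / \<tau>"
  have T: "T > 0" using tau by (simp add: T_def)
  define c where "c = sqrt 2 * exp (- 2 * \<sigma> * T) / 4 * (pi / (2 * \<tau>))"
  have c: "c > 0" using tau by (simp add: c_def)
  show thesis
  proof (rule that[OF c])
    fix t :: "real \<times> real" assume t: "norm t \<ge> 1"
    obtain \<theta> where th: "\<And>y. tilt t y = norm t * exp (\<sigma> * y) * cos (\<tau> * y - \<theta>)" using tilt_polar by blast
    define l where "l = ln (norm t)"
    have "norm t > 0" using t by linarith
    then have l: "l \<ge> 0" "norm t = exp l" using t unfolding l_def by simp_all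
    define a where "a = - l / \<sigma> - T"
    have "c * norm t = (\<integral>y. (sqrt 2 * exp (- 2 * \<sigma> * T) / 4 * norm t) * ((cos (\<tau> * y - \<theta>))\<^sup>2 * indicator {a..a + pi / \<tau>} y) \<partial>lborel)"
      using has_bochner_integral_integral_eq[OF integral_cos_squared_period[of \<theta> a]] by (simp add: c_def)
    also have "\<dots> \<le> (\<integral>y. limit_intensity y * (1 - cos (tilt t y)) \<partial>lborel)"
    proof (rule integral_mono)
      show "integrable lborel (\<lambda>y. (sqrt 2 * exp (- 2 * \<sigma> * T) / 4 * norm t) * ((cos (\<tau> * y - \<theta>))\<^sup>2 * indicator {a..a + pi / \<tau>} y))"
        using integral_cos_squared_period[of \<theta> a] by (intro integrable_mult_right) (auto simp: has_bochner_integral_iff)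
      have "integrable lborel (\<lambda>y. - Re (limit_intensity y *\<^sub>R compensated_exp t y))"
        using integrable_Re[OF integrable_char_exponent] by simp
      then show "integrable lborel (\<lambda>y. limit_intensity y * (1 - cos (tilt t y)))"
        by (rule back_subst[of "integrable lborel"]) (auto simp: fun_eq_iff Re_compensated_exp algebra_simps)
      fix y
      show "(sqrt 2 * exp (- 2 * \<sigma> * T) / 4 * norm t) * ((cos (\<tau> * y - \<theta>))\<^sup>2 * indicator {a..a + pi / \<tau>} y) \<le> limit_intensity y * (1 - cos (tilt t y))"
      proof (cases "y \<in> {a..a + pi / \<tau>}")
        case False
        then show ?thesis using limit_intensity_pos[of y] by simp
      next
        case True
        then have y: "a \<le> y" "y \<le> - l / \<sigma>" by (auto simp: a_def T_def)
        have sy: "\<sigma> * y \<le> - l" "\<sigma> * y \<ge> - l - \<sigma> * T"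
        proof -
          have "\<sigma> * a = - l - \<sigma> * T" using sigma_pos by (simp add: a_def field_simps)
          then show "\<sigma> * y \<ge> - l - \<sigma> * T" using mult_left_mono[OF y(1), of \<sigma>] sigma_pos by simp
          show "\<sigma> * y \<le> - l" using mult_left_mono[OF y(2), of \<sigma>] sigma_pos by simp
        qed
        have e: "norm t * exp (\<sigma> * y) \<le> 1" "norm t * exp (\<sigma> * y) \<ge> exp (- \<sigma> * T)"
          using sy unfolding l(2) by (simp_all add: exp_add[symmetric])
        have "\<bar>tilt t y\<bar> = norm t * exp (\<sigma> * y) * \<bar>cos (\<tau> * y - \<theta>)\<bar>" unfolding th by (simp add: abs_mult)
        also have "\<dots> \<le> 1 * 1" using e by (intro mult_mono) auto
        finally have "\<bar>tilt t y\<bar> \<le> 1" by simp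
        from one_minus_cos_ge[OF this] have 1: "(tilt t y)\<^sup>2 / 4 \<le> 1 - cos (tilt t y)" .
        have "exp (- 2 * \<sigma> * T) = (exp (- \<sigma> * T))\<^sup>2" by (simp add: power2_eq_square exp_add[symmetric])
        also have "\<dots> \<le> (norm t * exp (\<sigma> * y))\<^sup>2" using e(2) by (intro power_mono) auto
        finally have "exp (- 2 * \<sigma> * T) * (cos (\<tau> * y - \<theta>))\<^sup>2 \<le> (norm t * exp (\<sigma> * y))\<^sup>2 * (cos (\<tau> * y - \<theta>))\<^sup>2"
          by (rule mult_right_mono) simp
        also have "\<dots> = (tilt t y)\<^sup>2" unfolding th by (simp add: power_mult_distrib)
        finally have 2: "exp (- 2 * \<sigma> * T) * (cos (\<tau> * y - \<theta>))\<^sup>2 / 4 \<le> 1 - cos (tilt t y)" using 1 by linarith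
        have "sqrt 2 * y \<le> \<sigma> * y"
        proof -
          have "y \<le> 0" using y(2) l(1) sigma_pos by (meson divide_nonpos_pos neg_le_0_iff_le order.trans)
          then show ?thesis using sigma_less by (intro mult_right_mono_neg) auto
        qed
        then have "norm t \<le> exp (- (sqrt 2 * y))" using sy(1) unfolding l(2) by simp
        then have 3: "sqrt 2 * norm t \<le> limit_intensity y" unfolding limit_intensity_def by (intro mult_left_mono) auto
        have "(sqrt 2 * exp (- 2 * \<sigma> * T) / 4 * norm t) * (cos (\<tau> * y - \<theta>))\<^sup>2 = (sqrt 2 * norm t) * (exp (- 2 * \<sigma> * T) * (cos (\<tau> * y - \<theta>))\<^sup>2 / 4)"
          by simp
        also have "\<dots> \<le> limit_intensity y * (1 - cos (tilt t y))"
          using 2 3 limit_intensity_pos[of y] by (intro mult_mono) auto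
        finally show ?thesis using True by simp
      qed
    qed
    finally show "Re (char_exponent t) \<le> - c * norm t" unfolding Re_char_exponent by simp
  qed
qed

lemma integrable_exp_char_exponent: "integrable lborel (\<lambda>t. exp (char_exponent t))"
proof -
  obtain c where c: "c > 0" "\<And>t. norm t \<ge> 1 \<Longrightarrow> Re (char_exponent t) \<le> - c * norm t" using char_exponent_decay by blast
  have c2: "c / 2 > 0" using c by simp
  have i: "integrable lborel (\<lambda>t::real\<times>real. exp c * (exp (- (c/2) * \<bar>fst t\<bar>) * exp (- (c/2) * \<bar>snd t\<bar>)))"
    by (intro integrable_mult_right integrable_lborel_times integrable_exp_neg_abs c2)
  show ?thesis
  proof (rule Bochner_Integration.integrable_bound[OF i _ AE_I2])
    fix t :: "real \<times> real"
    have n: "\<bar>fst t\<bar> \<le> norm t" "\<bar>snd t\<bar> \<le> norm t" using norm_fst_le[of "fst t" "snd t"] norm_snd_le[of "snd t" "fst t"] by auto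
    have "Re (char_exponent t) \<le> c + (- c * norm t)"
    proof (cases "norm t \<ge> 1")
      case True then show ?thesis using c(2)[OF True] c(1) by linarith
    next
      case False
      then have "c * norm t \<le> c * 1" using c(1) by (intro mult_left_mono) auto
      then show ?thesis using Re_char_exponent_nonpos[of t] by linarith
    qed
    also have "\<dots> \<le> c + (- (c/2) * \<bar>fst t\<bar> + - (c/2) * \<bar>snd t\<bar>)"
    proof -
      have "c / 2 * \<bar>fst t\<bar> \<le> c / 2 * norm t" "c / 2 * \<bar>snd t\<bar> \<le> c / 2 * norm t"
        using n c(1) by (auto intro!: mult_left_mono)
      then show ?thesis by linarith
    qed
    finally have "exp (Re (char_exponent t)) \<le> exp (c + (- (c/2) * \<bar>fst t\<bar> + - (c/2) * \<bar>snd t\<bar>))" by simp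
    then show "norm (exp (char_exponent t)) \<le> norm (exp c * (exp (- (c/2) * \<bar>fst t\<bar>) * exp (- (c/2) * \<bar>snd t\<bar>)))"
      unfolding exp_add by (simp add: mult.assoc)
  qed measurable
qed

lemma isCont_exp_char_exponent: "isCont (\<lambda>t. exp (char_exponent t)) 0"
proof -
  have "((\<lambda>t. char_exponent t) \<longlongrightarrow> 0) (at 0)"
  proof (rule Lim_null_comparison)
    show "\<forall>\<^sub>F t in at 0. norm (char_exponent t) \<le> 2 * ((norm t)\<^sup>2 + 2 * norm t) * decay_integral"
      using norm_char_exponent by (intro always_eventually) auto
    have "((\<lambda>t::real\<times>real. 2 * ((norm t)\<^sup>2 + 2 * norm t) * decay_integral) \<longlongrightarrow> 2 * ((norm (0::real\<times>real))\<^sup>2 + 2 * norm (0::real\<times>real)) * decay_integral) (at 0)"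
      by (intro tendsto_intros)
    then show "((\<lambda>t::real\<times>real. 2 * ((norm t)\<^sup>2 + 2 * norm t) * decay_integral) \<longlongrightarrow> 0) (at 0)" by simp
  qed
  moreover have "char_exponent 0 = 0" using norm_char_exponent[of 0] by simp
  ultimately show ?thesis using tendsto_exp[of char_exponent 0 "at 0"] unfolding isCont_def by simp
qed

sublocale planar: planar_characteristic_convergence M centred_sum_pair "\<lambda>t. exp (char_exponent t)"
  by unfold_locales (auto intro: centred_sum_char_tendsto integrable_exp_char_exponent isCont_exp_char_exponent)

end

section \<open>Bounds for random analytic functions and for sums of independent variables\<close>

lemma norm_exp_minus_one_le: "norm (exp z - 1) \<le> norm z * exp (norm (z::complex))"
proof -
  have "norm (exp z - exp 0) \<le> exp (norm z) * norm (z - 0)"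
  proof (rule field_differentiable_bound[of "cball 0 (norm z)" exp exp])
    fix x :: complex assume "x \<in> cball 0 (norm z)"
    then show "norm (exp x) \<le> exp (norm z)" using complex_Re_le_cmod[of x] by simp
  qed (auto intro: DERIV_subset[OF DERIV_exp])
  then show ?thesis by (simp add: mult.commute)
qed

text \<open>
  Cauchy's formula on the circle of radius \<open>2 R\<close> bounds a supremum by a mean, whose expectation can
  be computed.
\<close>

lemma norm_le_circle_mean:
  fixes D :: "complex \<Rightarrow> complex"
  assumes D: "D holomorphic_on UNIV" and R: "R > 0" and w: "norm w \<le> R"
  shows "ennreal (norm (D w)) \<le> 2 * (\<integral>\<^sup>+x. ennreal (norm (D (circlepath 0 (2 * R) x))) * indicator {0..1} x \<partial>lborel)"
proof -
  let ?\<gamma> = "circlepath 0 (2 * R)"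
  define g where "g = (\<lambda>x. norm (D (?\<gamma> x)))"
  have cont: "continuous_on {0..1} g"
    unfolding g_def circlepath
    by (intro continuous_intros continuous_on_compose2[OF holomorphic_on_imp_continuous_on[OF D]]) auto
  have "((\<lambda>u. D u / (u - w)) has_contour_integral (2 * of_real pi * \<i> * D w)) ?\<gamma>"
    by (rule Cauchy_integral_circlepath_simple) (use D R w in \<open>auto intro: holomorphic_on_subset\<close>)
  then have "((\<lambda>x. D (?\<gamma> x) / (?\<gamma> x - w) * vector_derivative ?\<gamma> (at x within {0..1})) has_integral (2 * of_real pi * \<i> * D w)) {0..1}"
    unfolding has_contour_integral_def .
  then have I: "((\<lambda>x. D (?\<gamma> x) / (?\<gamma> x - w) * (2 * pi * \<i> * (2 * R) * exp (2 * pi * \<i> * x))) has_integral (2 * of_real pi * \<i> * D w)) {0..1}"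
    by (rule has_integral_eq[rotated]) (simp add: vector_derivative_circlepath01)
  have "norm (2 * of_real pi * \<i> * D w) \<le> integral {0..1} (\<lambda>x. 4 * pi * g x)"
  proof (subst integral_unique[OF I, symmetric], rule integral_norm_bound_integral)
    show "(\<lambda>x. D (?\<gamma> x) / (?\<gamma> x - w) * (2 * pi * \<i> * (2 * R) * exp (2 * pi * \<i> * x))) integrable_on {0..1}" using I by blast
    show "(\<lambda>x. 4 * pi * g x) integrable_on {0..1}" by (intro integrable_continuous_interval continuous_intros cont)
    fix x :: real assume "x \<in> {0..1}"
    have n: "norm (?\<gamma> x) = 2 * R" using R by (simp add: circlepath norm_mult)
    then have "norm (?\<gamma> x - w) \<ge> R" using w norm_triangle_ineq2[of "?\<gamma> x" w] by linarith
    then have "g x / norm (?\<gamma> x - w) * (4 * pi * R) \<le> g x / R * (4 * pi * R)"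
      using R by (intro mult_right_mono divide_left_mono mult_pos_pos) (auto simp: g_def)
    moreover have "norm (D (?\<gamma> x) / (?\<gamma> x - w) * (2 * pi * \<i> * (2 * R) * exp (2 * pi * \<i> * x))) = g x / norm (?\<gamma> x - w) * (4 * pi * R)"
      using R by (simp add: norm_mult norm_divide g_def)
    ultimately show "norm (D (?\<gamma> x) / (?\<gamma> x - w) * (2 * pi * \<i> * (2 * R) * exp (2 * pi * \<i> * x))) \<le> 4 * pi * g x"
      using R by (simp add: mult.commute)
  qed
  then have le: "norm (D w) \<le> 2 * integral {0..1} g" by (simp add: norm_mult)
  have si: "integrable lborel (\<lambda>x. indicator {0..1} x *\<^sub>R g x)"
    by (rule borel_integrable_compact[OF _ cont]) simp
  have "integral {0..1} g = (\<integral>x. indicator {0..1} x *\<^sub>R g x \<partial>lborel)"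
    using set_borel_integral_eq_integral(2)[of "{0..1}" g] si unfolding set_integrable_def set_lebesgue_integral_def by simp
  moreover have "(\<integral>\<^sup>+x. ennreal (indicator {0..1} x *\<^sub>R g x) \<partial>lborel) = ennreal (\<integral>x. indicator {0..1} x *\<^sub>R g x \<partial>lborel)"
    by (rule nn_integral_eq_integral[OF si]) (simp add: g_def)
  moreover have "(\<integral>\<^sup>+x. ennreal (indicator {0..1} x *\<^sub>R g x) \<partial>lborel) = (\<integral>\<^sup>+x. ennreal (norm (D (?\<gamma> x))) * indicator {0..1} x \<partial>lborel)"
    by (intro nn_integral_cong) (simp add: g_def indicator_def)
  ultimately have "2 * (\<integral>\<^sup>+x. ennreal (norm (D (?\<gamma> x))) * indicator {0..1} x \<partial>lborel) = ennreal (2 * integral {0..1} g)"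
    by (simp add: ennreal_mult' )
  then show ?thesis using le by (simp add: ennreal_leI)
qed

text \<open>
  A pointwise bound in the mean for a random analytic function yields a uniform bound in
  probability, by Fubini's theorem and Markov's inequality.
\<close>

lemma (in prob_space) analytic_sup_small:
  fixes D :: "complex \<Rightarrow> 'a \<Rightarrow> complex"
  assumes D: "\<And>\<omega>. (\<lambda>w. D w \<omega>) holomorphic_on UNIV" and [measurable]: "(\<lambda>(w, \<omega>). D w \<omega>) \<in> borel_measurable (borel \<Otimes>\<^sub>M M)"
    and R: "R > 0" and e: "e \<ge> 0" and \<delta>: "\<delta> > 0" and le: "\<And>w. norm w = 2 * R \<Longrightarrow> (\<integral>\<^sup>+\<omega>. norm (D w \<omega>) \<partial>M) \<le> ennreal e"
  shows "\<exists>A\<in>events. prob A \<ge> 1 - 2 * e / \<delta> \<and> (\<forall>\<omega>\<in>A. \<forall>w. norm w \<le> R \<longrightarrow> norm (D w \<omega>) \<le> \<delta>)"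
proof -
  interpret P: pair_sigma_finite "lborel :: real measure" M ..
  let ?\<gamma> = "circlepath 0 (2 * R)"
  have [measurable]: "?\<gamma> \<in> borel_measurable borel"
    unfolding circlepath by (intro borel_measurable_continuous_onI continuous_intros)
  define V where "V = (\<lambda>\<omega>. \<integral>\<^sup>+x. ennreal (norm (D (?\<gamma> x) \<omega>)) * indicator {0..1} x \<partial>lborel)"
  have [measurable]: "V \<in> borel_measurable M" unfolding V_def by measurable
  have "(\<integral>\<^sup>+\<omega>. V \<omega> \<partial>M) = (\<integral>\<^sup>+x. (\<integral>\<^sup>+\<omega>. ennreal (norm (D (?\<gamma> x) \<omega>)) * indicator {0..1} x \<partial>M) \<partial>lborel)"
    unfolding V_def by (subst P.Fubini') auto
  also have "\<dots> \<le> (\<integral>\<^sup>+x. ennreal e * indicator {0..1} (x::real) \<partial>lborel)"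
  proof (rule nn_integral_mono)
    fix x :: real
    have "norm (?\<gamma> x) = 2 * R" using R by (simp add: circlepath norm_mult)
    from le[OF this] have "(\<integral>\<^sup>+\<omega>. norm (D (?\<gamma> x) \<omega>) \<partial>M) * indicator {0..1} x \<le> ennreal e * indicator {0..1} x" by (rule mult_right_mono) simp
    then show "(\<integral>\<^sup>+\<omega>. ennreal (norm (D (?\<gamma> x) \<omega>)) * indicator {0..1} x \<partial>M) \<le> ennreal e * indicator {0..1} x"
      by (subst nn_integral_multc) auto
  qed
  also have "\<dots> = ennreal e" by (simp add: nn_integral_cmult_indicator)
  finally have EV: "(\<integral>\<^sup>+\<omega>. V \<omega> \<partial>M) \<le> ennreal e" .
  define A where "A = {\<omega> \<in> space M. \<not> 1 \<le> ennreal (2 / \<delta>) * V \<omega>}"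
  have A: "A \<in> events" unfolding A_def by measurable
  have "emeasure M (space M - A) = emeasure M ({\<omega> \<in> space M. 1 \<le> ennreal (2 / \<delta>) * V \<omega>} \<inter> space M)"
    unfolding A_def by (intro arg_cong[where f = "emeasure M"]) auto
  also have "\<dots> \<le> ennreal (2 / \<delta>) * (\<integral>\<^sup>+\<omega>. V \<omega> * indicator (space M) \<omega> \<partial>M)"
    using nn_integral_Markov_inequality[of V "space M" M "ennreal (2 / \<delta>)"] by (simp add: Int_def conj_commute)
  also have "(\<integral>\<^sup>+\<omega>. V \<omega> * indicator (space M) \<omega> \<partial>M) = (\<integral>\<^sup>+\<omega>. V \<omega> \<partial>M)" by (intro nn_integral_cong) simp
  also have "ennreal (2 / \<delta>) * \<dots> \<le> ennreal (2 / \<delta>) * ennreal e" by (rule mult_left_mono[OF EV]) simp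
  also have "\<dots> = ennreal (2 * e / \<delta>)" using \<delta> e by (simp add: ennreal_mult'[symmetric])
  finally have "prob (space M - A) \<le> 2 * e / \<delta>" using \<delta> e by (simp add: emeasure_eq_measure)
  then have "prob A \<ge> 1 - 2 * e / \<delta>" using prob_compl[OF A] by linarith
  moreover have "norm (D w \<omega>) \<le> \<delta>" if "\<omega> \<in> A" "norm w \<le> R" for w \<omega>
  proof -
    have "ennreal (norm (D w \<omega>)) \<le> 2 * V \<omega>" unfolding V_def by (rule norm_le_circle_mean[OF D R that(2)])
    also have "2 * V \<omega> = ennreal \<delta> * (ennreal (2 / \<delta>) * V \<omega>)"
      using \<delta> by (simp add: mult.assoc[symmetric] ennreal_mult'[symmetric])
    also have "\<dots> \<le> ennreal \<delta> * 1" using that(1) unfolding A_def by (intro mult_left_mono) auto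
    finally show ?thesis using \<delta> by simp
  qed
  ultimately show ?thesis using A by blast
qed

text \<open>
  The variance bound for the norm of a sum, with \<open>2 x \<le> x\<^sup>2 / s + s\<close> in place of the Cauchy-Schwarz
  inequality.
\<close>

lemma (in prob_space) expectation_norm_sum_le:
  fixes U :: "nat \<Rightarrow> 'a \<Rightarrow> complex"
  assumes ind: "indep_vars (\<lambda>_. borel) U I" and I: "finite I"
    and U: "\<And>k. k \<in> I \<Longrightarrow> integrable M (U k)" and U2: "\<And>k. k \<in> I \<Longrightarrow> integrable M (\<lambda>\<omega>. (norm (U k \<omega>))\<^sup>2)"
    and mean: "\<And>k. k \<in> I \<Longrightarrow> expectation (U k) = 0" and s: "s > 0"
  shows "integrable M (\<lambda>\<omega>. norm (\<Sum>k\<in>I. U k \<omega>))"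
    "expectation (\<lambda>\<omega>. norm (\<Sum>k\<in>I. U k \<omega>)) \<le> ((\<Sum>k\<in>I. expectation (\<lambda>\<omega>. (norm (U k \<omega>))\<^sup>2)) / s + s) / 2"
proof -
  have [measurable]: "U k \<in> borel_measurable M" if "k \<in> I" for k using U[OF that] by auto
  have prod: "integrable M (\<lambda>\<omega>. U j \<omega> * cnj (U k \<omega>))" if jk: "j \<in> I" "k \<in> I" for j k
  proof (rule Bochner_Integration.integrable_bound[OF Bochner_Integration.integrable_add[OF U2[OF jk(1)] U2[OF jk(2)]]])
    show "(\<lambda>\<omega>. U j \<omega> * cnj (U k \<omega>)) \<in> borel_measurable M" using U[OF jk(1)] U[OF jk(2)]
      by (intro borel_measurable_times borel_measurable_integrable) (auto intro: integrable_cnj)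
    have "a * b \<le> a\<^sup>2 + b\<^sup>2" if "a \<ge> 0" "b \<ge> 0" for a b :: real
      using sum_squares_bound[of a b] that mult_nonneg_nonneg[OF that] by linarith
    then have "norm (U j \<omega> * cnj (U k \<omega>)) \<le> norm ((norm (U j \<omega>))\<^sup>2 + (norm (U k \<omega>))\<^sup>2)" for \<omega>
      by (simp add: norm_mult)
    then show "AE \<omega> in M. norm (U j \<omega> * cnj (U k \<omega>)) \<le> norm ((norm (U j \<omega>))\<^sup>2 + (norm (U k \<omega>))\<^sup>2)" by (rule AE_I2)
  qed
  have cross: "expectation (\<lambda>\<omega>. U j \<omega> * cnj (U k \<omega>)) = 0" if jk: "j \<in> I" "k \<in> I" "j \<noteq> k" for j k
  proof -
    have "indep_vars (\<lambda>_. borel) U {j, k}" by (rule indep_vars_subset[OF ind]) (use jk in auto)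
    have [measurable]: "cnj \<in> borel_measurable borel" by (intro borel_measurable_continuous_onI continuous_intros)
    from indep_vars_compose2[OF \<open>indep_vars (\<lambda>_. borel) U {j, k}\<close>, where Y = "\<lambda>i x. if i = k then cnj x else x" and N = "\<lambda>_. borel"]
    have iv: "indep_vars (\<lambda>_. borel) (\<lambda>i \<omega>. if i = k then cnj (U i \<omega>) else U i \<omega>) {j, k}" by simp
    have "expectation (\<lambda>\<omega>. \<Prod>i\<in>{j, k}. if i = k then cnj (U i \<omega>) else U i \<omega>) = (\<Prod>i\<in>{j, k}. expectation (\<lambda>\<omega>. if i = k then cnj (U i \<omega>) else U i \<omega>))"
      by (rule indep_vars_lebesgue_integral[OF _ iv]) (use jk U in auto)
    then show ?thesis using jk mean[OF jk(1)] by simp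
  qed
  have sq: "complex_of_real ((norm (\<Sum>k\<in>I. U k \<omega>))\<^sup>2) = (\<Sum>j\<in>I. \<Sum>k\<in>I. U j \<omega> * cnj (U k \<omega>))" for \<omega>
    unfolding complex_norm_square by (simp add: sum_product)
  have isq: "integrable M (\<lambda>\<omega>. complex_of_real ((norm (\<Sum>k\<in>I. U k \<omega>))\<^sup>2))"
    unfolding sq by (intro Bochner_Integration.integrable_sum prod)
  then have isq': "integrable M (\<lambda>\<omega>. (norm (\<Sum>k\<in>I. U k \<omega>))\<^sup>2)" using integrable_Re[OF isq] by simp
  have "complex_of_real (expectation (\<lambda>\<omega>. (norm (\<Sum>k\<in>I. U k \<omega>))\<^sup>2)) = expectation (\<lambda>\<omega>. \<Sum>j\<in>I. \<Sum>k\<in>I. U j \<omega> * cnj (U k \<omega>))"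
    unfolding sq[symmetric] by (rule integral_complex_of_real[symmetric])
  also have "\<dots> = (\<Sum>j\<in>I. \<Sum>k\<in>I. expectation (\<lambda>\<omega>. U j \<omega> * cnj (U k \<omega>)))"
    by (subst Bochner_Integration.integral_sum, intro Bochner_Integration.integrable_sum prod, assumption+)
       (intro sum.cong refl Bochner_Integration.integral_sum prod)
  also have "\<dots> = (\<Sum>j\<in>I. expectation (\<lambda>\<omega>. U j \<omega> * cnj (U j \<omega>)))"
  proof (rule sum.cong[OF refl])
    fix j assume j: "j \<in> I"
    have "(\<Sum>k\<in>I. expectation (\<lambda>\<omega>. U j \<omega> * cnj (U k \<omega>))) = (\<Sum>k\<in>{j}. expectation (\<lambda>\<omega>. U j \<omega> * cnj (U k \<omega>)))"
      by (rule sum.mono_neutral_right[OF I]) (use j cross in auto)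
    then show "(\<Sum>k\<in>I. expectation (\<lambda>\<omega>. U j \<omega> * cnj (U k \<omega>))) = expectation (\<lambda>\<omega>. U j \<omega> * cnj (U j \<omega>))" by simp
  qed
  also have "\<dots> = complex_of_real (\<Sum>j\<in>I. expectation (\<lambda>\<omega>. (norm (U j \<omega>))\<^sup>2))"
    by (simp add: complex_norm_square[symmetric] del: of_real_power)
  finally have E2: "expectation (\<lambda>\<omega>. (norm (\<Sum>k\<in>I. U k \<omega>))\<^sup>2) = (\<Sum>j\<in>I. expectation (\<lambda>\<omega>. (norm (U j \<omega>))\<^sup>2))"
    unfolding of_real_eq_iff .
  show i1: "integrable M (\<lambda>\<omega>. norm (\<Sum>k\<in>I. U k \<omega>))" using U by (intro integrable_norm Bochner_Integration.integrable_sum)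
  have "norm z \<le> ((norm z)\<^sup>2 / s + s) / 2" for z :: complex
    using sum_squares_bound[of "norm z" s] s by (simp add: field_simps power2_eq_square)
  then have "expectation (\<lambda>\<omega>. norm (\<Sum>k\<in>I. U k \<omega>)) \<le> expectation (\<lambda>\<omega>. ((norm (\<Sum>k\<in>I. U k \<omega>))\<^sup>2 / s + s) / 2)"
    using isq' by (intro integral_mono i1) auto
  also have "\<dots> = (expectation (\<lambda>\<omega>. (norm (\<Sum>k\<in>I. U k \<omega>))\<^sup>2) / s + s) / 2" using isq' by (simp add: prob_space)
  finally show "expectation (\<lambda>\<omega>. norm (\<Sum>k\<in>I. U k \<omega>)) \<le> ((\<Sum>k\<in>I. expectation (\<lambda>\<omega>. (norm (U k \<omega>))\<^sup>2)) / s + s) / 2"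
    unfolding E2 .
qed

section \<open>The centred sum near the critical point\<close>

context rem_model
begin

definition "low_part_weight B = exp ((2 * \<sigma> - sqrt 2 + 5 * \<kappa>) * B)"

lemma expo_diff_bound:
  assumes b: "norm (\<beta> - \<beta>0) \<le> \<theta>" and th: "\<theta> \<le> \<kappa> / 2"
  shows "norm (expo \<beta> y - expo \<beta>0 y) \<le> \<theta> / \<kappa> * exp (\<sigma> * y + 3 / 2 * \<kappa> * \<bar>y\<bar>)"
proof -
  define z where "z = (\<beta> - \<beta>0) * complex_of_real y"
  have nz: "norm z \<le> \<theta> * \<bar>y\<bar>" using b by (simp add: z_def norm_mult mult_right_mono)
  have th0: "\<theta> \<ge> 0" using b norm_ge_zero order_trans by blast
  have "expo \<beta> y - expo \<beta>0 y = expo \<beta>0 y * (exp z - 1)"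
    by (simp add: expo_def z_def right_diff_distrib exp_add[symmetric] algebra_simps)
  then have "norm (expo \<beta> y - expo \<beta>0 y) = exp (\<sigma> * y) * norm (exp z - 1)"
    by (simp add: norm_mult norm_expo \<beta>0_def)
  also have "\<dots> \<le> exp (\<sigma> * y) * (\<theta> * \<bar>y\<bar> * exp (\<kappa> / 2 * \<bar>y\<bar>))"
  proof (rule mult_left_mono)
    have "norm (exp z - 1) \<le> norm z * exp (norm z)" by (rule norm_exp_minus_one_le)
    also have "\<dots> \<le> \<theta> * \<bar>y\<bar> * exp (\<kappa> / 2 * \<bar>y\<bar>)"
    proof (rule mult_mono[OF nz])
      have "norm z \<le> \<kappa> / 2 * \<bar>y\<bar>" using nz mult_right_mono[OF th, of "\<bar>y\<bar>"] by linarith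
      then show "exp (norm z) \<le> exp (\<kappa> / 2 * \<bar>y\<bar>)" by simp
    qed (use th0 in auto)
    finally show "norm (exp z - 1) \<le> \<theta> * \<bar>y\<bar> * exp (\<kappa> / 2 * \<bar>y\<bar>)" .
  qed simp
  also have "\<dots> \<le> exp (\<sigma> * y) * (\<theta> * (exp (\<kappa> * \<bar>y\<bar>) / \<kappa>) * exp (\<kappa> / 2 * \<bar>y\<bar>))"
  proof (intro mult_left_mono mult_right_mono)
    have "\<kappa> * \<bar>y\<bar> \<le> exp (\<kappa> * \<bar>y\<bar>)" using exp_ge_add_one_self[of "\<kappa> * \<bar>y\<bar>"] by linarith
    then show "\<bar>y\<bar> \<le> exp (\<kappa> * \<bar>y\<bar>) / \<kappa>" using kappa(1) by (simp add: field_simps)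
  qed (use th0 in auto)
  also have "\<dots> = \<theta> / \<kappa> * (exp (\<sigma> * y) * (exp (\<kappa> * \<bar>y\<bar>) * exp (\<kappa> / 2 * \<bar>y\<bar>)))" by simp
  also have "\<dots> = \<theta> / \<kappa> * exp (\<sigma> * y + 3 / 2 * \<kappa> * \<bar>y\<bar>)"
    unfolding exp_add[symmetric] by (simp add: algebra_simps)
  finally show ?thesis .
qed

text \<open>
  Levels up to \<open>B\<close> are estimated in the second moment and higher ones in the first moment: under the
  limiting intensity, the second moment of \<open>exp (\<sigma> y)\<close> diverges at \<open>\<infinity>\<close> and the first one at \<open>-\<infinity>\<close>.
\<close>

lemma low_part_dominated:
  assumes b: "norm (\<beta> - \<beta>0) \<le> \<theta>" and th: "\<theta> \<le> \<kappa> / 2" and B: "B \<ge> 0"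
  shows "envelope y * norm ((norm ((expo \<beta> y - expo \<beta>0 y) * indicator {..B} y))\<^sup>2) \<le> (\<theta>\<^sup>2 / \<kappa>\<^sup>2 * low_part_weight B) * exp (- \<kappa> * \<bar>y\<bar>)"
proof (cases "y \<le> B")
  case False
  then show ?thesis by (simp add: low_part_weight_def)
next
  case True
  have th0: "\<theta> \<ge> 0" using b norm_ge_zero order_trans by blast
  have "(norm (expo \<beta> y - expo \<beta>0 y))\<^sup>2 \<le> (\<theta> / \<kappa> * exp (\<sigma> * y + 3 / 2 * \<kappa> * \<bar>y\<bar>))\<^sup>2"
    by (intro power_mono expo_diff_bound b th) simp
  also have "\<dots> = \<theta>\<^sup>2 / \<kappa>\<^sup>2 * exp (2 * \<sigma> * y + 3 * \<kappa> * \<bar>y\<bar>)"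
    by (simp add: power_mult_distrib power_divide exp_double[symmetric] algebra_simps)
  finally have "envelope y * (norm (expo \<beta> y - expo \<beta>0 y))\<^sup>2 \<le> envelope y * (\<theta>\<^sup>2 / \<kappa>\<^sup>2 * exp (2 * \<sigma> * y + 3 * \<kappa> * \<bar>y\<bar>))"
    by (rule mult_left_mono) simp
  also have "\<dots> = \<theta>\<^sup>2 / \<kappa>\<^sup>2 * (envelope y * exp (2 * \<sigma> * y + 3 * \<kappa> * \<bar>y\<bar>))" by simp
  also have "\<dots> \<le> \<theta>\<^sup>2 / \<kappa>\<^sup>2 * (low_part_weight B * exp (- \<kappa> * \<bar>y\<bar>))"
  proof (rule mult_left_mono)
    have g: "2 * \<sigma> - sqrt 2 \<ge> 6 * \<kappa>" "\<kappa> > 0" using kappa by auto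
    have "(2 * \<sigma> - sqrt 2) * y + 5 * \<kappa> * \<bar>y\<bar> \<le> (2 * \<sigma> - sqrt 2 + 5 * \<kappa>) * B"
    proof (cases "y \<ge> 0")
      case p: True
      have "(2 * \<sigma> - sqrt 2 + 5 * \<kappa>) * y \<le> (2 * \<sigma> - sqrt 2 + 5 * \<kappa>) * B" using g True by (intro mult_left_mono) auto
      then show ?thesis using p by (simp add: algebra_simps)
    next
      case n: False
      have "(2 * \<sigma> - sqrt 2) * y \<le> 6 * \<kappa> * y" using g n by (intro mult_right_mono_neg) auto
      moreover have "\<kappa> * y \<le> 0" using g n by (simp add: mult_nonneg_nonpos)
      moreover have "(2 * \<sigma> - sqrt 2 + 5 * \<kappa>) * B \<ge> 0" using g B by (intro mult_nonneg_nonneg) auto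
      ultimately show ?thesis using n by (simp add: algebra_simps)
    qed
    then show "envelope y * exp (2 * \<sigma> * y + 3 * \<kappa> * \<bar>y\<bar>) \<le> low_part_weight B * exp (- \<kappa> * \<bar>y\<bar>)"
      unfolding low_part_weight_def exp_add[symmetric] by (simp add: algebra_simps)
  qed simp
  finally show ?thesis using True by (simp add: mult.assoc)
qed

lemma high_part_dominated:
  assumes b: "norm (\<beta> - \<beta>0) \<le> \<theta>" and th: "\<theta> \<le> \<kappa> / 2" and B: "B \<ge> 0"
  shows "envelope y * norm ((expo \<beta> y - expo \<beta>0 y) * indicator {B<..} y) \<le> (\<theta> / \<kappa>) * exp (- \<kappa> * \<bar>y\<bar>)"
proof (cases "y > B")
  case False
  have "\<theta> \<ge> 0" using b norm_ge_zero order_trans by blast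
  then show ?thesis using False kappa(1) by simp
next
  case True
  have th0: "\<theta> \<ge> 0" using b norm_ge_zero order_trans by blast
  have "envelope y * norm (expo \<beta> y - expo \<beta>0 y) \<le> envelope y * (\<theta> / \<kappa> * exp (\<sigma> * y + 3 / 2 * \<kappa> * \<bar>y\<bar>))"
    by (intro mult_left_mono expo_diff_bound b th) simp
  also have "\<dots> = \<theta> / \<kappa> * (envelope y * exp (\<sigma> * y + 3 / 2 * \<kappa> * \<bar>y\<bar>))" by simp
  also have "\<dots> \<le> \<theta> / \<kappa> * exp (- \<kappa> * \<bar>y\<bar>)"
  proof (rule mult_left_mono)
    have "6 * \<kappa> * y \<le> (sqrt 2 - \<sigma>) * y" using kappa(3) True B by (intro mult_right_mono) auto
    moreover have "\<kappa> * y \<ge> 0" using kappa(1) True B by simp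
    ultimately show "envelope y * exp (\<sigma> * y + 3 / 2 * \<kappa> * \<bar>y\<bar>) \<le> exp (- \<kappa> * \<bar>y\<bar>)"
      using True B unfolding exp_add[symmetric] by (simp add: algebra_simps)
  qed (use th0 kappa(1) in simp)
  finally show ?thesis using True by simp
qed

lemma tail_dominated:
  assumes B: "B \<ge> 0"
  shows "envelope y * norm (indicator {B<..} y :: real) \<le> exp (- \<kappa> * B) * exp (- \<kappa> * \<bar>y\<bar>)"
proof (cases "y > B")
  case True
  have "6 * \<kappa> \<le> sqrt 2" using kappa(3) sigma_pos by linarith
  then have "6 * \<kappa> * y \<le> sqrt 2 * y" using True B by (intro mult_right_mono) auto
  moreover have "\<kappa> * B \<le> \<kappa> * y" using kappa(1) True by simp
  moreover have "\<kappa> * y \<ge> 0" using kappa(1) True B by simp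
  moreover have "\<bar>y\<bar> = y" using True B by simp
  ultimately have "- (sqrt 2 * y) + \<kappa> * \<bar>y\<bar> \<le> - \<kappa> * B + - \<kappa> * \<bar>y\<bar>" by (simp only:)
  then show ?thesis using True unfolding exp_add[symmetric] by simp
qed simp

text \<open>A union bound: the expected number of levels above \<open>B\<close> is the integral of the level density.\<close>

lemma exceedance_prob:
  assumes N: "N \<ge> 2" and d: "\<And>y. level_density N y \<le> 2 * envelope y" and B: "B \<ge> 0"
  shows "prob (\<Union>k\<in>{1..N}. {\<omega> \<in> space M. Y N k \<omega> > B}) \<le> 2 * exp (- \<kappa> * B) * decay_integral"
proof -
  have m: "{\<omega> \<in> space M. Y N k \<omega> > B} \<in> events" if "k \<ge> 1" for k
    using measurable_Y[OF that] by measurable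
  have p: "real N * prob {\<omega> \<in> space M. Y N k \<omega> > B} \<le> 2 * exp (- \<kappa> * B) * decay_integral" if k: "k \<ge> 1" for k
  proof -
    have "prob {\<omega> \<in> space M. Y N k \<omega> > B} = (\<integral>\<omega>. indicator {B<..} (Y N k \<omega>) \<partial>M)"
    proof -
      have "(\<integral>\<omega>. indicator {B<..} (Y N k \<omega>) \<partial>M) = (\<integral>\<omega>. (indicator {\<omega> \<in> space M. Y N k \<omega> > B} \<omega> :: real) \<partial>M)"
        by (rule Bochner_Integration.integral_cong) (auto simp: indicator_def)
      then show ?thesis using m[OF k] by simp
    qed
    then have "real N * prob {\<omega> \<in> space M. Y N k \<omega> > B} = (\<integral>y. level_density N y *\<^sub>R indicator {B<..} y \<partial>lborel)"
      using Y_integral(1)[OF N k, of "indicator {B<..} :: real \<Rightarrow> real"] by simp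
    also have "\<dots> \<le> 2 * exp (- \<kappa> * B) * decay_integral"
      using level_density_integral(2)[OF _ tail_dominated[OF B] d] by simp
    finally show ?thesis .
  qed
  have "prob (\<Union>k\<in>{1..N}. {\<omega> \<in> space M. Y N k \<omega> > B}) \<le> (\<Sum>k\<in>{1..N}. prob {\<omega> \<in> space M. Y N k \<omega> > B})"
    by (rule finite_measure_subadditive_finite) (use m in auto)
  also have "\<dots> \<le> (\<Sum>k\<in>{1..N}. 2 * exp (- \<kappa> * B) * decay_integral / real N)"
    by (intro sum_mono) (use p N in \<open>auto simp: field_simps\<close>)
  also have "\<dots> = 2 * exp (- \<kappa> * B) * decay_integral" using N by simp
  finally show ?thesis .
qed

definition "deviation_const B = low_part_weight B * decay_integral / \<kappa>\<^sup>2 + 1 / 2 + 2 * decay_integral / \<kappa>"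

text \<open>
  Here the sum is truncated at level \<open>B\<close> but its centring is not, because the full mean is an
  explicit entire function of \<open>\<beta>\<close>.  The mismatch is the first moment of the part above \<open>B\<close>.
\<close>

lemma truncated_deviation:
  assumes N: "N \<ge> 2" and d: "\<And>y. level_density N y \<le> 2 * envelope y" and B: "B \<ge> 0"
    and b: "norm (\<beta> - \<beta>0) \<le> \<theta>" and th: "\<theta> \<le> \<kappa> / 2" "\<theta> > 0"
  shows "(\<integral>\<^sup>+\<omega>. norm ((\<Sum>k=1..N. (expo \<beta> (Y N k \<omega>) - expo \<beta>0 (Y N k \<omega>)) * indicator {..B} (Y N k \<omega>)) - of_nat N * (mgf N \<beta> - mgf N \<beta>0)) \<partial>M)
     \<le> ennreal (deviation_const B * \<theta>)"
proof -
  define V where "V = (\<lambda>y. (expo \<beta> y - expo \<beta>0 y) * indicator {..B} y)"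
  define W where "W = (\<lambda>y. (expo \<beta> y - expo \<beta>0 y) * indicator {B<..} y)"
  have [measurable]: "V \<in> borel_measurable borel" "W \<in> borel_measurable borel" unfolding V_def W_def by measurable
  define v where "v = (\<integral>\<omega>. V (Y N 1 \<omega>) \<partial>M)"
  have lowd: "envelope y * norm ((norm (V y))\<^sup>2) \<le> (\<theta>\<^sup>2 / \<kappa>\<^sup>2 * low_part_weight B) * exp (- \<kappa> * \<bar>y\<bar>)" for y
    unfolding V_def by (rule low_part_dominated[OF b th(1) B])
  have highd: "envelope y * norm (W y) \<le> (\<theta> / \<kappa>) * exp (- \<kappa> * \<bar>y\<bar>)" for y
    unfolding W_def by (rule high_part_dominated[OF b th(1) B])
  have V2: "integrable M (\<lambda>\<omega>. (norm (V (Y N k \<omega>)))\<^sup>2)"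
    "real N * (\<integral>\<omega>. (norm (V (Y N k \<omega>)))\<^sup>2 \<partial>M) \<le> 2 * (\<theta>\<^sup>2 / \<kappa>\<^sup>2 * low_part_weight B) * decay_integral" if k: "k \<ge> 1" for k
  proof -
    have [measurable]: "(\<lambda>y. (norm (V y))\<^sup>2) \<in> borel_measurable borel" by measurable
    note di = level_density_integral[OF this lowd d]
    show "integrable M (\<lambda>\<omega>. (norm (V (Y N k \<omega>)))\<^sup>2)" using Y_integral(2)[OF N k, of "\<lambda>y. (norm (V y))\<^sup>2"] di(1) by simp
    show "real N * (\<integral>\<omega>. (norm (V (Y N k \<omega>)))\<^sup>2 \<partial>M) \<le> 2 * (\<theta>\<^sup>2 / \<kappa>\<^sup>2 * low_part_weight B) * decay_integral"
      using Y_integral(1)[OF N k, of "\<lambda>y. (norm (V y))\<^sup>2"] di(2) by simp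
  qed
  have iW: "integrable M (\<lambda>\<omega>. W (Y N k \<omega>))" and eW: "norm (of_nat N * (\<integral>\<omega>. W (Y N k \<omega>) \<partial>M)) \<le> 2 * (\<theta> / \<kappa>) * decay_integral" if k: "k \<ge> 1" for k
  proof -
    have [measurable]: "W \<in> borel_measurable borel" by measurable
    note di = level_density_integral[OF this highd d]
    show "integrable M (\<lambda>\<omega>. W (Y N k \<omega>))" using Y_integral(2)[OF N k, of W] di(1) by simp
    show "norm (of_nat N * (\<integral>\<omega>. W (Y N k \<omega>) \<partial>M)) \<le> 2 * (\<theta> / \<kappa>) * decay_integral"
      using Y_integral(1)[OF N k, of W] di(2) by (simp add: scaleR_conv_of_real)
  qed
  have VW: "V y = (expo \<beta> y - expo \<beta>0 y) - W y" for y by (simp add: V_def W_def indicator_def)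
  have iD: "integrable M (\<lambda>\<omega>. expo \<beta> (Y N k \<omega>) - expo \<beta>0 (Y N k \<omega>))" if k: "k \<ge> 1" for k
    by (intro Bochner_Integration.integrable_diff integrable_expo[OF k N])
  have iV: "integrable M (\<lambda>\<omega>. V (Y N k \<omega>))" if k: "k \<ge> 1" for k
    unfolding VW by (intro Bochner_Integration.integrable_diff iD[OF k] iW[OF k])
  have eV: "(\<integral>\<omega>. V (Y N k \<omega>) \<partial>M) = v" if k: "k \<ge> 1" for k
  proof -
    have "real N *\<^sub>R (\<integral>\<omega>. V (Y N k \<omega>) \<partial>M) = real N *\<^sub>R v"
      unfolding v_def using Y_integral(1)[OF N k, of V] Y_integral(1)[OF N order_refl, of V] by simp
    then show ?thesis using N by simp
  qed
  have v: "v = mgf N \<beta> - mgf N \<beta>0 - (\<integral>\<omega>. W (Y N 1 \<omega>) \<partial>M)"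
    unfolding v_def VW using iD[OF order_refl] iW[OF order_refl] integrable_expo[OF order_refl N]
    by (simp add: expectation_expo[OF order_refl N] del: One_nat_def)
  define U where "U = (\<lambda>k \<omega>. V (Y N k \<omega>) - v)"
  have "indep_vars (\<lambda>_. borel) X {1..N}" by (rule indep_vars_subset[OF indep]) auto
  from indep_vars_compose2[OF this, where Y = "\<lambda>k x. V (sqrt (logN N) * x - centring N) - v" and N = "\<lambda>_. borel"]
  have indU: "indep_vars (\<lambda>_. borel) U {1..N}" unfolding U_def Y_def by measurable
  have iU: "integrable M (U k)" if "k \<in> {1..N}" for k unfolding U_def using iV[of k] that by auto
  have mU: "expectation (U k) = 0" if "k \<in> {1..N}" for k
    unfolding U_def using iV[of k] eV[of k] that by (simp add: prob_space)
  have nU: "(norm (U k \<omega>))\<^sup>2 = (norm (V (Y N k \<omega>)))\<^sup>2 - 2 * Re (V (Y N k \<omega>) * cnj v) + (norm v)\<^sup>2" for k \<omega>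
    unfolding U_def cmod_power2 by (simp add: power2_eq_square algebra_simps)
  have iU2: "integrable M (\<lambda>\<omega>. (norm (U k \<omega>))\<^sup>2)" if "k \<in> {1..N}" for k
    unfolding nU using V2(1)[of k] iV[of k] that by (intro Bochner_Integration.integrable_add Bochner_Integration.integrable_diff integrable_mult_right integrable_Re integrable_mult_left) auto
  have vU: "expectation (\<lambda>\<omega>. (norm (U k \<omega>))\<^sup>2) \<le> 2 * (\<theta>\<^sup>2 / \<kappa>\<^sup>2 * low_part_weight B) * decay_integral / real N" if k: "k \<in> {1..N}" for k
  proof -
    define r where "r = (\<lambda>\<omega>. Re (V (Y N k \<omega>) * cnj v))"
    have iR: "integrable M r" unfolding r_def using iV[of k] k by (intro integrable_Re integrable_mult_left) auto
    have "expectation r = Re (v * cnj v)"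
      unfolding r_def using iV[of k] eV[of k] k by (subst integral_Re) auto
    also have "\<dots> = (norm v)\<^sup>2" by (simp add: complex_mult_cnj cmod_power2)
    finally have er: "expectation r = (norm v)\<^sup>2" .
    have "expectation (\<lambda>\<omega>. (norm (U k \<omega>))\<^sup>2) = expectation (\<lambda>\<omega>. (norm (V (Y N k \<omega>)))\<^sup>2 - 2 * r \<omega> + (norm v)\<^sup>2)"
      unfolding nU r_def ..
    also have "\<dots> = expectation (\<lambda>\<omega>. (norm (V (Y N k \<omega>)))\<^sup>2) - (norm v)\<^sup>2"
      using V2(1)[of k] iR k by (simp add: prob_space er)
    also have "\<dots> \<le> expectation (\<lambda>\<omega>. (norm (V (Y N k \<omega>)))\<^sup>2)" by simp
    also have "\<dots> \<le> 2 * (\<theta>\<^sup>2 / \<kappa>\<^sup>2 * low_part_weight B) * decay_integral / real N" using V2(2)[of k] k N by (subst pos_le_divide_eq) (auto simp: mult.commute)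
    finally show ?thesis .
  qed
  have sU: "(\<Sum>k=1..N. expectation (\<lambda>\<omega>. (norm (U k \<omega>))\<^sup>2)) \<le> 2 * (\<theta>\<^sup>2 / \<kappa>\<^sup>2 * low_part_weight B) * decay_integral"
    using sum_mono[of "{1..N}", OF vU] N by simp
  note es = expectation_norm_sum_le[OF indU finite_atLeastAtMost iU iU2 mU th(2)]
  have "expectation (\<lambda>\<omega>. norm (\<Sum>k=1..N. U k \<omega>)) \<le> ((\<Sum>k=1..N. expectation (\<lambda>\<omega>. (norm (U k \<omega>))\<^sup>2)) / \<theta> + \<theta>) / 2"
    by (rule es(2))
  also have "\<dots> \<le> (2 * (\<theta>\<^sup>2 / \<kappa>\<^sup>2 * low_part_weight B) * decay_integral / \<theta> + \<theta>) / 2"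
    using sU th(2) by (intro divide_right_mono add_mono) auto
  also have "\<dots> = (low_part_weight B * decay_integral / \<kappa>\<^sup>2 + 1 / 2) * \<theta>" using th(2) by (simp add: field_simps power2_eq_square)
  finally have ES: "expectation (\<lambda>\<omega>. norm (\<Sum>k=1..N. U k \<omega>)) \<le> (low_part_weight B * decay_integral / \<kappa>\<^sup>2 + 1 / 2) * \<theta>" .
  have eq: "(\<Sum>k=1..N. (expo \<beta> (Y N k \<omega>) - expo \<beta>0 (Y N k \<omega>)) * indicator {..B} (Y N k \<omega>)) - of_nat N * (mgf N \<beta> - mgf N \<beta>0)
      = (\<Sum>k=1..N. U k \<omega>) - of_nat N * (\<integral>\<omega>. W (Y N 1 \<omega>) \<partial>M)" for \<omega>
  proof -
    have "(\<Sum>k=1..N. U k \<omega>) = (\<Sum>k=1..N. (expo \<beta> (Y N k \<omega>) - expo \<beta>0 (Y N k \<omega>)) * indicator {..B} (Y N k \<omega>)) - of_nat N * v"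
      unfolding U_def V_def by (simp add: sum_subtractf)
    then show ?thesis unfolding v by (simp add: algebra_simps)
  qed
  have le: "norm ((\<Sum>k=1..N. U k \<omega>) - of_nat N * (\<integral>\<omega>. W (Y N 1 \<omega>) \<partial>M)) \<le> norm (\<Sum>k=1..N. U k \<omega>) + 2 * (\<theta> / \<kappa>) * decay_integral" for \<omega>
    using norm_triangle_ineq4[of "\<Sum>k=1..N. U k \<omega>" "of_nat N * (\<integral>\<omega>. W (Y N 1 \<omega>) \<partial>M)"] eW[OF order_refl] by linarith
  have "(\<integral>\<^sup>+\<omega>. norm ((\<Sum>k=1..N. U k \<omega>) - of_nat N * (\<integral>\<omega>. W (Y N 1 \<omega>) \<partial>M)) \<partial>M) \<le> (\<integral>\<^sup>+\<omega>. ennreal (norm (\<Sum>k=1..N. U k \<omega>) + 2 * (\<theta> / \<kappa>) * decay_integral) \<partial>M)"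
    by (intro nn_integral_mono ennreal_leI le)
  also have "\<dots> = ennreal (expectation (\<lambda>\<omega>. norm (\<Sum>k=1..N. U k \<omega>) + 2 * (\<theta> / \<kappa>) * decay_integral))"
    using es(1) th(2) kappa(1) decay_integral_nonneg by (intro nn_integral_eq_integral) auto
  also have "expectation (\<lambda>\<omega>. norm (\<Sum>k=1..N. U k \<omega>) + 2 * (\<theta> / \<kappa>) * decay_integral) = expectation (\<lambda>\<omega>. norm (\<Sum>k=1..N. U k \<omega>)) + 2 * (\<theta> / \<kappa>) * decay_integral"
    using es(1) by (simp add: prob_space)
  also have "ennreal \<dots> \<le> ennreal (deviation_const B * \<theta>)"
    using ES by (intro ennreal_leI) (simp add: deviation_const_def algebra_simps)
  finally show ?thesis unfolding eq .
qed

end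

section \<open>The window around the critical point\<close>

context rem_model
begin

definition rotation :: complex where "rotation = exp (3 * of_real pi * \<i> / 4)"

text \<open>
  The shift \<open>d\<^sub>N\<close>.  The phase \<open>\<tau>\<^sup>2 n\<close> of the mean is unbounded, but matters only modulo \<open>2 \<pi>\<close>; reducing it
  keeps the shift of order \<open>ln n\<close>.
\<close>

definition zero_offset :: "nat \<Rightarrow> complex" where
  "zero_offset N = (\<i> * of_real (\<tau>\<^sup>2 * logN N - 2 * pi * of_int \<lfloor>\<tau>\<^sup>2 * logN N / (2 * pi)\<rfloor>) - \<beta>0 * of_real (loglog N / (2 * sqrt 2))) / of_real (sqrt 2 * \<tau>)"

definition beta_at :: "nat \<Rightarrow> complex \<Rightarrow> complex" where
  "beta_at N w = \<beta>0 + (w + zero_offset N) / (rotation * of_real (logN N))"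

lemma rotation: "norm rotation = 1" "rotation \<noteq> 0" "\<beta>0 - of_real (sqrt 2) = of_real (sqrt 2 * \<tau>) * rotation"
proof -
  have "rotation = cis (3 * pi / 4)" by (simp add: rotation_def cis_conv_exp mult.commute mult.left_commute)
  moreover have pi4: "3 * pi / 4 = pi - pi / 4" by simp
  ultimately have "rotation = cis (pi - pi / 4)" by (simp only:)
  then have e: "rotation = Complex (- (sqrt 2 / 2)) (sqrt 2 / 2)"
    unfolding cis.ctr cos_pi_minus sin_pi_minus cos_45 sin_45 .
  show "norm rotation = 1" by (simp add: rotation_def)
  then show "rotation \<noteq> 0" by auto
  have "\<sigma> - sqrt 2 = - \<tau>" using sum by linarith
  then have "\<beta>0 - of_real (sqrt 2) = Complex (- \<tau>) \<tau>" by (simp add: \<beta>0_def complex_eq_iff)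
  also have "\<dots> = of_real (sqrt 2 * \<tau>) * rotation" unfolding e by (simp add: complex_eq_iff)
  finally show "\<beta>0 - of_real (sqrt 2) = of_real (sqrt 2 * \<tau>) * rotation" .
qed

definition "offset_const = 2 * pi / (sqrt 2 * \<tau>)"
definition "offset_slope = norm \<beta>0 / (sqrt 2 * \<tau> * (2 * sqrt 2))"

lemma offset_nonneg: "offset_const \<ge> 0" "offset_slope \<ge> 0" using tau by (auto simp: offset_const_def offset_slope_def)

lemma norm_zero_offset: "norm (zero_offset N) \<le> offset_const + offset_slope * \<bar>loglog N\<bar>"
proof -
  let ?r = "\<tau>\<^sup>2 * logN N - 2 * pi * of_int \<lfloor>\<tau>\<^sup>2 * logN N / (2 * pi)\<rfloor>"
  have r: "\<bar>?r\<bar> \<le> 2 * pi"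
  proof -
    let ?x = "\<tau>\<^sup>2 * logN N / (2 * pi)"
    have "?r = 2 * pi * (?x - of_int \<lfloor>?x\<rfloor>)" by (simp add: right_diff_distrib)
    also have "\<bar>\<dots>\<bar> = 2 * pi * \<bar>?x - of_int \<lfloor>?x\<rfloor>\<bar>" by (simp add: abs_mult)
    also have "\<dots> \<le> 2 * pi * 1"
    proof (intro mult_left_mono)
      show "\<bar>?x - of_int \<lfloor>?x\<rfloor>\<bar> \<le> 1" using of_int_floor_le[of ?x] floor_correct[of ?x] by linarith
    qed simp
    finally show ?thesis by simp
  qed
  have "norm (zero_offset N) = norm (\<i> * of_real ?r - \<beta>0 * of_real (loglog N / (2 * sqrt 2))) / (sqrt 2 * \<tau>)"
    unfolding zero_offset_def norm_divide norm_of_real using tau by simp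
  also have "\<dots> \<le> (2 * pi + norm \<beta>0 * (\<bar>loglog N\<bar> / (2 * sqrt 2))) / (sqrt 2 * \<tau>)"
  proof (rule divide_right_mono)
    have "norm (\<i> * of_real ?r - \<beta>0 * of_real (loglog N / (2 * sqrt 2))) \<le> norm (\<i> * of_real ?r) + norm (\<beta>0 * of_real (loglog N / (2 * sqrt 2)))"
      by (rule norm_triangle_ineq4)
    also have "norm (\<i> * of_real ?r) = \<bar>?r\<bar>" unfolding norm_mult norm_of_real by simp
    also have "norm (\<beta>0 * of_real (loglog N / (2 * sqrt 2))) = norm \<beta>0 * (\<bar>loglog N\<bar> / (2 * sqrt 2))" unfolding norm_mult norm_of_real by simp
    finally show "norm (\<i> * of_real ?r - \<beta>0 * of_real (loglog N / (2 * sqrt 2))) \<le> 2 * pi + norm \<beta>0 * (\<bar>loglog N\<bar> / (2 * sqrt 2))"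
      using r by linarith
  qed (use tau in simp)
  also have "\<dots> = offset_const + offset_slope * \<bar>loglog N\<bar>" unfolding offset_const_def offset_slope_def by (simp add: add_divide_distrib)
  finally show ?thesis .
qed

lemma zero_offset_bigo: "zero_offset \<in> O(\<lambda>N. complex_of_real (ln (ln (real N))))"
proof (rule bigoI)
  have "eventually (\<lambda>N. offset_const + offset_slope * \<bar>loglog N\<bar> \<le> (offset_const + 2 * offset_slope + 1) * \<bar>ln (ln (real N))\<bar>) sequentially"
  proof -
    have "eventually (\<lambda>N. \<bar>loglog N\<bar> \<le> 2 * \<bar>ln (ln (real N))\<bar> \<and> 1 \<le> \<bar>ln (ln (real N))\<bar>) sequentially"
      unfolding loglog_def logN_def by (intro eventually_conj; real_asymp)
    then show ?thesis
    proof eventually_elim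
      case (elim N)
      have "offset_slope * \<bar>loglog N\<bar> \<le> offset_slope * (2 * \<bar>ln (ln (real N))\<bar>)" using elim offset_nonneg by (intro mult_left_mono) auto
      moreover have "offset_const * 1 \<le> offset_const * \<bar>ln (ln (real N))\<bar>" using elim offset_nonneg by (intro mult_left_mono) auto
      ultimately show ?case using elim by (simp add: algebra_simps)
    qed
  qed
  then show "eventually (\<lambda>N. norm (zero_offset N) \<le> (offset_const + 2 * offset_slope + 1) * norm (complex_of_real (ln (ln (real N))))) sequentially"
  proof eventually_elim
    case (elim N)
    then show ?case using norm_zero_offset[of N] unfolding norm_of_real by linarith
  qed
qed

text \<open>A bound for the distance from \<open>\<beta>\<^sub>0\<close> to \<open>\<beta>\<close> when the window variable has norm at most \<open>R\<close>.\<close>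

definition "window_radius R N = (R + offset_const + offset_slope * \<bar>loglog N\<bar>) / logN N"

lemma window_radius_limits: "(\<lambda>N. window_radius R N) \<longlonglongrightarrow> 0" "(\<lambda>N. logN N * (window_radius R N)\<^sup>2 / 2 + window_radius R N * \<bar>loglog N\<bar>) \<longlonglongrightarrow> 0"
proof -
  show "(\<lambda>N. window_radius R N) \<longlonglongrightarrow> 0" unfolding window_radius_def loglog_def logN_def by real_asymp
  define a where "a = R + offset_const"
  have l: "(\<lambda>N. 1 / logN N) \<longlonglongrightarrow> 0" "(\<lambda>N. \<bar>loglog N\<bar> / logN N) \<longlonglongrightarrow> 0" "(\<lambda>N. \<bar>loglog N\<bar>\<^sup>2 / logN N) \<longlonglongrightarrow> 0"
    unfolding loglog_def logN_def by real_asymp+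
  have "(\<lambda>N. a\<^sup>2 / 2 * (1 / logN N) + (a * offset_slope + a) * (\<bar>loglog N\<bar> / logN N) + (offset_slope\<^sup>2 / 2 + offset_slope) * (\<bar>loglog N\<bar>\<^sup>2 / logN N))
     \<longlonglongrightarrow> a\<^sup>2 / 2 * 0 + (a * offset_slope + a) * 0 + (offset_slope\<^sup>2 / 2 + offset_slope) * 0"
    by (intro tendsto_add tendsto_mult tendsto_const l)
  then have "(\<lambda>N. a\<^sup>2 / 2 * (1 / logN N) + (a * offset_slope + a) * (\<bar>loglog N\<bar> / logN N) + (offset_slope\<^sup>2 / 2 + offset_slope) * (\<bar>loglog N\<bar>\<^sup>2 / logN N)) \<longlonglongrightarrow> 0"
    by simp
  moreover have "\<forall>\<^sub>F N in sequentially. a\<^sup>2 / 2 * (1 / logN N) + (a * offset_slope + a) * (\<bar>loglog N\<bar> / logN N) + (offset_slope\<^sup>2 / 2 + offset_slope) * (\<bar>loglog N\<bar>\<^sup>2 / logN N)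
      = logN N * (window_radius R N)\<^sup>2 / 2 + window_radius R N * \<bar>loglog N\<bar>"
    using eventually_ge_at_top[of 2]
  proof eventually_elim
    case (elim N)
    have r: "window_radius R N = (a + offset_slope * \<bar>loglog N\<bar>) / logN N" by (simp add: window_radius_def a_def)
    define x where "x = \<bar>loglog N\<bar>"
    have "logN N > 0" by (rule logN_pos[OF elim])
    then show ?case unfolding r x_def[symmetric] by (simp add: power2_eq_square field_simps)
  qed
  ultimately show "(\<lambda>N. logN N * (window_radius R N)\<^sup>2 / 2 + window_radius R N * \<bar>loglog N\<bar>) \<longlonglongrightarrow> 0" by (rule Lim_transform_eventually)
qed

lemma window_radius_pos: "N \<ge> 2 \<Longrightarrow> R > 0 \<Longrightarrow> window_radius R N > 0"
  unfolding window_radius_def using logN_pos[of N] offset_nonneg by (intro divide_pos_pos add_pos_nonneg) auto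

lemma beta_at_dist:
  assumes N: "N \<ge> 2" and w: "norm w \<le> R"
  shows "norm (beta_at N w - \<beta>0) \<le> window_radius R N"
proof -
  have n: "logN N > 0" by (rule logN_pos[OF N])
  have "norm (beta_at N w - \<beta>0) = norm (w + zero_offset N) / logN N"
    unfolding beta_at_def using n by (simp add: norm_divide norm_mult rotation)
  also have "norm (w + zero_offset N) \<le> R + offset_const + offset_slope * \<bar>loglog N\<bar>"
    using norm_triangle_ineq[of w "zero_offset N"] norm_zero_offset[of N] w by linarith
  finally show ?thesis unfolding window_radius_def using n by (simp add: divide_right_mono)
qed

text \<open>
  The quadratic polynomial in the exponent is expanded around \<open>\<beta>\<^sub>0\<close>.  The rotation by \<open>3 \<pi> / 4\<close> is the direction of
  \<open>\<beta>\<^sub>0 - \<surd>2\<close>, so the linear term is \<open>c w\<close> with \<open>c\<close> real, and the shift absorbs the terms free of \<open>w\<close> up to a multiple of \<open>2 \<pi> \<i>\<close>.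
\<close>

lemma mean_at:
  assumes N: "N \<ge> 2"
  shows "of_nat N * mgf N (beta_at N w) = exp (of_real (sqrt 2 * \<tau>) * w) *
    exp (of_real (logN N) * (beta_at N w - \<beta>0)\<^sup>2 / 2 + (beta_at N w - \<beta>0) * of_real (loglog N / (2 * sqrt 2)))"
proof -
  define n where "n = logN N"
  have n: "n > 0" unfolding n_def by (rule logN_pos[OF N])
  define l where "l = loglog N / (2 * sqrt 2)"
  define c where "c = sqrt 2 * \<tau>"
  have c: "c > 0" using tau by (simp add: c_def)
  define b where "b = complex_of_real (sqrt 2)"
  define v where "v = beta_at N w - \<beta>0"
  define m where "m = \<lfloor>\<tau>\<^sup>2 * n / (2 * pi)\<rfloor>"
  have nv: "of_real n * (\<beta>0 - b) * v = of_real c * (w + zero_offset N)"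
  proof -
    have "v = (w + zero_offset N) / (rotation * of_real n)" by (simp add: v_def beta_at_def n_def)
    moreover have "\<beta>0 - b = of_real c * rotation" by (simp only: b_def rotation(3) c_def)
    ultimately show ?thesis using n rotation(2) by simp
  qed
  have cd: "of_real c * zero_offset N = \<i> * of_real (\<tau>\<^sup>2 * n - 2 * pi * of_int m) - \<beta>0 * of_real l"
    unfolding zero_offset_def c_def[symmetric] n_def[symmetric] l_def[symmetric] m_def[symmetric] using c by simp
  have sq: "of_real n * (\<beta>0 - b)\<^sup>2 / 2 = - \<i> * of_real (\<tau>\<^sup>2 * n)"
    unfolding b_def beta0_diff_sq by simp
  have "of_real n * (beta_at N w - b)\<^sup>2 / 2 + beta_at N w * of_real l =
     of_real n * (\<beta>0 - b)\<^sup>2 / 2 + of_real n * (\<beta>0 - b) * v + of_real n * v\<^sup>2 / 2 + (\<beta>0 + v) * of_real l"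
    unfolding v_def by (simp add: power2_eq_square field_simps)
  also have "\<dots> = of_real c * w + (of_real n * v\<^sup>2 / 2 + v * of_real l) + - (\<i> * of_real (2 * pi * of_int m))"
    unfolding sq nv distrib_left cd by (simp add: algebra_simps)
  finally have "of_nat N * mgf N (beta_at N w) = exp (of_real c * w + (of_real n * v\<^sup>2 / 2 + v * of_real l) + - (\<i> * of_real (2 * pi * of_int m)))"
    using real_times_mgf[OF N, of "beta_at N w"] unfolding n_def[symmetric] l_def[symmetric] b_def[symmetric] by simp
  also have "\<dots> = exp (of_real c * w + (of_real n * v\<^sup>2 / 2 + v * of_real l))"
    unfolding exp_add[of _ "- (\<i> * of_real (2 * pi * of_int m))"]
    using exp_integer_2pi[of "of_int (- m)"] by (simp add: exp_minus mult_ac)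
  finally show ?thesis unfolding exp_add c_def n_def v_def l_def .
qed

lemma mean_uniform:
  assumes R: "R > 0" and \<delta>: "\<delta> > 0"
  shows "\<forall>\<^sub>F N in sequentially. \<forall>w. norm w \<le> R \<longrightarrow> norm (of_nat N * mgf N (beta_at N w) - exp (of_real (sqrt 2 * \<tau>) * w)) \<le> \<delta>"
proof -
  define q where "q = (\<lambda>N. logN N * (window_radius R N)\<^sup>2 / 2 + window_radius R N * \<bar>loglog N\<bar>)"
  define E where "E = exp (sqrt 2 * \<tau> * R)"
  have "(\<lambda>N. E * (q N * exp (q N))) \<longlonglongrightarrow> E * (0 * exp 0)"
  proof (intro tendsto_mult tendsto_const tendsto_exp)
    show "q \<longlonglongrightarrow> 0" unfolding q_def by (rule window_radius_limits(2))
    then show "q \<longlonglongrightarrow> 0" .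
  qed
  then have "\<forall>\<^sub>F N in sequentially. E * (q N * exp (q N)) < \<delta>" using order_tendstoD(2)[OF _ \<delta>] by simp
  with eventually_ge_at_top[of 2] show ?thesis
  proof eventually_elim
    case (elim N)
    show ?case
    proof (intro allI impI)
      fix w :: complex assume w: "norm w \<le> R"
      define v where "v = beta_at N w - \<beta>0"
      define \<rho> where "\<rho> = of_real (logN N) * v\<^sup>2 / 2 + v * of_real (loglog N / (2 * sqrt 2))"
      have n: "logN N > 0" by (rule logN_pos[OF elim(1)])
      have v: "norm v \<le> window_radius R N" unfolding v_def by (rule beta_at_dist[OF elim(1) w])
      have "norm \<rho> \<le> norm (of_real (logN N) * v\<^sup>2 / 2) + norm (v * of_real (loglog N / (2 * sqrt 2)))"
        unfolding \<rho>_def by (rule norm_triangle_ineq)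
      also have "norm (of_real (logN N) * v\<^sup>2 / 2) = logN N * (norm v)\<^sup>2 / 2" using n by (simp add: norm_mult norm_divide norm_power)
      also have "logN N * (norm v)\<^sup>2 / 2 \<le> logN N * (window_radius R N)\<^sup>2 / 2"
        using n v by (intro divide_right_mono mult_left_mono power_mono) auto
      also have "norm (v * of_real (loglog N / (2 * sqrt 2))) = norm v * (\<bar>loglog N\<bar> / (2 * sqrt 2))" unfolding norm_mult norm_of_real by simp
      also have "\<dots> \<le> window_radius R N * \<bar>loglog N\<bar>"
      proof (rule mult_mono[OF v])
        have "1 \<le> 2 * sqrt (2::real)" using real_sqrt_ge_one[of 2] by linarith
        then show "\<bar>loglog N\<bar> / (2 * sqrt 2) \<le> \<bar>loglog N\<bar>" by (simp add: divide_le_eq mult_le_cancel_left1)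
      qed (use order_trans[OF norm_ge_zero v] in auto)
      finally have rq: "norm \<rho> \<le> q N" unfolding q_def by simp
      have "norm (exp (of_real (sqrt 2 * \<tau>) * w)) \<le> E"
        unfolding E_def using tau order.trans[OF complex_Re_le_cmod w] by (simp add: mult_left_mono)
      moreover have "norm (exp \<rho> - 1) \<le> q N * exp (q N)"
        by (rule order.trans[OF norm_exp_minus_one_le mult_mono[OF rq]]) (use rq order_trans[OF norm_ge_zero rq] in auto)
      ultimately have "norm (exp (of_real (sqrt 2 * \<tau>) * w) * (exp \<rho> - 1)) \<le> E * (q N * exp (q N))"
        unfolding norm_mult by (intro mult_mono) (auto simp: E_def)
      then show "norm (of_nat N * mgf N (beta_at N w) - exp (of_real (sqrt 2 * \<tau>) * w)) \<le> \<delta>"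
        unfolding mean_at[OF elim(1)] v_def[symmetric] \<rho>_def[symmetric] using elim(2) by (simp add: right_diff_distrib)
    qed
  qed
qed

lemma holomorphic_expo_beta_at: "(\<lambda>w. expo (beta_at N w) y) holomorphic_on UNIV" "(\<lambda>w. mgf N (beta_at N w)) holomorphic_on UNIV"
  unfolding expo_def beta_at_def mgf_def divide_inverse by (intro holomorphic_intros)+

end

context rem_model
begin

abbreviation "window_sum N w \<omega> \<equiv> \<Sum>k=1..N. expo (beta_at N w) (Y N k \<omega>)"

text \<open>
  The level \<open>B\<close> is chosen first, such that no \<open>y\<^sub>k\<close> exceeds it except with small probability.  On that
  event the truncation has no effect, and the truncated deviation tends to zero for each
  fixed \<open>B\<close>.
\<close>

theorem deviation_uniform:
  assumes R: "R > 0" and \<delta>: "\<delta> > 0" and \<epsilon>: "\<epsilon> > 0"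
  shows "\<forall>\<^sub>F N in sequentially. \<exists>A\<in>events. prob A \<ge> 1 - \<epsilon> \<and> (\<forall>\<omega>\<in>A. \<forall>w. norm w \<le> R \<longrightarrow>
     norm (window_sum N w \<omega> - of_nat N * mgf N (beta_at N w) - centred_sum N \<omega>) \<le> \<delta>)"
proof -
  have t0: "((\<lambda>B. 2 * exp (- \<kappa> * B) * decay_integral) \<longlongrightarrow> 0) at_top" using kappa(1) by real_asymp
  then have "\<forall>\<^sub>F B in at_top. 2 * exp (- \<kappa> * B) * decay_integral < \<epsilon> / 2 \<and> B \<ge> 0"
    by (intro eventually_conj eventually_ge_at_top order_tendstoD(2)[OF t0 half_gt_zero[OF \<epsilon>]])
  from eventually_happens'[OF trivial_limit_at_top_linorder this] obtain B where B: "2 * exp (- \<kappa> * B) * decay_integral < \<epsilon> / 2" "B \<ge> 0" by auto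
  have mC: "deviation_const B \<ge> 0" unfolding deviation_const_def low_part_weight_def using decay_integral_nonneg kappa(1) by (intro add_nonneg_nonneg divide_nonneg_nonneg mult_nonneg_nonneg) auto
  have t1: "(\<lambda>N. 2 * (deviation_const B * window_radius (2 * R) N) / \<delta>) \<longlonglongrightarrow> 2 * (deviation_const B * 0) / \<delta>"
    using \<delta> by (intro tendsto_intros window_radius_limits) auto
  then have ev1: "\<forall>\<^sub>F N in sequentially. 2 * (deviation_const B * window_radius (2 * R) N) / \<delta> < \<epsilon> / 2"
    using order_tendstoD(2)[OF t1, of "\<epsilon> / 2"] \<epsilon> by simp
  have ev2: "\<forall>\<^sub>F N in sequentially. window_radius (2 * R) N < \<kappa> / 2"
    using order_tendstoD(2)[OF window_radius_limits(1), of "\<kappa> / 2" "2 * R"] kappa(1) by simp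
  from eventually_ge_at_top[of 2] level_density_bound ev1 ev2
  show ?thesis
  proof eventually_elim
    case (elim N)
    note N = elim(1)
    from elim(2) have d: "\<And>y. level_density N y \<le> 2 * envelope y" by blast
    define D where "D = (\<lambda>w \<omega>. (\<Sum>k=1..N. (expo (beta_at N w) (Y N k \<omega>) - expo \<beta>0 (Y N k \<omega>)) * indicator {..B} (Y N k \<omega>))
       - of_nat N * (mgf N (beta_at N w) - mgf N \<beta>0))"
    have rp: "window_radius (2 * R) N > 0" using window_radius_pos[OF N, of "2 * R"] R by simp
    have "\<exists>A\<in>events. prob A \<ge> 1 - 2 * (deviation_const B * window_radius (2 * R) N) / \<delta> \<and> (\<forall>\<omega>\<in>A. \<forall>w. norm w \<le> R \<longrightarrow> norm (D w \<omega>) \<le> \<delta>)"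
    proof (rule analytic_sup_small[OF _ _ R _ \<delta>])
      show "(\<lambda>w. D w \<omega>) holomorphic_on UNIV" for \<omega>
        unfolding D_def by (intro holomorphic_intros holomorphic_expo_beta_at)
      have [measurable]: "beta_at N \<in> borel_measurable borel"
        unfolding beta_at_def[abs_def] by measurable
      have [measurable]: "mgf N \<in> borel_measurable borel" unfolding mgf_def[abs_def] by measurable
      have 1: "(\<lambda>(w, \<omega>). (expo (beta_at N w) (Y N k \<omega>) - expo \<beta>0 (Y N k \<omega>)) * indicator {..B} (Y N k \<omega>)) \<in> borel_measurable (borel \<Otimes>\<^sub>M M)" if "k \<in> {1..N}" for k
      proof -
        have [measurable]: "Y N k \<in> borel_measurable M" using measurable_Y[of k] that by simp
        show ?thesis unfolding expo_def by measurable
      qed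
      have "(\<lambda>x. \<Sum>k=1..N. (case x of (w, \<omega>) \<Rightarrow> (expo (beta_at N w) (Y N k \<omega>) - expo \<beta>0 (Y N k \<omega>)) * indicator {..B} (Y N k \<omega>))) \<in> borel_measurable (borel \<Otimes>\<^sub>M M)"
        by (rule borel_measurable_sum[OF 1])
      moreover have "(\<lambda>x. of_nat N * (mgf N (beta_at N (fst x)) - mgf N \<beta>0)) \<in> borel_measurable (borel \<Otimes>\<^sub>M M)" by measurable
      ultimately have "(\<lambda>x. (\<Sum>k=1..N. (case x of (w, \<omega>) \<Rightarrow> (expo (beta_at N w) (Y N k \<omega>) - expo \<beta>0 (Y N k \<omega>)) * indicator {..B} (Y N k \<omega>)))
         - of_nat N * (mgf N (beta_at N (fst x)) - mgf N \<beta>0)) \<in> borel_measurable (borel \<Otimes>\<^sub>M M)" by (rule borel_measurable_diff)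
      then show "(\<lambda>(w, \<omega>). D w \<omega>) \<in> borel_measurable (borel \<Otimes>\<^sub>M M)"
        unfolding D_def by (simp add: case_prod_beta)
      show "0 \<le> deviation_const B * window_radius (2 * R) N" using mC rp by simp
      show "(\<integral>\<^sup>+\<omega>. norm (D w \<omega>) \<partial>M) \<le> ennreal (deviation_const B * window_radius (2 * R) N)" if "norm w = 2 * R" for w
        unfolding D_def by (rule truncated_deviation[OF N d B(2) beta_at_dist[OF N]]) (use that elim(4) rp in auto)
    qed
    then obtain A where A: "A \<in> events" "prob A \<ge> 1 - 2 * (deviation_const B * window_radius (2 * R) N) / \<delta>"
      "\<And>\<omega> w. \<omega> \<in> A \<Longrightarrow> norm w \<le> R \<Longrightarrow> norm (D w \<omega>) \<le> \<delta>" by blast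
    define X' where "X' = (\<Union>k\<in>{1..N}. {\<omega> \<in> space M. Y N k \<omega> > B})"
    have X': "X' \<in> events" unfolding X'_def
    proof (rule sets.finite_UN)
      show "{\<omega> \<in> space M. Y N k \<omega> > B} \<in> events" if "k \<in> {1..N}" for k
      proof -
        have [measurable]: "Y N k \<in> borel_measurable M" using measurable_Y[of k] that by simp
        show ?thesis by measurable
      qed
    qed simp
    have pX: "prob X' \<le> \<epsilon> / 2" using exceedance_prob[OF N d B(2)] B(1) unfolding X'_def by linarith
    show ?case
    proof (intro bexI[of _ "A - X'"] conjI ballI allI impI)
      show "A - X' \<in> events" using A(1) X' by auto
      have "prob A \<le> prob (A - X') + prob X'"
        using finite_measure_Diff'[OF A(1) X'] finite_measure_mono[of "A \<inter> X'" X'] X' by simp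
      then show "1 - \<epsilon> \<le> prob (A - X')" using A(2) elim(3) pX by linarith
      fix \<omega> and w :: complex assume \<omega>: "\<omega> \<in> A - X'" and w: "norm w \<le> R"
      have "\<omega> \<in> space M" using \<omega> sets.sets_into_space[OF A(1)] by auto
      then have "Y N k \<omega> \<le> B" if "k \<in> {1..N}" for k using \<omega> that unfolding X'_def by force
      then have "(\<Sum>k=1..N. (expo (beta_at N w) (Y N k \<omega>) - expo \<beta>0 (Y N k \<omega>)) * indicator {..B} (Y N k \<omega>)) = (\<Sum>k=1..N. expo (beta_at N w) (Y N k \<omega>) - expo \<beta>0 (Y N k \<omega>))"
        by (intro sum.cong refl) auto
      then have "window_sum N w \<omega> - of_nat N * mgf N (beta_at N w) - centred_sum N \<omega> = D w \<omega>"
        unfolding D_def centred_sum_def by (simp add: sum_subtractf algebra_simps)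
      then show "norm (window_sum N w \<omega> - of_nat N * mgf N (beta_at N w) - centred_sum N \<omega>) \<le> \<delta>"
        using A(3)[of \<omega> w] \<omega> w by simp
    qed
  qed
qed

end

section \<open>Convergence of the zeros\<close>

context rem_model
begin

abbreviation "rem_zeros f N \<omega> \<equiv>
  sum_zeros (rem_partition X N \<omega>) (\<lambda>\<beta>. f (rotation * of_real (logN N) * (\<beta> - \<beta>0) - zero_offset N))"

definition "limit_zeros f s = sum_zeros (\<lambda>w. exp (of_real (sqrt 2 * \<tau>) * w) + s) f"

context
  fixes f :: "complex \<Rightarrow> real" and R :: real
  assumes f: "continuous_on UNIV f" and supp: "\<And>z. norm z > R \<Longrightarrow> f z = 0" and R: "R \<ge> 0"
begin

definition "zero_sum N \<omega> = sum_zeros (\<lambda>w. window_sum N w \<omega>) f"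

lemma rem_zeros_eq:
  assumes N: "N \<ge> 2"
  shows "rem_zeros f N \<omega> = zero_sum N \<omega>"
proof -
  have n: "logN N > 0" by (rule logN_pos[OF N])
  have "rem_zeros f N \<omega> =
     sum_zeros (\<lambda>w. exp (- beta_at N w * of_real (centring N)) * rem_partition X N \<omega> (\<beta>0 + (w + zero_offset N) / (rotation * of_real (logN N)))) f"
  proof (rule sum_zeros_affine)
    show "rem_partition X N \<omega> holomorphic_on UNIV" unfolding rem_partition_def[abs_def] by (intro holomorphic_intros)
    show "rem_partition X N \<omega> 0 \<noteq> 0" using N by (simp add: rem_partition_def)
    show "(\<lambda>w. exp (- beta_at N w * of_real (centring N))) holomorphic_on UNIV"
      unfolding beta_at_def divide_inverse by (intro holomorphic_intros)
  qed (use n rotation in auto)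
  also have "(\<lambda>w. exp (- beta_at N w * of_real (centring N)) * rem_partition X N \<omega> (\<beta>0 + (w + zero_offset N) / (rotation * of_real (logN N))))
     = (\<lambda>w. window_sum N w \<omega>)"
    unfolding beta_at_def[symmetric] unfolding rem_partition_def sum_distrib_left expo_def Y_def logN_def[symmetric]
    by (intro ext sum.cong refl) (simp add: exp_add[symmetric] algebra_simps)
  finally show ?thesis unfolding zero_sum_def .
qed

text \<open>
  For \<open>N \<ge> 2\<close> the sum over zeros is a continuous function of the variables, by \<open>continuous_sum_zeros\<close>; for
  \<open>N \<le> 1\<close> the partition function is constant on the probability space.
\<close>

lemma measurable_rem_zeros:
  "(\<lambda>\<omega>. rem_zeros f N \<omega>) \<in> borel_measurable M"
proof (cases "N \<ge> 2")
  case False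
  then consider "N = 0" | "N = 1" by linarith
  then have "\<exists>F. \<forall>\<omega>. rem_partition X N \<omega> = F"
    by cases (auto simp: rem_partition_def[abs_def])
  then obtain F where "\<And>\<omega>. rem_partition X N \<omega> = F" by blast
  then show ?thesis by simp
next
  case N: True
  have n: "logN N > 0" by (rule logN_pos[OF N])
  define F where "F = (\<lambda>(x :: nat \<Rightarrow> real) w. \<Sum>k=1..N. expo (beta_at N w) (sqrt (logN N) * x k - centring N))"
  define x where "x = (\<lambda>\<omega> k. if k \<ge> 1 then X k \<omega> else 0)"
  have "continuous_on UNIV (\<lambda>x. sum_zeros (F x) f)"
  proof (rule continuous_sum_zeros[OF _ _ _ f supp])
    show "F x holomorphic_on UNIV" for x unfolding F_def by (intro holomorphic_intros holomorphic_expo_beta_at)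
    show "\<exists>p. F x p \<noteq> 0" for x
    proof
      \<comment> \<open>the window variable that corresponds to \<open>\<beta> = 0\<close>, where the sum is \<open>N\<close>\<close>
      have "beta_at N (- \<beta>0 * (rotation * of_real (logN N)) - zero_offset N) = 0" unfolding beta_at_def using n rotation by simp
      then show "F x (- \<beta>0 * (rotation * of_real (logN N)) - zero_offset N) \<noteq> 0" using N by (simp add: F_def expo_def)
    qed
    have "continuous_on UNIV (\<lambda>p :: (nat \<Rightarrow> real) \<times> complex. fst p k)" for k
    proof -
      have "continuous_on UNIV (\<lambda>x :: nat \<Rightarrow> real. x k)" by (rule continuous_on_product_coordinates)
      from continuous_on_compose2[OF this continuous_on_fst[OF continuous_on_id]] show ?thesis by auto
    qed
    then show "continuous_on UNIV (\<lambda>(x, w). F x w)"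
      unfolding F_def expo_def beta_at_def case_prod_beta divide_inverse by (intro continuous_intros) auto
  qed
  then have [measurable]: "(\<lambda>x. sum_zeros (F x) f) \<in> borel_measurable borel" by (rule borel_measurable_continuous_onI)
  have [measurable]: "x \<in> borel_measurable M"
  proof (rule measurable_coordinatewise_then_product)
    show "(\<lambda>\<omega>. x \<omega> k) \<in> borel_measurable M" for k
      unfolding x_def using measurable_X[of k] by (cases "k \<ge> 1") auto
  qed
  have "(\<lambda>\<omega>. sum_zeros (F (x \<omega>)) f) \<in> borel_measurable M" by measurable
  moreover have "sum_zeros (F (x \<omega>)) f = rem_zeros f N \<omega>" for \<omega>
  proof -
    have "F (x \<omega>) = (\<lambda>w. window_sum N w \<omega>)" unfolding F_def x_def Y_def by (intro ext sum.cong refl) auto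
    then show ?thesis unfolding rem_zeros_eq[OF N] zero_sum_def by simp
  qed
  ultimately show ?thesis by simp
qed

lemma continuous_limit_zeros: "continuous_on UNIV (limit_zeros f)"
  unfolding limit_zeros_def
proof (rule continuous_sum_zeros[OF _ _ _ f supp])
  show "(\<lambda>w. exp (complex_of_real (sqrt 2 * \<tau>) * w) + s) holomorphic_on UNIV" for s by (intro holomorphic_intros)
  show "\<exists>p. exp (complex_of_real (sqrt 2 * \<tau>) * p) + s \<noteq> 0" for s
  proof -
    have "exp (complex_of_real (sqrt 2 * \<tau>) * 0) + s \<noteq> exp (complex_of_real (sqrt 2 * \<tau>) * (1 / of_real (sqrt 2 * \<tau>))) + s"
    proof -
      have "exp (1 :: complex) = of_real (exp 1)" using exp_of_real[of 1] by simp
      then have "exp (1 :: complex) \<noteq> 1" by (metis exp_eq_one_iff of_real_eq_1_iff zero_neq_one)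
      then show ?thesis using tau by simp
    qed
    then show ?thesis by metis
  qed
  show "continuous_on UNIV (\<lambda>(s, w). exp (complex_of_real (sqrt 2 * \<tau>) * w) + s)"
    unfolding case_prod_beta by (intro continuous_intros)
qed

text \<open>
  In the window the rescaled partition function is uniformly close to \<open>exp (c w) + s\<close> with \<open>s\<close> the centred
  sum; the uniformity in \<open>s\<close> of \<open>sum_zeros_exp_shift_uniform\<close> replaces tightness of the centred sums.
\<close>

lemma zero_sum_close:
  assumes \<delta>: "\<delta> > 0" and \<epsilon>: "\<epsilon> > 0"
  shows "\<forall>\<^sub>F N in sequentially. \<exists>A\<in>events. prob A \<ge> 1 - \<epsilon> \<and> (\<forall>\<omega>\<in>A. \<bar>zero_sum N \<omega> - limit_zeros f (centred_sum N \<omega>)\<bar> < \<delta>)"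
proof -
  have c: "sqrt 2 * \<tau> > 0" using tau by simp
  obtain d where d: "d > 0" "\<And>G s. G holomorphic_on UNIV \<Longrightarrow> (\<And>z. z \<in> cball 0 (R+1) \<Longrightarrow> norm (G z - (exp (of_real (sqrt 2 * \<tau>) * z) + s)) \<le> d) \<Longrightarrow>
       \<bar>sum_zeros G f - sum_zeros (\<lambda>w. exp (of_real (sqrt 2 * \<tau>) * w) + s) f\<bar> < \<delta>"
    using sum_zeros_exp_shift_uniform[OF c f supp R \<delta>] by blast
  have R1: "R + 1 > 0" using R by simp
  have d2: "d / 2 > 0" using d(1) by simp
  from deviation_uniform[OF R1 d2 \<epsilon>] mean_uniform[OF R1 d2]
  show ?thesis
  proof eventually_elim
    case (elim N)
    then obtain A where A: "A \<in> events" "prob A \<ge> 1 - \<epsilon>"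
      "\<And>\<omega> w. \<omega> \<in> A \<Longrightarrow> norm w \<le> R + 1 \<Longrightarrow> norm (window_sum N w \<omega> - of_nat N * mgf N (beta_at N w) - centred_sum N \<omega>) \<le> d / 2" by blast
    have "\<bar>zero_sum N \<omega> - limit_zeros f (centred_sum N \<omega>)\<bar> < \<delta>" if \<omega>: "\<omega> \<in> A" for \<omega>
      unfolding zero_sum_def limit_zeros_def
    proof (rule d(2))
      show "(\<lambda>w. window_sum N w \<omega>) holomorphic_on UNIV" by (intro holomorphic_intros holomorphic_expo_beta_at)
      fix w :: complex assume "w \<in> cball 0 (R + 1)"
      then have w: "norm w \<le> R + 1" by simp
      let ?S = "window_sum N w \<omega>" and ?m = "of_nat N * mgf N (beta_at N w)" and ?e = "exp (of_real (sqrt 2 * \<tau>) * w)"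
      have "?S - (?e + centred_sum N \<omega>) = (?S - ?m - centred_sum N \<omega>) + (?m - ?e)" by simp
      then have "norm (?S - (?e + centred_sum N \<omega>)) \<le> norm (?S - ?m - centred_sum N \<omega>) + norm (?m - ?e)" by (metis norm_triangle_ineq)
      moreover have "norm (?m - ?e) \<le> d / 2" using elim(2) w by blast
      ultimately show "norm (?S - (?e + centred_sum N \<omega>)) \<le> d" using A(3)[OF \<omega> w] by linarith
    qed
    then show ?case using A by blast
  qed
qed

end

text \<open>The law of \<open>\<zeta>\<close>.\<close>

definition "limit_law = distr (density lborel (\<lambda>p. ennreal (planar.limit_density 0 p))) borel (\<lambda>p. Complex (fst p) (snd p))"

lemma measurable_Complex_pair [measurable]: "(\<lambda>p. Complex (fst p) (snd p)) \<in> borel_measurable (borel :: (real \<times> real) measure)"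
  by (intro borel_measurable_continuous_onI) (auto intro!: continuous_intros simp: Complex_eq)

lemma prob_space_limit_law: "prob_space limit_law"
proof -
  have "prob_space (density lborel (\<lambda>p. ennreal (planar.limit_density 0 p)))"
  proof
    have "(\<integral>\<^sup>+p. ennreal (planar.limit_density 0 p) \<partial>lborel) = ennreal (\<integral>p. planar.limit_density 0 p \<partial>lborel)"
      using planar.has_bochner_integral_limit_density(1) by (intro nn_integral_eq_integral) (auto intro: planar.limit_density_nonneg)
    then show "emeasure (density lborel (\<lambda>p. ennreal (planar.limit_density 0 p))) (space (density lborel (\<lambda>p. ennreal (planar.limit_density 0 p)))) = 1"
      by (simp add: emeasure_density planar.has_bochner_integral_limit_density)
  qed
  then show ?thesis unfolding limit_law_def by (rule prob_space.prob_space_distr) measurable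
qed

lemma sets_limit_law [measurable_cong]: "sets limit_law = sets borel" by (simp add: limit_law_def)

lemma integral_limit_law:
  fixes g :: "complex \<Rightarrow> real"
  assumes [measurable]: "g \<in> borel_measurable borel"
  shows "(\<integral>s. g s \<partial>limit_law) = (\<integral>p. g (Complex (fst p) (snd p)) * planar.limit_density 0 p \<partial>lborel)"
proof -
  have "(\<integral>s. g s \<partial>limit_law) = (\<integral>p. g (Complex (fst p) (snd p)) \<partial>(density lborel (\<lambda>p. ennreal (planar.limit_density 0 p))))"
    unfolding limit_law_def by (subst integral_distr) auto
  also have "\<dots> = (\<integral>p. planar.limit_density 0 p *\<^sub>R g (Complex (fst p) (snd p)) \<partial>lborel)"
    by (subst integral_density) (auto intro: planar.limit_density_nonneg)
  finally show ?thesis by (simp add: mult.commute)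
qed

text \<open>
  The law has a density, so it does not charge the origin, where the zeros of \<open>exp (c w) + s\<close> disappear and
  the formula with the logarithm fails.
\<close>

lemma limit_law_nonzero: "AE s in limit_law. s \<noteq> 0"
proof -
  have "AE p in lborel. p \<noteq> (0 :: real \<times> real)" by (rule AE_lborel_singleton)
  then have "AE p in density lborel (\<lambda>p. ennreal (planar.limit_density 0 p)). p \<noteq> 0"
    by (subst AE_density) auto
  then have "AE p in density lborel (\<lambda>p. ennreal (planar.limit_density 0 p)). Complex (fst p) (snd p) \<noteq> 0"
    by eventually_elim (auto simp: complex_eq_iff prod_eq_iff)
  then show ?thesis unfolding limit_law_def by (subst AE_distr_iff) auto
qed

text \<open>
  The sum over the zeros of \<open>exp (c w) + s\<close> is a continuous function \<open>H\<close> of \<open>s\<close> that vanishes for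
  large \<open>s\<close>.  So for continuous \<open>G\<close> the function \<open>G \<circ> H\<close> differs from the constant \<open>G 0\<close> by a
  test function with compact support, to which the convergence of the centred sums applies.
  The actual sum over zeros differs from \<open>H\<close> at the centred sum by a quantity that tends to zero in
  probability.
\<close>

theorem rem_zeros_converge:
  fixes f :: "complex \<Rightarrow> real"
  assumes f: "continuous_on UNIV f" and fc: "compact (closure {z. f z \<noteq> 0})"
  shows "converges_in_distribution M
     (\<lambda>N \<omega>. rem_zeros f N \<omega>)
     limit_law (\<lambda>s. \<Sum>\<^sub>\<infinity>k\<in>(UNIV :: int set). f ((2 * of_real pi * \<i> * of_int k + Ln (- s)) / of_real (sqrt 2 * \<tau>)))"
proof -
  have "bounded {z. f z \<noteq> 0}" using compact_imp_bounded[OF fc] bounded_subset[OF _ closure_subset] by blast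
  then obtain R0 where R0: "\<And>z. f z \<noteq> 0 \<Longrightarrow> norm z \<le> R0" unfolding bounded_iff by blast
  define R where "R = max R0 0"
  have R: "R \<ge> 0" and supp: "\<And>z. norm z > R \<Longrightarrow> f z = 0" using R0 unfolding R_def by force+
  define \<Phi> where "\<Phi> = (\<lambda>N \<omega>. rem_zeros f N \<omega>)"
  define H where "H = limit_zeros f"
  define Y' where "Y' = (\<lambda>s. \<Sum>\<^sub>\<infinity>k\<in>(UNIV :: int set). f ((2 * of_real pi * \<i> * of_int k + Ln (- s)) / of_real (sqrt 2 * \<tau>)))"
  have c: "sqrt 2 * \<tau> > 0" using tau by simp
  have mPhi [measurable]: "\<Phi> N \<in> borel_measurable M" for N unfolding \<Phi>_def by (rule measurable_rem_zeros[OF f supp R])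
  have cH: "continuous_on UNIV H" unfolding H_def by (rule continuous_limit_zeros[OF f supp R])
  then have mH [measurable]: "H \<in> borel_measurable borel" by (rule borel_measurable_continuous_onI)
  have YH: "Y' s = H s" if "s \<noteq> 0" for s
    unfolding Y'_def H_def limit_zeros_def by (rule sum_zeros_exp_shift[symmetric]) (use c that in auto)
  have "Y' = (\<lambda>s. if s = 0 then Y' 0 else H s)" using YH by auto
  moreover have "(\<lambda>s. if s = 0 then Y' 0 else H s) \<in> borel_measurable borel" by measurable
  ultimately have mY [measurable]: "Y' \<in> borel_measurable borel" by simp
  have Hfar: "H s = 0" if "norm s > exp (sqrt 2 * \<tau> * R)" for s
    unfolding H_def limit_zeros_def by (rule exp_shift_zeros_far[OF less_imp_le[OF c] supp that])
  interpret L: prob_space limit_law by (rule prob_space_limit_law)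
  have conv: "(\<lambda>N. \<integral>x. cts_step a b x \<partial>(distr M borel (\<Phi> N))) \<longlonglongrightarrow> (\<integral>x. cts_step a b x \<partial>(distr limit_law borel Y'))" if ab: "a < b" for a b
  proof -
    define G where "G = cts_step a b"
    have G01: "0 \<le> G x" "G x \<le> 1" for x using ab by (auto simp: G_def cts_step_def)
    have uG: "uniformly_continuous_on UNIV G" unfolding G_def by (rule cts_step_uniformly_continuous[OF ab])
    have cG: "continuous_on UNIV G" by (rule uniformly_continuous_imp_continuous[OF uG])
    then have mG [measurable]: "G \<in> borel_measurable borel" by (rule borel_measurable_continuous_onI)
    have iG: "integrable M (\<lambda>\<omega>. G (u \<omega>))" if [measurable]: "u \<in> borel_measurable M" for u
      by (rule integrable_const_bound[of _ 1]) (use G01 in auto)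
    define h where "h = (\<lambda>p :: real \<times> real. G (H (Complex (fst p) (snd p))) - G 0)"
    have hc: "continuous_on UNIV h"
    proof -
      have cc: "continuous_on UNIV (\<lambda>p :: real \<times> real. Complex (fst p) (snd p))" by (auto intro!: continuous_intros simp: Complex_eq)
      have "continuous_on UNIV (\<lambda>p :: real \<times> real. H (Complex (fst p) (snd p)))"
        by (rule continuous_on_compose2[OF cH cc]) auto
      from continuous_on_compose2[OF cG this] show ?thesis unfolding h_def by (intro continuous_intros) auto
    qed
    have hs: "h p = 0" if "norm p > exp (sqrt 2 * \<tau> * R)" for p
    proof -
      have "norm (Complex (fst p) (snd p)) = norm p" by (cases p) (simp add: norm_Pair complex_norm)
      then show ?thesis unfolding h_def using Hfar that by simp
    qed
    have "(\<lambda>N. \<integral>\<omega>. h (centred_sum_pair N \<omega>) \<partial>M) \<longlonglongrightarrow> (\<integral>p. h p * planar.limit_density 0 p \<partial>lborel)"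
      by (rule planar.expectation_tendsto[OF hc hs])
    moreover have "(\<integral>\<omega>. h (centred_sum_pair N \<omega>) \<partial>M) = (\<integral>\<omega>. G (H (centred_sum N \<omega>)) \<partial>M) - G 0" for N
      unfolding h_def centred_sum_pair_def using iG[of "\<lambda>\<omega>. H (centred_sum N \<omega>)"] by (simp add: prob_space)
    moreover have "(\<integral>p. h p * planar.limit_density 0 p \<partial>lborel) = (\<integral>s. G (H s) \<partial>limit_law) - G 0"
    proof -
      have "(\<integral>p. h p * planar.limit_density 0 p \<partial>lborel) = (\<integral>s. G (H s) - G 0 \<partial>limit_law)"
        unfolding h_def by (rule integral_limit_law[symmetric]) measurable
      also have "\<dots> = (\<integral>s. G (H s) \<partial>limit_law) - G 0"
      proof -
        have "integrable limit_law (\<lambda>s. G (H s))" by (rule L.integrable_const_bound[of _ 1]) (use G01 in auto)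
        then show ?thesis by (simp add: L.prob_space)
      qed
      finally show ?thesis .
    qed
    ultimately have "(\<lambda>N. (\<integral>\<omega>. G (H (centred_sum N \<omega>)) \<partial>M) - G 0) \<longlonglongrightarrow> (\<integral>s. G (H s) \<partial>limit_law) - G 0" by simp
    from tendsto_add[OF this tendsto_const[of "G 0"]]
    have l1: "(\<lambda>N. \<integral>\<omega>. G (H (centred_sum N \<omega>)) \<partial>M) \<longlonglongrightarrow> (\<integral>s. G (H s) \<partial>limit_law)" by simp
    have l2: "(\<lambda>N. (\<integral>\<omega>. G (\<Phi> N \<omega>) \<partial>M) - (\<integral>\<omega>. G (H (centred_sum N \<omega>)) \<partial>M)) \<longlonglongrightarrow> 0"
    proof (rule tendstoI)
      fix e :: real assume e: "e > 0"
      then have e3: "e / 3 > 0" by simp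
      obtain \<delta> where \<delta>: "\<delta> > 0" "\<And>x y. dist x y < \<delta> \<Longrightarrow> dist (G x) (G y) < e / 3"
        using uG e3 unfolding uniformly_continuous_on_def by (meson UNIV_I)
      have "\<forall>\<^sub>F N in sequentially. \<exists>A\<in>events. prob A \<ge> 1 - e / 3 \<and> (\<forall>\<omega>\<in>A. \<bar>zero_sum f N \<omega> - limit_zeros f (centred_sum N \<omega>)\<bar> < \<delta>)"
        by (rule zero_sum_close[OF f supp R \<delta>(1) e3])
      with eventually_ge_at_top[of 2]
      show "\<forall>\<^sub>F N in sequentially. dist ((\<integral>\<omega>. G (\<Phi> N \<omega>) \<partial>M) - (\<integral>\<omega>. G (H (centred_sum N \<omega>)) \<partial>M)) 0 < e"
      proof eventually_elim
        case (elim N)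
        obtain A where A: "A \<in> events" "prob A \<ge> 1 - e / 3" "\<And>\<omega>. \<omega> \<in> A \<Longrightarrow> \<bar>zero_sum f N \<omega> - limit_zeros f (centred_sum N \<omega>)\<bar> < \<delta>"
          using elim(2) by blast
        have b: "\<bar>G (\<Phi> N \<omega>) - G (H (centred_sum N \<omega>))\<bar> \<le> e / 3 + indicator (space M - A) \<omega>" if "\<omega> \<in> space M" for \<omega>
        proof (cases "\<omega> \<in> A")
          case True
          have "dist (\<Phi> N \<omega>) (H (centred_sum N \<omega>)) < \<delta>"
          proof -
            have "\<Phi> N \<omega> = zero_sum f N \<omega>" unfolding \<Phi>_def by (rule rem_zeros_eq[OF f supp R elim(1)])
            then show ?thesis using A(3)[OF True] unfolding H_def dist_real_def by simp
          qed
          then show ?thesis using \<delta>(2) True by (force simp: dist_real_def intro: less_imp_le)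
        next
          case False
          then show ?thesis using that G01[of "\<Phi> N \<omega>"] G01[of "H (centred_sum N \<omega>)"] e by (simp add: abs_le_iff)
        qed
        have "\<bar>(\<integral>\<omega>. G (\<Phi> N \<omega>) \<partial>M) - (\<integral>\<omega>. G (H (centred_sum N \<omega>)) \<partial>M)\<bar> = \<bar>\<integral>\<omega>. G (\<Phi> N \<omega>) - G (H (centred_sum N \<omega>)) \<partial>M\<bar>"
          using iG[of "\<Phi> N"] iG[of "\<lambda>\<omega>. H (centred_sum N \<omega>)"] by simp
        also have "\<dots> \<le> (\<integral>\<omega>. \<bar>G (\<Phi> N \<omega>) - G (H (centred_sum N \<omega>))\<bar> \<partial>M)" by (rule integral_abs_bound)
        also have "\<dots> \<le> (\<integral>\<omega>. e / 3 + indicator (space M - A) \<omega> \<partial>M)"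
        proof (rule integral_mono)
          show "integrable M (\<lambda>\<omega>. \<bar>G (\<Phi> N \<omega>) - G (H (centred_sum N \<omega>))\<bar>)" using iG[of "\<Phi> N"] iG[of "\<lambda>\<omega>. H (centred_sum N \<omega>)"] by simp
          show "integrable M (\<lambda>\<omega>. e / 3 + indicator (space M - A) \<omega>)" using A(1) by (intro Bochner_Integration.integrable_add integrable_const integrable_real_indicator) (auto simp: less_top[symmetric])
        qed (rule b)
        also have "\<dots> = e / 3 + prob (space M - A)" using A(1) by (subst Bochner_Integration.integral_add) (auto simp: prob_space emeasure_eq_measure)
        also have "\<dots> \<le> e / 3 + e / 3" using A(2) prob_compl[OF A(1)] by simp
        finally show ?case using e by (simp add: dist_real_def)
      qed
    qed
    have "(\<lambda>N. \<integral>\<omega>. G (\<Phi> N \<omega>) \<partial>M) \<longlonglongrightarrow> (\<integral>s. G (H s) \<partial>limit_law)"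
      using tendsto_add[OF l2 l1] by simp
    moreover have "(\<integral>s. G (H s) \<partial>limit_law) = (\<integral>s. G (Y' s) \<partial>limit_law)"
      by (rule integral_cong_AE) (use limit_law_nonzero YH in \<open>auto elim!: eventually_mono\<close>)
    ultimately show ?thesis unfolding G_def[symmetric] by (simp add: integral_distr)
  qed
  have "weak_conv_m (\<lambda>N. distr M borel (\<Phi> N)) (distr limit_law borel Y')"
    by (rule integral_cts_step_conv_imp_weak_conv[OF _ _ conv]) (auto intro!: real_distribution_distr L.real_distribution_distr)
  then show ?thesis unfolding converges_in_distribution_def using mPhi mY unfolding \<Phi>_def Y'_def by simp
qed

end

theorem theorem2p13:
  fixes M :: "'a measure" and X :: "nat \<Rightarrow> 'a \<Rightarrow> real" and \<sigma>\<^sub>0 \<tau>\<^sub>0 :: real and \<beta>\<^sub>0 :: complex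
  assumes "prob_space M"
    and "prob_space.indep_vars M (\<lambda>_. borel) X {1..}"
    and "\<And>k. k \<ge> 1 \<Longrightarrow> distributed M lborel (X k) std_normal_density"
    and "\<beta>\<^sub>0 = Complex \<sigma>\<^sub>0 \<tau>\<^sub>0"
    and "\<sigma>\<^sub>0 > 1 / sqrt 2" and "\<tau>\<^sub>0 > 0" and "\<sigma>\<^sub>0 + \<tau>\<^sub>0 = sqrt 2"
  shows "\<exists>(M' :: complex measure) (\<eta> :: complex \<Rightarrow> complex) (d :: nat \<Rightarrow> complex).
    prob_space M' \<and> \<eta> \<in> borel_measurable M' \<and>
    d \<in> O(\<lambda>N. complex_of_real (ln (ln (real N)))) \<and>
    (\<forall>f :: complex \<Rightarrow> real. continuous_on UNIV f \<longrightarrow> compact (closure {z. f z \<noteq> 0}) \<longrightarrow>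
      converges_in_distribution
        M (\<lambda>N \<omega>. sum_zeros (rem_partition X N \<omega>)
             (\<lambda>\<beta>. f (exp (3 * of_real pi * \<i> / 4) * of_real (ln (real N)) * (\<beta> - \<beta>\<^sub>0) - d N)))
        M' (\<lambda>\<omega>. \<Sum>\<^sub>\<infinity>k\<in>(UNIV :: int set).
             f ((2 * of_real pi * \<i> * of_int k + \<eta> \<omega>) / of_real (sqrt 2 * \<tau>\<^sub>0))))"
proof -
  interpret prob_space M by fact
  interpret rem_model \<sigma>\<^sub>0 \<tau>\<^sub>0 M X
    by unfold_locales (use assms in auto)
  have b: "\<beta>\<^sub>0 = \<beta>0" using assms(4) by (simp add: \<beta>0_def)
  have "(\<lambda>s. Ln (- s)) \<in> borel_measurable limit_law" by measurable
  moreover note prob_space_limit_law zero_offset_bigo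
  moreover have "converges_in_distribution
        M (\<lambda>N \<omega>. sum_zeros (rem_partition X N \<omega>)
             (\<lambda>\<beta>. f (exp (3 * of_real pi * \<i> / 4) * of_real (ln (real N)) * (\<beta> - \<beta>\<^sub>0) - zero_offset N)))
        limit_law (\<lambda>\<omega>. \<Sum>\<^sub>\<infinity>k\<in>(UNIV :: int set).
             f ((2 * of_real pi * \<i> * of_int k + Ln (- \<omega>)) / of_real (sqrt 2 * \<tau>\<^sub>0)))"
    if "continuous_on UNIV f" "compact (closure {z. f z \<noteq> 0})" for f
    using rem_zeros_converge[OF that] unfolding rotation_def logN_def b .
  ultimately show ?thesis
    by (intro exI[of _ limit_law] exI[of _ "\<lambda>s. Ln (- s)"] exI[of _ zero_offset]) blast
qed

end
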